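(* Let $\tau:\mathrm{SL}_2(\mathbb C)\to\mathrm{SL}_4(\mathbb R)$ be the representation given by restricting scalars, and let $\Gamma$ be a $P_2$-Anosov subgroup of $\mathrm{SL}_4(\mathbb R)$ such that the limit set $\Lambda_\Gamma^2$ of $\Gamma$ in the $2$-Grassmannian $\mathcal F_2(\mathbb R^4)$ is a topological $2$-sphere. If there is a conjugate $H$ of $\tau(\mathrm{SL}_2(\mathbb C))$ in $\mathrm{SL}_4(\mathbb R)$ such that $\Gamma\cap H$ is Zariski-dense in $H$, then the action of $\Gamma$ on $\mathbb{RP}^3$ is minimal.
   Context: The representation $\tau$ comes from identifying $\mathbb C^2$ with $\mathbb R^4$ as a real vector space. $\mathcal F_2(\mathbb R^4)$ is the Grassmannian of $2$-dimensional linear subspaces of $\mathbb R^4$, and $P_2<\mathrm{SL}_4(\mathbb R)$ is the stabilizer of such a subspace. For $g\in\mathrm{SL}_d(\mathbb R)$ let $\sigma_1(g)\ge\dots\ge\sigma_d(g)$ be its singular values. A finitely generated subgroup $\Gamma<\mathrm{SL}_d(\mathbb R)$ is $P_k$-Anosov if there are constants $c,C>0$ with $\log\frac{\sigma_k(\gamma)}{\sigma_{k+1}(\gamma)}\ge c|\gamma|-C$ for all $\gamma\in\Gamma$, where $|\cdot|$ is a word length on $\Gamma$ for a finite generating set (this is equivalent to the definition of Labourie and Guichard–Wienhard). The limit set $\Lambda_\Gamma^2\subset\mathcal F_2(\mathbb R^4)$ is the set of all limits of sequences $U_2(\gamma_j)$, with $(\gamma_j)$ a sequence of pairwise distinct elements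 of $\Gamma$, where for $\sigma_2(\gamma)>\sigma_3(\gamma)$, $U_2(\gamma)=k\,\mathrm{span}\{e_1,e_2\}$ for a decomposition $\gamma=k\,\mathrm{diag}(\sigma_1(\gamma),\dots,\sigma_4(\gamma))\,k'$ with $k,k'\in\mathrm{O}(4)$. "$\Gamma\cap H$ is Zariski-dense in $H$" means that $\Gamma\cap H$ and $H$ have the same Zariski closure in $\mathrm{SL}_4(\mathbb R)$. An action by homeomorphisms is minimal if every orbit is dense. *)

theory Defs
  imports "HOL-Analysis.Analysis" "HOL-Algebra.Generated_Groups"
begin

type_synonym mat4 = "real^4^4"

definition SL2C :: "(complex^2^2) set" where
  "SL2C = {A. det A = 1}"

definition SL4 :: "mat4 monoid" where
  "SL4 = \<lparr>carrier = {A. det A = 1}, mult = (**), one = mat 1\<rparr>"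

lemma group_SL4: "group SL4"
proof (rule groupI)
  fix A assume A: "A \<in> carrier SL4"
  then have "invertible A"
    by (simp add: SL4_def invertible_det_nz)
  then obtain B where B: "B ** A = mat 1"
    by (auto simp: invertible_def)
  have "det B * det A = 1"
    using arg_cong[OF B, of det] by (simp add: det_mul)
  then have "B \<in> carrier SL4"
    using A by (simp add: SL4_def)
  with B show "\<exists>B\<in>carrier SL4. B \<otimes>\<^bsub>SL4\<^esub> A = \<one>\<^bsub>SL4\<^esub>"
    by (auto simp: SL4_def)
qed (auto simp: SL4_def det_mul matrix_mul_assoc)


section \<open>Restriction of scalars\<close>

definition real_coords :: "complex^2 \<Rightarrow> real^4" where
  "real_coords z = vector [Re (z$1), Im (z$1), Re (z$2), Im (z$2)]"

definition complex_coords :: "real^4 \<Rightarrow> complex^2" where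
  "complex_coords x = vector [Complex (x$1) (x$2), Complex (x$3) (x$4)]"

definition tau :: "complex^2^2 \<Rightarrow> mat4" where
  "tau A = matrix (\<lambda>x. real_coords (A *v complex_coords x))"

lemma vector_4:
  fixes a b c d :: "'a::zero"
  shows "(vector [a, b, c, d] :: 'a^4) $ 1 = a"
    and "(vector [a, b, c, d] :: 'a^4) $ 2 = b"
    and "(vector [a, b, c, d] :: 'a^4) $ 3 = c"
    and "(vector [a, b, c, d] :: 'a^4) $ 4 = d"
  by (simp_all add: vector_def)

lemma complex_real_coords [simp]: "complex_coords (real_coords z) = z"
  by (simp add: complex_coords_def real_coords_def vec_eq_iff forall_2 vector_2 vector_4)

lemma real_complex_coords [simp]: "real_coords (complex_coords x) = x"
  by (simp add: complex_coords_def real_coords_def vec_eq_iff forall_4 vector_2 vector_4)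

lemma tau_mult_vec: "tau A *v x = real_coords (A *v complex_coords x)"
proof -
  have "linear (\<lambda>x. real_coords (A *v complex_coords x))"
    by (rule linearI)
      (simp_all add: complex_coords_def real_coords_def vec_eq_iff forall_4 vector_2 vector_4
        matrix_vector_mult_def sum_2 algebra_simps)
  then show ?thesis
    by (simp add: tau_def matrix_works)
qed

definition conjugate_tau_image :: "mat4 set \<Rightarrow> bool" where
  "conjugate_tau_image H \<longleftrightarrow>
     (\<exists>h\<in>carrier SL4. H = (\<lambda>A. h ** tau A ** matrix_inv h) ` SL2C)"


section \<open>Zariski closure\<close>

text \<open>On a finite-dimensional space, \<^const>\<open>real_polynomial_function\<close> describes the polynomials
  in the coordinates, here the matrix entries.\<close>

definition zariski_closure_SL4 :: "mat4 set \<Rightarrow> mat4 set" where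
  "zariski_closure_SL4 S = {A \<in> carrier SL4.
     \<forall>p. real_polynomial_function p \<longrightarrow> (\<forall>B\<in>S. p B = 0) \<longrightarrow> p A = 0}"

definition zariski_dense_in :: "mat4 set \<Rightarrow> mat4 set \<Rightarrow> bool" where
  "zariski_dense_in S H \<longleftrightarrow> zariski_closure_SL4 S = zariski_closure_SL4 H"


section \<open>Projective space and the Grassmannian of planes\<close>

definition quotient_topology :: "'a topology \<Rightarrow> ('a \<Rightarrow> 'b) \<Rightarrow> 'b topology" where
  "quotient_topology X q = topology (\<lambda>U. U \<subseteq> q ` topspace X \<and>
     openin X {x \<in> topspace X. q x \<in> U})"

lemma openin_quotient_topology:
  "openin (quotient_topology X q) U \<longleftrightarrow>
     U \<subseteq> q ` topspace X \<and> openin X {x \<in> topspace X. q x \<in> U}"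
proof -
  have "istopology (\<lambda>U. U \<subseteq> q ` topspace X \<and> openin X {x \<in> topspace X. q x \<in> U})"
    unfolding istopology_def
  proof (intro conjI allI impI)
    fix S T
    assume S: "S \<subseteq> q ` topspace X \<and> openin X {x \<in> topspace X. q x \<in> S}"
      and T: "T \<subseteq> q ` topspace X \<and> openin X {x \<in> topspace X. q x \<in> T}"
    have "{x \<in> topspace X. q x \<in> S \<inter> T} =
        {x \<in> topspace X. q x \<in> S} \<inter> {x \<in> topspace X. q x \<in> T}" by auto
    then show "openin X {x \<in> topspace X. q x \<in> S \<inter> T}"
      using S T by auto
    show "S \<inter> T \<subseteq> q ` topspace X" using S by auto
  next
    fix K
    assume K: "\<forall>S\<in>K. S \<subseteq> q ` topspace X \<and> openin X {x \<in> topspace X. q x \<in> S}"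
    have "{x \<in> topspace X. q x \<in> \<Union>K} = (\<Union>S\<in>K. {x \<in> topspace X. q x \<in> S})" by auto
    then show "openin X {x \<in> topspace X. q x \<in> \<Union>K}"
      using K by auto
    show "\<Union>K \<subseteq> q ` topspace X" using K by auto
  qed
  then show ?thesis
    by (simp add: quotient_topology_def topology_inverse')
qed

lemma topspace_quotient_topology: "topspace (quotient_topology X q) = q ` topspace X"
proof (rule antisym)
  have "openin (quotient_topology X q) (q ` topspace X)"
  proof -
    have "{x \<in> topspace X. q x \<in> q ` topspace X} = topspace X" by auto
    then show ?thesis by (simp add: openin_quotient_topology)
  qed
  then show "q ` topspace X \<subseteq> topspace (quotient_topology X q)"
    by (rule openin_subset)
  show "topspace (quotient_topology X q) \<subseteq> q ` topspace X"
    using openin_topspace[of "quotient_topology X q"] unfolding openin_quotient_topology by blast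
qed

definition RP3 :: "(real^4) set topology" where
  "RP3 = quotient_topology (top_of_set {v. v \<noteq> 0}) (\<lambda>v. span {v})"

definition Gr2 :: "(real^4) set topology" where
  "Gr2 = quotient_topology (top_of_set {(v, w). v \<noteq> w \<and> independent {v, w}})
           (\<lambda>(v, w). span {v, w})"

lemma topspace_RP3: "topspace RP3 = {L. subspace L \<and> dim L = 1}"
proof -
  have "\<exists>v. v \<noteq> 0 \<and> L = span {v}" if L: "subspace L" "dim L = 1" for L :: "(real^4) set"
  proof -
    obtain B where B: "B \<subseteq> L" "independent B" "L \<subseteq> span B" "card B = dim L"
      using basis_exists[of L] by blast
    then obtain v where v: "B = {v}" using L card_1_singletonE by metis
    then have "v \<noteq> 0" using B dependent_zero by blast
    moreover have "L = span {v}" using B v L span_minimal by blast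
    ultimately show ?thesis by blast
  qed
  then show ?thesis
    by (auto simp: RP3_def topspace_quotient_topology image_iff)
qed

lemma topspace_Gr2: "topspace Gr2 = {V. subspace V \<and> dim V = 2}"
proof -
  have "\<exists>v w. v \<noteq> w \<and> independent {v, w} \<and> V = span {v, w}"
    if V: "subspace V" "dim V = 2" for V :: "(real^4) set"
  proof -
    obtain B where B: "B \<subseteq> V" "independent B" "V \<subseteq> span B" "card B = dim V"
      using basis_exists[of V] by blast
    then obtain v w where vw: "B = {v, w}" "v \<noteq> w" using V card_2_iff by metis
    then have "V = span {v, w}" using B V span_minimal by blast
    with vw B show ?thesis by blast
  qed
  moreover have "dim (span {v, w}) = 2" if "v \<noteq> w" "independent {v, w}" for v w :: "real^4"
    using that dim_span_eq_card_independent[OF that(2)] by simp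
  ultimately show ?thesis
    by (auto simp: Gr2_def topspace_quotient_topology image_iff)
qed


section \<open>Singular values and the subspace \<open>U\<^sub>2\<close>\<close>

definition diagonal :: "real^4 \<Rightarrow> mat4" where
  "diagonal s = (\<chi> i j. if i = j then s$i else 0)"

text \<open>The indices are spelled out because in the type \<open>4\<close> the numeral \<open>4\<close> equals \<open>0\<close>,
  so that the order of the type puts it before \<open>1\<close>.\<close>

definition singular_decomposition :: "mat4 \<Rightarrow> mat4 \<Rightarrow> real^4 \<Rightarrow> mat4 \<Rightarrow> bool" where
  "singular_decomposition g k s k' \<longleftrightarrow>
     orthogonal_matrix k \<and> orthogonal_matrix k' \<and>
     s$1 \<ge> s$2 \<and> s$2 \<ge> s$3 \<and> s$3 \<ge> s$4 \<and> s$4 \<ge> 0 \<and>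
     g = k ** diagonal s ** k'"

text \<open>Every matrix has a singular value decomposition; the vector of singular values does not
  depend on it.\<close>

definition singular_values :: "mat4 \<Rightarrow> real^4" where
  "singular_values g = (SOME s. \<exists>k k'. singular_decomposition g k s k')"

text \<open>If the second singular value is greater than the third, the image below is the same for
  all singular value decompositions of \<open>g\<close>. In the other case the value is of no significance.\<close>

definition U2 :: "mat4 \<Rightarrow> (real^4) set" where
  "U2 g = (SOME V. \<exists>k s k'. singular_decomposition g k s k' \<and>
                     V = (*v) k ` span {axis 1 1, axis 2 1})"


section \<open>Anosov subgroups and limit sets\<close>

definition word_length :: "mat4 set \<Rightarrow> mat4 \<Rightarrow> nat" where
  "word_length S g = (LEAST n. \<exists>ws. length ws = n \<and> set ws \<subseteq> S \<union> m_inv SL4 ` S \<and>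
                                 g = foldr (**) ws (mat 1))"

definition P2_Anosov :: "mat4 set \<Rightarrow> bool" where
  "P2_Anosov \<Gamma> \<longleftrightarrow> subgroup \<Gamma> SL4 \<and>
     (\<exists>S. finite S \<and> S \<subseteq> \<Gamma> \<and> generate SL4 S = \<Gamma> \<and>
       (\<exists>c>0. \<exists>C>0. \<forall>\<gamma>\<in>\<Gamma>.
          ln (singular_values \<gamma> $ 2 / singular_values \<gamma> $ 3) \<ge> c * real (word_length S \<gamma>) - C))"

definition limit_set2 :: "mat4 set \<Rightarrow> (real^4) set set" where
  "limit_set2 \<Gamma> = {V. \<exists>\<gamma> :: nat \<Rightarrow> mat4. inj \<gamma> \<and> range \<gamma> \<subseteq> \<Gamma> \<and>
     (\<forall>j. singular_values (\<gamma> j) $ 2 > singular_values (\<gamma> j) $ 3) \<and>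
     limitin Gr2 (\<lambda>j. U2 (\<gamma> j)) V sequentially}"

definition minimal_on_RP3 :: "mat4 set \<Rightarrow> bool" where
  "minimal_on_RP3 \<Gamma> \<longleftrightarrow>
     (\<forall>L\<in>topspace RP3. RP3 closure_of ((\<lambda>g. (*v) g ` L) ` \<Gamma>) = topspace RP3)"

end

theory Submission
  imports Defs
begin

text \<open>
  Along a word geodesic, the singular value gap makes \<open>U\<^sub>2\<close> vary exponentially little far from the
  identity; hence elements with distinct limit planes \<open>V\<close> and \<open>W\<close> are joined by geodesics passing
  near the identity. If \<open>V\<close> and \<open>W\<close> met, then at every point of such a geodesic the forward and
  backward planes would be nearly incident, and the norm on the second exterior power would
  satisfy \<open>N(2n) \<le> C e\<^bsup>-cn\<^esup> N(n)\<^sup>2\<close>; iterating over dyadic scales contradicts \<open>N \<ge> 1\<close>. So distinct planes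
  of the limit set are transverse. By invariance of domain a 2-sphere of pairwise transverse planes
  covers \<open>\<real>\<^sup>4\<close>.

  Let \<open>K\<close> be the closed invariant cone over an orbit. Zariski density gives a loxodromic element of
  \<open>\<Gamma> \<inter> H\<close>. The part of \<open>K\<close> on its attracting complex line is invariant under multiplication by the
  diagonal matrix entries, in an eigenbasis, of all elements of \<open>\<Gamma> \<inter> H\<close>. Their arguments generate a dense
  group of rotations, so \<open>K\<close> contains the whole line. Some translate of the line is transverse to the
  repelling plane of any given sequence in \<open>\<Gamma>\<close>, so \<open>K\<close> contains all planes of the limit set, and these
  cover \<open>\<real>\<^sup>4\<close>.
\<close>

text \<open>Only the gap of singular values is given; transversality of limit planes has to be
  extracted from it. On bivectors the two largest singular values of g are s1 s2 and s1 s3, so the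
  gap makes every long element nearly of rank one there, and a plane becomes a vector up to sign.
  The norm inequality is contradictory because each doubling of n lowers the bound on log N(n) / n
  by c/2, while the determinant forces N >= 1. Incidence is exact only for the limit planes. For the
  group elements approximating them it is approximate, and it is needed at all points of a segment
  at once. These points lie in a finite ball, so the ball and the number of scales are fixed before
  the approximating elements. On the side of \<open>H\<close>, a single loxodromic element may
  rotate its attracting line by a rational angle, so its powers need not fill the line from one real
  direction. The missing rotations come from all of \<open>\<Gamma> \<inter> H\<close>; projecting
  back to the line lets matrix entries act on it although the elements themselves do not preserve
  it.\<close>

lemma det_4:
  fixes A :: "'a::comm_ring_1^4^4"
  shows "det A =
    (A$1$1 * A$2$2 - A$2$1 * A$1$2) * (A$3$3 * A$4$4 - A$4$3 * A$3$4)
  - (A$1$1 * A$3$2 - A$3$1 * A$1$2) * (A$2$3 * A$4$4 - A$4$3 * A$2$4)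
  + (A$1$1 * A$4$2 - A$4$1 * A$1$2) * (A$2$3 * A$3$4 - A$3$3 * A$2$4)
  + (A$2$1 * A$3$2 - A$3$1 * A$2$2) * (A$1$3 * A$4$4 - A$4$3 * A$1$4)
  - (A$2$1 * A$4$2 - A$4$1 * A$2$2) * (A$1$3 * A$3$4 - A$3$3 * A$1$4)
  + (A$3$1 * A$4$2 - A$4$1 * A$3$2) * (A$1$3 * A$2$4 - A$2$3 * A$1$4)"
proof -
  have f123: "finite {2::4, 3, 4}" "1 \<notin> {2::4, 3, 4}" by auto
  have f23: "finite {3::4, 4}" "2 \<notin> {3::4, 4}" by auto
  have f3: "finite {4::4}" "3 \<notin> {4::4}" by auto
  show ?thesis
    unfolding det_def UNIV_4
    unfolding sum_over_permutations_insert[OF f123]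
    unfolding sum_over_permutations_insert[OF f23]
    unfolding sum_over_permutations_insert[OF f3]
    unfolding permutes_sing
    by (simp add: sign_swap_id sign_compose permutation_swap_id sign_id swap_id_eq permutation_compose algebra_simps)
qed

section \<open>The second exterior power\<close>

text \<open>The second exterior power of \<open>\<real>\<^sup>4\<close> is realised by the skew-symmetric matrices, on which
  \<open>A\<close> acts by \<open>ext A\<close>; \<open>pf\<close> is the pairing given by the wedge product into the fourth power.\<close>

definition wedge :: "real^4 \<Rightarrow> real^4 \<Rightarrow> mat4" where
  "wedge v w = (\<chi> i j. v$i * w$j - w$i * v$j)"

definition ext :: "mat4 \<Rightarrow> mat4 \<Rightarrow> mat4" where
  "ext A X = A ** X ** transpose A"

definition skew :: "mat4 set" where
  "skew = {X. transpose X = - X}"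

definition pf :: "mat4 \<Rightarrow> mat4 \<Rightarrow> real" where
  "pf X Y = X$1$2 * Y$3$4 - X$1$3 * Y$2$4 + X$1$4 * Y$2$3
          + X$3$4 * Y$1$2 - X$2$4 * Y$1$3 + X$2$3 * Y$1$4"

definition E12 :: mat4 where
  "E12 = wedge (axis 1 1) (axis 2 1)"

lemma inner_matrix: "X \<bullet> Y = (\<Sum>i\<in>UNIV. \<Sum>j\<in>UNIV. X$i$j * Y$i$j)" for X Y :: "real^'n^'m"
  by (simp add: inner_vec_def)

lemma ext_wedge: "ext A (wedge v w) = wedge (A *v v) (A *v w)"
  by (simp add: ext_def wedge_def vec_eq_iff matrix_matrix_mult_def matrix_vector_mult_def
      transpose_def sum_4 algebra_simps)

lemma ext_mult: "ext (A ** B) X = ext A (ext B X)"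
  by (simp add: ext_def matrix_transpose_mul matrix_mul_assoc)

lemma ext_id [simp]: "ext (mat 1) X = X"
  by (simp add: ext_def transpose_mat)

lemma ext_add: "ext A (X + Y) = ext A X + ext A Y"
  by (simp add: ext_def vec_eq_iff matrix_matrix_mult_def sum.distrib algebra_simps)

lemma ext_scaleR: "ext A (c *\<^sub>R X) = c *\<^sub>R ext A X"
  by (simp add: ext_def vec_eq_iff matrix_matrix_mult_def sum_distrib_left algebra_simps)

lemma linear_ext: "linear (ext A)"
  by (rule linearI) (simp_all add: ext_add ext_scaleR)

lemma ext_diff: "ext A (X - Y) = ext A X - ext A Y"
  by (rule linear_diff[OF linear_ext])

lemma ext_minus: "ext A (- X) = - ext A X"
  by (rule linear_neg[OF linear_ext])

lemma inner_mult_left: "(A ** X) \<bullet> Y = X \<bullet> (transpose A ** Y)" for A X Y :: mat4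
  by (simp add: inner_matrix matrix_matrix_mult_def transpose_def sum_4 algebra_simps)

lemma inner_mult_right: "(X ** A) \<bullet> Y = X \<bullet> (Y ** transpose A)" for A X Y :: mat4
  by (simp add: inner_matrix matrix_matrix_mult_def transpose_def sum_4 algebra_simps)

lemma inner_ext: "ext A X \<bullet> Y = X \<bullet> ext (transpose A) Y"
  unfolding ext_def inner_mult_right[of "A ** X"] inner_mult_left[of A X]
  by (simp only: matrix_mul_assoc)

lemma norm_ext_orthogonal:
  assumes "orthogonal_matrix k"
  shows "norm (ext k X) = norm X"
proof -
  have "ext k X \<bullet> ext k X = X \<bullet> X"
    using assms by (simp add: inner_ext flip: ext_mult) (simp add: orthogonal_matrix_def)
  then show ?thesis by (simp add: norm_eq_sqrt_inner)
qed

lemma skewI: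
  assumes "\<And>i j. X$j$i = - X$i$j"
  shows "X \<in> skew"
proof -
  have "transpose X $ i $ j = (- X) $ i $ j" for i j
    using assms[of j i] by (simp add: transpose_def)
  then show ?thesis by (simp add: skew_def vec_eq_iff del: vector_uminus_component)
qed

lemma skewD:
  assumes "X \<in> skew"
  shows "X$j$i = - X$i$j"
proof -
  have "transpose X = - X" using assms by (simp add: skew_def)
  then have "transpose X $ i $ j = (- X) $ i $ j" by simp
  then show ?thesis by (simp add: transpose_def)
qed

lemma ext_skew:
  assumes "X \<in> skew"
  shows "ext A X \<in> skew"
proof -
  have "transpose X = - X" using assms by (simp add: skew_def)
  then have "transpose (ext A X) = ext A (- X)"
    by (simp add: ext_def matrix_transpose_mul matrix_mul_assoc)
  then show ?thesis by (simp add: skew_def ext_minus)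
qed

lemma wedge_skew: "wedge v w \<in> skew"
  by (rule skewI) (simp add: wedge_def)

text \<open>A bivector coordinate occurs twice in its matrix, so this is twice the Gram determinant.
  Hence the norm \<open>sqrt 2\<close> of the vectors that represent planes.\<close>

lemma inner_wedge: "wedge v w \<bullet> wedge x y = 2 * ((v \<bullet> x) * (w \<bullet> y) - (v \<bullet> y) * (w \<bullet> x))"
proof -
  have o: "(\<Sum>i\<in>UNIV. \<Sum>j\<in>UNIV. (a$i * b$j) * (c$i * d$j)) = (a \<bullet> c) * (b \<bullet> d)" for a b c d :: "real^4"
    by (simp add: inner_vec_def sum_product mult_ac)
  have "wedge v w \<bullet> wedge x y = (\<Sum>i\<in>UNIV. \<Sum>j\<in>UNIV.
      (v$i * w$j) * (x$i * y$j) - (v$i * w$j) * (y$i * x$j) - (w$i * v$j) * (x$i * y$j) + (w$i * v$j) * (y$i * x$j))"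
    unfolding inner_matrix wedge_def by (intro sum.cong refl) (simp add: algebra_simps)
  also have "\<dots> = 2 * ((v \<bullet> x) * (w \<bullet> y) - (v \<bullet> y) * (w \<bullet> x))"
    unfolding sum.distrib sum_subtractf o by (simp add: algebra_simps)
  finally show ?thesis .
qed

lemma norm_wedge_orthonormal:
  assumes "norm v = 1" "norm w = 1" "v \<bullet> w = 0"
  shows "norm (wedge v w) = sqrt 2"
proof -
  have "v \<bullet> v = 1" "w \<bullet> w = 1" using assms by (simp_all add: dot_square_norm)
  then have "wedge v w \<bullet> wedge v w = 2" using assms by (simp add: inner_wedge inner_commute)
  then show ?thesis by (simp add: norm_eq_sqrt_inner)
qed

lemma norm_E12: "norm E12 = sqrt 2"
  unfolding E12_def by (rule norm_wedge_orthonormal) (auto simp: inner_axis_axis)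

lemma E12_skew: "E12 \<in> skew"
  by (simp add: E12_def wedge_skew)

lemma norm_ext_E12: "orthogonal_matrix k \<Longrightarrow> norm (ext k E12) = sqrt 2"
  by (simp add: norm_ext_orthogonal norm_E12)

lemma ext_E12_eq: "ext k E12 = wedge (column 1 k) (column 2 k)"
  by (simp add: E12_def ext_wedge matrix_vector_mult_basis)

lemma inner_E12: "X \<in> skew \<Longrightarrow> E12 \<bullet> X = 2 * X$1$2"
proof -
  assume "X \<in> skew"
  then have "X$2$1 = - X$1$2"
    by (rule skewD)
  then show ?thesis
    by (simp add: inner_matrix E12_def wedge_def axis_def sum_4)
qed

definition columns4 :: "real^4 \<Rightarrow> real^4 \<Rightarrow> real^4 \<Rightarrow> real^4 \<Rightarrow> mat4" where
  "columns4 v w x y = (\<chi> i j. if j = 1 then v$i else if j = 2 then w$i else if j = 3 then x$i else y$i)"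

text \<open>Laplace expansion along the first two columns, the shape chosen in \<open>det_4\<close>:
  each summand is a coordinate of one wedge times the complementary coordinate of the other.\<close>

lemma pf_wedge: "pf (wedge v w) (wedge x y) = det (columns4 v w x y)"
  by (simp add: det_4 pf_def wedge_def columns4_def algebra_simps)

lemma mult_columns4: "A ** columns4 v w x y = columns4 (A *v v) (A *v w) (A *v x) (A *v y)"
  by (simp add: columns4_def matrix_matrix_mult_def matrix_vector_mult_def vec_eq_iff)

lemma pf_ext_wedge: "pf (ext A (wedge v w)) (ext A (wedge x y)) = det A * pf (wedge v w) (wedge x y)"
  by (simp add: ext_wedge pf_wedge flip: mult_columns4) (simp add: det_mul)

lemma component_le_norm_matrix: "\<bar>X$i$j\<bar> \<le> norm X" for X :: "real^'n^'m"
  using component_le_norm_cart[of "X$i" j] Finite_Cartesian_Product.norm_nth_le[of X i] by simp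

lemma pf_bound: "\<bar>pf X Y\<bar> \<le> 6 * (norm X * norm Y)"
proof -
  have *: "\<bar>X$i$j * Y$k$l\<bar> \<le> norm X * norm Y" for i j k l
    by (simp add: abs_mult mult_mono component_le_norm_matrix)
  show ?thesis
    unfolding pf_def
    using *[of 1 2 3 4] *[of 1 3 2 4] *[of 1 4 2 3] *[of 3 4 1 2] *[of 2 4 1 3] *[of 2 3 1 4]
    by linarith
qed

section \<open>Singular value decompositions\<close>

lemma norm_le_componentwise_matrix:
  fixes X Y :: "real^'n^'m"
  assumes "\<And>i j. \<bar>X$i$j\<bar> \<le> c * \<bar>Y$i$j\<bar>" "c \<ge> 0"
  shows "norm X \<le> c * norm Y"
proof -
  have "norm X \<le> norm (c *\<^sub>R Y)"
    using assms by (intro norm_le_componentwise_cart) (simp add: abs_mult)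
  then show ?thesis using assms by simp
qed

lemma mult_diagonal [simp]: "(diagonal s ** X) $ i $ j = s$i * X$i$j" "(X ** diagonal s) $ i $ j = X$i$j * s$j"
  using exhaust_4[of i] exhaust_4[of j] by (auto simp: diagonal_def matrix_matrix_mult_def sum_4)

lemma transpose_diagonal: "transpose (diagonal s) = diagonal s"
  by (simp add: diagonal_def transpose_def vec_eq_iff)

lemma ext_diagonal: "ext (diagonal s) X $ i $ j = s$i * s$j * X$i$j"
  by (simp add: ext_def transpose_diagonal)

text \<open>Once the orthogonal factors are stripped off, the entry (i,j) is scaled by
  \<open>s$i * s$j\<close>. The subtracted term is the (1,2) entry; every other product with i
  \<noteq> j is at most \<open>s$1 * s$3\<close>.\<close>

lemma ext_singular_decomposition:
  assumes sd: "singular_decomposition g k s k'" and X: "X \<in> skew"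
  shows "norm (ext g X - (s$1 * s$2 * (ext (transpose k') E12 \<bullet> X) / 2) *\<^sub>R ext k E12)
           \<le> s$1 * s$3 * norm X"
proof -
  have k: "orthogonal_matrix k" "orthogonal_matrix k'" and s: "s$1 \<ge> s$2" "s$2 \<ge> s$3" "s$3 \<ge> s$4" "s$4 \<ge> 0"
    and g: "g = k ** diagonal s ** k'"
    using sd by (auto simp: singular_decomposition_def)
  define Y where "Y = ext k' X"
  define Z where "Z = ext (diagonal s) Y - (s$1 * s$2 * Y$1$2) *\<^sub>R E12"
  have Y: "Y \<in> skew" using X by (simp add: Y_def ext_skew)
  note Yij = skewD[OF Y]
  have Yii: "Y$i$i = 0" for i using Yij[of i i] by simp
  have Y12: "ext (transpose k') E12 \<bullet> X = 2 * Y$1$2"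
    using Y by (simp add: inner_ext Y_def inner_E12)
  have m: "s$i * s$j \<le> s$1 * s$3" if "i \<noteq> j" "\<not> (i \<in> {1,2} \<and> j \<in> {1,2})" for i j
  proof -
    have "s$i \<le> s$1 \<and> s$j \<le> s$3 \<or> s$i \<le> s$3 \<and> s$j \<le> s$1"
      using that s exhaust_4[of i] exhaust_4[of j] by auto
    then show ?thesis
    proof
      assume "s$i \<le> s$1 \<and> s$j \<le> s$3"
      moreover have "0 \<le> s$j" using s exhaust_4[of j] by auto
      ultimately show ?thesis using s by (intro mult_mono) auto
    next
      assume "s$i \<le> s$3 \<and> s$j \<le> s$1"
      moreover have "0 \<le> s$j" using s exhaust_4[of j] by auto
      ultimately have "s$i * s$j \<le> s$3 * s$1" using s by (intro mult_mono) auto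
      then show ?thesis by (simp add: mult.commute)
    qed
  qed
  have "norm Z \<le> (s$1 * s$3) * norm Y"
  proof (rule norm_le_componentwise_matrix)
    fix i j
    have pos: "0 \<le> s$i" "0 \<le> s$j" using s exhaust_4[of i] exhaust_4[of j] by auto
    consider "i = j" | "i = 1" "j = 2" | "i = 2" "j = 1" | "i \<noteq> j" "\<not> (i \<in> {1,2} \<and> j \<in> {1,2})"
      by blast
    then show "\<bar>Z$i$j\<bar> \<le> (s$1 * s$3) * \<bar>Y$i$j\<bar>"
    proof cases
      case 4
      then have "E12$i$j = 0" by (auto simp: E12_def wedge_def axis_def)
      then have "\<bar>Z$i$j\<bar> = (s$i * s$j) * \<bar>Y$i$j\<bar>"
        using pos by (simp add: Z_def ext_diagonal abs_mult)
      then show ?thesis using m[OF 4] by (simp add: mult_right_mono)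
    qed (insert s Yij[of 1 2], auto simp: Z_def ext_diagonal E12_def wedge_def axis_def Yii)
  qed (use s in auto)
  moreover have "ext k Z = ext g X - (s$1 * s$2 * (ext (transpose k') E12 \<bullet> X) / 2) *\<^sub>R ext k E12"
    by (simp add: Z_def ext_diff ext_scaleR Y12 g Y_def ext_mult)
  ultimately show ?thesis
    by (metis k norm_ext_orthogonal Y_def)
qed

lemma ext_singular_decomposition_E12:
  assumes sd: "singular_decomposition g k s k'"
  shows "ext g (ext (transpose k') E12) = (s$1 * s$2) *\<^sub>R ext k E12"
proof -
  have "orthogonal_matrix k'" and g: "g = k ** diagonal s ** k'"
    using sd by (auto simp: singular_decomposition_def)
  then have "ext g (ext (transpose k') E12) = ext k (ext (diagonal s) E12)"
    by (simp add: ext_mult) (simp add: orthogonal_matrix_def flip: ext_mult)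
  moreover have "ext (diagonal s) E12 = (s$1 * s$2) *\<^sub>R E12"
    by (simp add: vec_eq_iff ext_diagonal) (auto simp: E12_def wedge_def axis_def)
  ultimately show ?thesis by (simp add: ext_scaleR)
qed

lemma orthogonal_matrix_columns4:
  assumes "orthogonal_matrix (Q :: mat4)"
  shows "(Q$1$j)\<^sup>2 + (Q$2$j)\<^sup>2 + (Q$3$j)\<^sup>2 + (Q$4$j)\<^sup>2 = 1"
    and "(Q$i$1)\<^sup>2 + (Q$i$2)\<^sup>2 + (Q$i$3)\<^sup>2 + (Q$i$4)\<^sup>2 = 1"
proof -
  have "(transpose Q ** Q)$j$j = 1" "(Q ** transpose Q)$i$i = 1"
    using assms by (simp_all add: orthogonal_matrix_def mat_def)
  then show "(Q$1$j)\<^sup>2 + (Q$2$j)\<^sup>2 + (Q$3$j)\<^sup>2 + (Q$4$j)\<^sup>2 = 1"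
    "(Q$i$1)\<^sup>2 + (Q$i$2)\<^sup>2 + (Q$i$3)\<^sup>2 + (Q$i$4)\<^sup>2 = 1"
    by (simp_all add: matrix_matrix_mult_def transpose_def sum_4 power2_eq_square)
qed

lemma singular_decomposition_nonneg: "singular_decomposition g k s k' \<Longrightarrow> 0 \<le> s$i"
  using exhaust_4[of i] unfolding singular_decomposition_def by auto

text \<open>Comparing the two resulting diagonalisations of \<open>g g\<^sup>T\<close>.\<close>

lemma singular_decomposition_intertwine:
  assumes "singular_decomposition g k s k'" "singular_decomposition g l t l'"
  shows "orthogonal_matrix (transpose l ** k)"
    and "(transpose l ** k)$i$j = 0 \<or> s$j = t$i"
proof -
  define Q where "Q = transpose l ** k"
  have k: "orthogonal_matrix k" "orthogonal_matrix k'" "orthogonal_matrix l" "orthogonal_matrix l'"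
    and g: "g = k ** diagonal s ** k'" "g = l ** diagonal t ** l'"
    using assms unfolding singular_decomposition_def by blast+
  have pos: "0 \<le> s$j" "0 \<le> t$i"
    using singular_decomposition_nonneg assms by blast+
  have a: "g ** transpose g = u ** diagonal r ** diagonal r ** transpose u"
    if gu: "g = u ** diagonal r ** u'" and u': "orthogonal_matrix u'" for u u' r
  proof -
    have "g ** transpose g = u ** diagonal r ** (u' ** transpose u') ** (diagonal r ** transpose u)"
      unfolding gu by (simp only: matrix_transpose_mul transpose_diagonal matrix_mul_assoc)
    moreover have "u' ** transpose u' = mat 1" using u' by (simp add: orthogonal_matrix_def)
    ultimately show ?thesis by (simp only: matrix_mul_rid) (simp only: matrix_mul_assoc)
  qed
  have "k ** diagonal s ** diagonal s ** transpose k = l ** diagonal t ** diagonal t ** transpose l"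
    using a[OF g(1) k(2)] a[OF g(2) k(4)] by simp
  then have "transpose l ** (k ** diagonal s ** diagonal s ** transpose k) ** k
      = transpose l ** (l ** diagonal t ** diagonal t ** transpose l) ** k" by simp
  then have "transpose l ** k ** diagonal s ** diagonal s ** (transpose k ** k)
      = (transpose l ** l) ** diagonal t ** diagonal t ** (transpose l ** k)"
    by (simp only: matrix_mul_assoc)
  then have "Q ** diagonal s ** diagonal s = diagonal t ** diagonal t ** Q"
    using k by (simp add: Q_def orthogonal_matrix_def)
  then have "(Q ** diagonal s ** diagonal s)$i$j = (diagonal t ** diagonal t ** Q)$i$j" by simp
  then have "Q$i$j * (s$j * s$j - t$i * t$i) = 0"
    by (simp add: algebra_simps flip: matrix_mul_assoc[of "diagonal t"])
  then show "(transpose l ** k)$i$j = 0 \<or> s$j = t$i"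
    using pos by (auto simp: Q_def square_eq_iff)
  show "orthogonal_matrix (transpose l ** k)"
    using k by (simp add: orthogonal_matrix_mul)
qed

text \<open>If \<open>s$m > t$m\<close>, the intertwining matrix vanishes in the rows from m on of
  its first m columns. Then m orthonormal columns would live in m - 1 coordinates, which the row and
  column sums of squares exclude.\<close>

lemma singular_decomposition_le:
  assumes sd: "singular_decomposition g k s k'" "singular_decomposition g l t l'"
  shows "s$m \<le> t$m"
proof (rule ccontr)
  assume "\<not> s$m \<le> t$m"
  define Q where "Q = transpose l ** k"
  have Q: "orthogonal_matrix Q" and z: "Q$i$j = 0 \<or> s$j = t$i" for i j
    using singular_decomposition_intertwine[OF sd] by (auto simp: Q_def)
  have s: "s$1 \<ge> s$2" "s$2 \<ge> s$3" "s$3 \<ge> s$4" "t$1 \<ge> t$2" "t$2 \<ge> t$3" "t$3 \<ge> t$4"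
    using sd unfolding singular_decomposition_def by blast+
  note c = orthogonal_matrix_columns4(1)[OF Q] and r = orthogonal_matrix_columns4(2)[OF Q]
  consider "m = 1" | "m = 2" | "m = 3" | "m = 4" using exhaust_4 by blast
  then show False
  proof cases
    case 1
    then have "Q$1$1 = 0" "Q$2$1 = 0" "Q$3$1 = 0" "Q$4$1 = 0"
      using z[of 1 1] z[of 2 1] z[of 3 1] z[of 4 1] s \<open>\<not> s$m \<le> t$m\<close> by auto
    then show False using c[of 1] by simp
  next
    case 2
    then have "Q$2$1 = 0" "Q$3$1 = 0" "Q$4$1 = 0" "Q$2$2 = 0" "Q$3$2 = 0" "Q$4$2 = 0"
      using z[of 2 1] z[of 3 1] z[of 4 1] z[of 2 2] z[of 3 2] z[of 4 2] s \<open>\<not> s$m \<le> t$m\<close> by auto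
    then show False
      using c[of 1] c[of 2] r[of 1] zero_le_power2[of "Q$1$3"] zero_le_power2[of "Q$1$4"] by auto
  next
    case 3
    then have "Q$3$1 = 0" "Q$4$1 = 0" "Q$3$2 = 0" "Q$4$2 = 0" "Q$3$3 = 0" "Q$4$3 = 0"
      using z[of 3 1] z[of 4 1] z[of 3 2] z[of 4 2] z[of 3 3] z[of 4 3] s \<open>\<not> s$m \<le> t$m\<close> by auto
    then show False
      using c[of 1] c[of 2] c[of 3] r[of 1] r[of 2]
        zero_le_power2[of "Q$1$4"] zero_le_power2[of "Q$2$4"] by simp
  next
    case 4
    then have "Q$4$1 = 0" "Q$4$2 = 0" "Q$4$3 = 0" "Q$4$4 = 0"
      using z[of 4 1] z[of 4 2] z[of 4 3] z[of 4 4] s \<open>\<not> s$m \<le> t$m\<close> by auto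
    then show False using r[of 4] by simp
  qed
qed

lemma singular_decomposition_unique:
  assumes "singular_decomposition g k s k'" "singular_decomposition g l t l'"
  shows "s = t"
  using assms by (auto simp: vec_eq_iff intro!: antisym singular_decomposition_le)

text \<open>The gap kills the lower left block of the change of frame, so it multiplies
  \<open>E12\<close> by the determinant of its upper left block; preservation of the norm makes that
  determinant 1 or -1. The sign is a genuine ambiguity of the decomposition.\<close>

lemma singular_decomposition_E12_unique:
  assumes sd: "singular_decomposition g k s k'" "singular_decomposition g l t l'" and gap: "s$2 > s$3"
  shows "ext k E12 = ext l E12 \<or> ext k E12 = - ext l E12"
proof -
  define Q where "Q = transpose l ** k"
  have Q: "orthogonal_matrix Q" and z: "Q$i$j = 0 \<or> s$j = s$i" for i j
    using singular_decomposition_intertwine[OF sd(1)] sd(2) singular_decomposition_unique[OF sd]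
    unfolding Q_def by blast+
  have k: "orthogonal_matrix k" "orthogonal_matrix l" and s: "s$1 \<ge> s$2" "s$3 \<ge> s$4"
    using sd unfolding singular_decomposition_def by blast+
  have "k = l ** Q" using k unfolding Q_def orthogonal_matrix_def
    by (simp add: matrix_mul_assoc)
  then have kl: "ext k E12 = ext l (ext Q E12)" by (simp add: ext_mult)
  define d where "d = Q$1$1 * Q$2$2 - Q$2$1 * Q$1$2"
  have "Q$3$1 = 0" "Q$4$1 = 0" "Q$3$2 = 0" "Q$4$2 = 0"
    using z[of 3 1] z[of 4 1] z[of 3 2] z[of 4 2] s gap by auto
  then have Qd: "ext Q E12 = d *\<^sub>R E12"
    unfolding ext_E12_eq
    by (simp add: wedge_def E12_def column_def vec_eq_iff forall_4 axis_def d_def)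
  have "norm (ext Q E12) = norm E12" using Q by (rule norm_ext_orthogonal)
  then have "\<bar>d\<bar> = 1" using norm_E12 by (simp add: Qd)
  then have "d = 1 \<or> d = -1" by linarith
  then show ?thesis using kl Qd by (auto simp: ext_scaleR ext_minus)
qed

text \<open>One step in building a singular value decomposition. At a unit vector of maximal stretch
  the first variation vanishes, and this gives orthogonality of the images.\<close>

lemma exists_max_stretch:
  fixes A :: mat4
  assumes S: "subspace S" "v0 \<in> S" "v0 \<noteq> 0"
  shows "\<exists>v. v \<in> S \<and> norm v = 1 \<and> (\<forall>w\<in>S. norm (A *v w) \<le> norm (A *v v) * norm w) \<and>
       (\<forall>w\<in>S. v \<bullet> w = 0 \<longrightarrow> (A *v v) \<bullet> (A *v w) = 0)"
proof -
  have "compact (S \<inter> sphere 0 1)"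
    by (intro closed_Int_compact closed_subspace S compact_sphere)
  moreover have "v0 /\<^sub>R norm v0 \<in> S" "norm (v0 /\<^sub>R norm v0) = 1"
    using S by (auto intro: subspace_scale)
  then have "S \<inter> sphere 0 1 \<noteq> {}" by auto
  moreover have "continuous_on (S \<inter> sphere 0 1) (\<lambda>w. norm (A *v w))"
    by (intro continuous_on_norm linear_continuous_on matrix_vector_mul_bounded_linear)
  ultimately obtain v where v: "v \<in> S \<inter> sphere 0 1"
    and max: "\<And>w. w \<in> S \<inter> sphere 0 1 \<Longrightarrow> norm (A *v w) \<le> norm (A *v v)"
    using continuous_attains_sup[of "S \<inter> sphere 0 1" "\<lambda>w. norm (A *v w)"]
    by blast
  have le: "norm (A *v w) \<le> norm (A *v v) * norm w" if "w \<in> S" for w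
  proof (cases "w = 0")
    case False
    have "w /\<^sub>R norm w \<in> S" using that S by (intro subspace_scale)
    then have "w /\<^sub>R norm w \<in> S \<inter> sphere 0 1" using False by simp
    then have "norm (A *v (w /\<^sub>R norm w)) \<le> norm (A *v v)" by (rule max)
    then show ?thesis using False
      by (simp add: matrix_vector_mult_scaleR divide_simps mult.commute)
  qed simp
  have orth: "(A *v v) \<bullet> (A *v w) = 0" if w: "w \<in> S" "v \<bullet> w = 0" for w
  proof -
    define a where "a = (A *v v) \<bullet> (A *v w)"
    \<comment> \<open>Comparing v with v + t w gives 2 t a \<le> t^2 b for all t, and t = a / b then
      forces a = 0. The added 1 keeps b positive.\<close>
    define b where "b = (norm (A *v v))\<^sup>2 * (norm w)\<^sup>2 + 1"
    have b: "b > 0" by (simp add: b_def add_nonneg_pos)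
    have sq: "(norm (x + y))\<^sup>2 = (norm x)\<^sup>2 + 2 * (x \<bullet> y) + (norm y)\<^sup>2" for x y :: "real^4"
      unfolding power2_norm_eq_inner by (simp add: inner_add_left inner_add_right inner_commute)
    have ineq: "2 * t * a \<le> t\<^sup>2 * b" for t
    proof -
      have "v + t *\<^sub>R w \<in> S" using v w S by (simp add: subspace_add subspace_scale)
      then have "norm (A *v (v + t *\<^sub>R w)) \<le> norm (A *v v) * norm (v + t *\<^sub>R w)" by (rule le)
      then have "(norm (A *v v + t *\<^sub>R (A *v w)))\<^sup>2 \<le> (norm (A *v v) * norm (v + t *\<^sub>R w))\<^sup>2"
        by (simp add: matrix_vector_mult_scaleR matrix_vector_right_distrib power_mono)
      moreover have "(norm (v + t *\<^sub>R w))\<^sup>2 = 1 + t\<^sup>2 * (norm w)\<^sup>2"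
        using v w by (simp add: norm_add_Pythagorean orthogonal_def power_mult_distrib)
      moreover have "(norm (A *v v + t *\<^sub>R (A *v w)))\<^sup>2
          = (norm (A *v v))\<^sup>2 + 2 * t * a + t\<^sup>2 * (norm (A *v w))\<^sup>2"
        unfolding sq[of "A *v v"] by (simp add: a_def power_mult_distrib)
      ultimately have "2 * t * a + t\<^sup>2 * (norm (A *v w))\<^sup>2 \<le> t\<^sup>2 * ((norm (A *v v))\<^sup>2 * (norm w)\<^sup>2)"
        by (simp add: power_mult_distrib algebra_simps)
      moreover have "0 \<le> t\<^sup>2 * (norm (A *v w))\<^sup>2" "0 \<le> t\<^sup>2" by auto
      ultimately show ?thesis unfolding b_def by (simp only: distrib_left mult_1_right)
    qed
    have "2 * (a / b) * a \<le> (a / b)\<^sup>2 * b" by (rule ineq)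
    then have "a\<^sup>2 \<le> 0" using b by (simp add: power2_eq_square field_simps)
    then show ?thesis by (simp add: a_def)
  qed
  show ?thesis
    using v le orth by (intro exI[of _ v]) simp
qed

text \<open>Directions of maximal stretch are chosen greedily in successive orthogonal complements.
  Invertibility makes all stretches positive, so the images can be normalised to the columns of
  \<open>k\<close>.\<close>

lemma singular_decomposition_exists:
  assumes g: "invertible g"
  obtains k s k' where "singular_decomposition g k s k'"
proof -
  let ?P = "\<lambda>S v. v \<in> S \<and> norm v = 1 \<and> (\<forall>w\<in>S. norm (g *v w) \<le> norm (g *v v) * norm w) \<and>
       (\<forall>w\<in>S. v \<bullet> w = 0 \<longrightarrow> (g *v v) \<bullet> (g *v w) = 0)"
  have ex: "\<exists>v. ?P {w. \<forall>u\<in>B. u \<bullet> w = 0} v" if "finite B" "card B < 4" for B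
  proof -
    have "dim B < DIM(real^4)" using that dim_le_card'[of B] by simp
    then obtain v0 :: "real^4" where "v0 \<noteq> 0" "\<And>y. y \<in> span B \<Longrightarrow> orthogonal v0 y"
      using orthogonal_to_subspace_exists by blast
    then have "v0 \<in> {w. \<forall>u\<in>B. u \<bullet> w = 0}"
      by (auto simp: orthogonal_def inner_commute span_base)
    moreover have "subspace {w. \<forall>u\<in>B. u \<bullet> w = 0}"
      by (auto simp: subspace_def inner_add_right)
    ultimately show ?thesis using \<open>v0 \<noteq> 0\<close> by (intro exists_max_stretch)
  qed
  have c: "finite ({} :: (real^4) set)" "card ({} :: (real^4) set) < 4" by simp_all
  obtain v1 where v1: "?P {w. \<forall>u\<in>{}. u \<bullet> w = 0} v1"
    using ex[OF c] by (rule exE)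
  have c: "finite {v1}" "card {v1} < 4" by simp_all
  obtain v2 where v2: "?P {w. \<forall>u\<in>{v1}. u \<bullet> w = 0} v2" 
    using ex[OF c] by (rule exE)
  have c: "finite {v1, v2}" "card {v1, v2} < 4" by (simp_all add: card_insert_if)
  obtain v3 where v3: "?P {w. \<forall>u\<in>{v1, v2}. u \<bullet> w = 0} v3"
    using ex[OF c] by (rule exE)
  have c: "finite {v1, v2, v3}" "card {v1, v2, v3} < 4" by (simp_all add: card_insert_if)
  obtain v4 where v4: "?P {w. \<forall>u\<in>{v1, v2, v3}. u \<bullet> w = 0} v4"
    using ex[OF c] by (rule exE)
  define v where "v i = (if i = (1::4) then v1 else if i = 2 then v2 else if i = 3 then v3 else v4)" for i
  have n: "v1 \<bullet> v1 = 1" "v2 \<bullet> v2 = 1" "v3 \<bullet> v3 = 1" "v4 \<bullet> v4 = 1"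
    using v1 v2 v3 v4 by (simp_all only: norm_eq_1)
  have o: "v1 \<bullet> v2 = 0" "v1 \<bullet> v3 = 0" "v1 \<bullet> v4 = 0" "v2 \<bullet> v3 = 0" "v2 \<bullet> v4 = 0" "v3 \<bullet> v4 = 0"
    using v2 v3 v4 by simp_all
  have go: "(g *v v1) \<bullet> (g *v v2) = 0" "(g *v v1) \<bullet> (g *v v3) = 0" "(g *v v1) \<bullet> (g *v v4) = 0"
     "(g *v v2) \<bullet> (g *v v3) = 0" "(g *v v2) \<bullet> (g *v v4) = 0" "(g *v v3) \<bullet> (g *v v4) = 0"
    using v1 v2 v3 o by simp_all
  have orth: "v i \<bullet> v j = (if i = j then 1 else 0)" for i j
    using exhaust_4[of i] exhaust_4[of j] n o
    by (elim disjE) (simp_all add: v_def inner_commute)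
  have gorth: "(g *v v i) \<bullet> (g *v v j) = 0" if "i \<noteq> j" for i j
    using exhaust_4[of i] exhaust_4[of j] that go
    by (elim disjE) (simp_all add: v_def inner_commute)
  have sorted: "norm (g *v v 2) \<le> norm (g *v v 1)" "norm (g *v v 3) \<le> norm (g *v v 2)" "norm (g *v v 4) \<le> norm (g *v v 3)"
  proof -
    have "norm (g *v v2) \<le> norm (g *v v1) * norm v2" using v1 by simp
    moreover have "norm (g *v v3) \<le> norm (g *v v2) * norm v3" using v2 o by simp
    moreover have "norm (g *v v4) \<le> norm (g *v v3) * norm v4" using v3 o by simp
    ultimately show "norm (g *v v 2) \<le> norm (g *v v 1)" "norm (g *v v 3) \<le> norm (g *v v 2)" "norm (g *v v 4) \<le> norm (g *v v 3)"
      using v2 v3 v4 by (simp_all add: v_def)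
  qed
  define s where "s = (\<chi> i. norm (g *v v i))"
  have "g *v v i \<noteq> 0" for i
  proof
    assume "g *v v i = 0"
    then have "v i = 0" using g by (metis invertible_def matrix_left_invertible_ker)
    then show False using orth[of i i] by simp
  qed
  then have spos: "s$i > 0" for i by (simp add: s_def)
  define k where "k = (\<chi> i j. (g *v v j) $ i / s$j)"
  define k' where "k' = (\<chi> i j. v i $ j)"
  have k': "orthogonal_matrix k'"
  proof -
    have "k' ** transpose k' = mat 1"
      using orth by (simp add: k'_def matrix_matrix_mult_def transpose_def vec_eq_iff mat_def inner_vec_def)
    then show ?thesis by (simp add: orthogonal_matrix_def matrix_left_right_inverse)
  qed
  have "transpose k ** k = mat 1"
  proof -
    have "(transpose k ** k)$i$j = (g *v v i) \<bullet> (g *v v j) / (s$i * s$j)" for i j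
      by (simp add: k_def matrix_matrix_mult_def transpose_def inner_vec_def sum_divide_distrib)
    moreover have "(g *v v i) \<bullet> (g *v v i) = s$i * s$i" for i
      by (simp add: s_def dot_square_norm power2_eq_square)
    ultimately show ?thesis
      using gorth spos by (simp add: vec_eq_iff mat_def less_imp_neq[THEN not_sym])
  qed
  then have k: "orthogonal_matrix k" by (simp add: orthogonal_matrix)
  have "g ** transpose k' = k ** diagonal s"
    using spos by (simp add: k_def k'_def matrix_matrix_mult_def matrix_vector_mult_def transpose_def diagonal_def vec_eq_iff if_distrib
        less_imp_neq[THEN not_sym] cong: if_cong)
  then have "g = k ** diagonal s ** k'"
    using k' by (metis matrix_mul_assoc matrix_mul_rid orthogonal_matrix_def)
  then have "singular_decomposition g k s k'"
    using k k' sorted by (simp add: singular_decomposition_def s_def)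
  then show ?thesis by (rule that)
qed

section \<open>Planes as orthogonal projections\<close>

lemma wedge_eq_0_iff: "wedge v w = 0 \<longleftrightarrow> \<not> (v \<noteq> w \<and> independent {v, w})"
proof
  assume 0: "wedge v w = 0"
  show "\<not> (v \<noteq> w \<and> independent {v, w})"
  proof
    assume vw: "v \<noteq> w \<and> independent {v, w}"
    then have "v \<noteq> 0" using dependent_zero by blast
    then obtain i where i: "v$i \<noteq> 0" by (auto simp: vec_eq_iff)
    have "v$i * w$j = w$i * v$j" for j
    proof -
      have "wedge v w $ i $ j = 0" using 0 by simp
      then show ?thesis by (simp add: wedge_def)
    qed
    then have "w = (w$i / v$i) *\<^sub>R v" using i by (simp add: vec_eq_iff field_simps)
    then have "w \<in> span {v}" by (metis span_base span_scale singletonI)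
    then show False using vw by (metis independent_insert insert_commute singletonD)
  qed
next
  assume a: "\<not> (v \<noteq> w \<and> independent {v, w})"
  show "wedge v w = 0"
  proof (cases "v = w")
    case True then show ?thesis by (simp add: wedge_def vec_eq_iff)
  next
    case False
    with a have "dependent {v, w}" by simp
    then consider "v = 0" | "w \<in> span {v}"
      using False by (metis independent_insert insert_commute insert_absorb dependent_single singletonD)
    then show ?thesis
    proof cases
      case 2
      then obtain c where "w = c *\<^sub>R v" by (auto simp: span_singleton)
      then show ?thesis by (simp add: wedge_def vec_eq_iff)
    qed (simp add: wedge_def vec_eq_iff)
  qed
qed

text \<open>If \<open>X\<close> is the wedge of a basis of a plane, then \<open>plane_proj X\<close> is the orthogonal projection
  onto that plane.\<close>

definition plane_proj :: "mat4 \<Rightarrow> mat4" where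
  "plane_proj X = (\<chi> i j. 2 * (\<Sum>k\<in>UNIV. X$i$k * X$j$k) / (X \<bullet> X))"

definition proj_of :: "(real^4) set \<Rightarrow> mat4" where
  "proj_of V = plane_proj (SOME X. \<exists>v w. X = wedge v w \<and> v \<noteq> w \<and> independent {v, w} \<and> V = span {v, w})"

lemma plane_proj_scale:
  assumes "c \<noteq> 0" shows "plane_proj (c *\<^sub>R X) = plane_proj X"
proof -
  have "(\<Sum>k\<in>UNIV. (c * X$i$k) * (c * X$j$k)) = (c * c) * (\<Sum>k\<in>UNIV. X$i$k * X$j$k)" for i j
    by (simp add: sum_distrib_left algebra_simps)
  then show ?thesis using assms by (simp add: plane_proj_def vec_eq_iff)
qed

lemma wedge_lincomb: "wedge (a *\<^sub>R v + b *\<^sub>R w) (c *\<^sub>R v + d *\<^sub>R w) = (a * d - b * c) *\<^sub>R wedge v w"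
  by (simp add: wedge_def vec_eq_iff) (simp add: algebra_simps)

lemma span_pairE:
  assumes "x \<in> span {v, w :: 'a::real_vector}"
  obtains a b where "x = a *\<^sub>R v + b *\<^sub>R w"
proof -
  from assms obtain a where "x - a *\<^sub>R v \<in> span {w}" by (auto simp: span_insert)
  then obtain b where "x - a *\<^sub>R v = b *\<^sub>R w" by (auto simp: span_singleton)
  then show ?thesis by (intro that[of a b]) (simp add: algebra_simps)
qed

text \<open>Two bases of a plane have proportional wedges and \<open>plane_proj\<close> ignores the
  scale, so the basis picked by the choice operator does not matter.\<close>

lemma proj_of_span:
  assumes "v \<noteq> w" "independent {v, w}"
  shows "proj_of (span {v, w}) = plane_proj (wedge v w)"
proof -
  let ?P = "\<lambda>X. \<exists>x y. X = wedge x y \<and> x \<noteq> y \<and> independent {x, y} \<and> span {v, w} = span {x, y}"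
  have "?P (wedge v w)" using assms by blast
  then have "?P (SOME X. ?P X)" by (rule someI)
  then obtain x y where X: "(SOME X. ?P X) = wedge x y" and xy: "x \<noteq> y" "independent {x, y}" "span {v, w} = span {x, y}"
    by blast
  have "x \<in> span {v, w}" "y \<in> span {v, w}" using xy(3) by (auto simp: span_base)
  then obtain a b c d where "x = a *\<^sub>R v + b *\<^sub>R w" "y = c *\<^sub>R v + d *\<^sub>R w"
    by (metis span_pairE)
  then have e: "wedge x y = (a * d - b * c) *\<^sub>R wedge v w" by (simp add: wedge_lincomb)
  moreover have "wedge x y \<noteq> 0" using xy by (simp add: wedge_eq_0_iff)
  ultimately have "a * d - b * c \<noteq> 0" by auto
  then show ?thesis unfolding proj_of_def X e by (rule plane_proj_scale)
qed

lemma continuous_on_wedge: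
  assumes "continuous_on S f" "continuous_on S g"
  shows "continuous_on S (\<lambda>x. wedge (f x) (g x))"
  unfolding wedge_def
  by (rule continuous_on_vec_lambda, rule continuous_on_vec_lambda)
    (intro continuous_on_diff continuous_on_mult continuous_on_component assms)

lemma continuous_on_plane_proj: "continuous_on {X. X \<noteq> 0} plane_proj"
proof -
  have "continuous_on {X. X \<noteq> 0} (\<lambda>X::mat4. 2 * (\<Sum>k\<in>UNIV. X$i$k * X$j$k) / (X \<bullet> X))" for i j
    by (intro continuous_intros) auto
  then show ?thesis
    unfolding plane_proj_def
    by (intro continuous_on_vec_lambda) 
qed

text \<open>On a quotient, continuity is checked on bases. Together with
  \<open>inj_on_proj_of\<close> this moves limits of planes into a space of matrices, where limits
  are unique.\<close>

lemma continuous_map_proj_of: "continuous_map Gr2 euclidean proj_of"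
proof -
  let ?S = "{(v :: real^4, w). v \<noteq> w \<and> independent {v, w}}"
  let ?q = "\<lambda>(v :: real^4, w). span {v, w}"
  have "continuous_on ?S (\<lambda>p. plane_proj (wedge (fst p) (snd p)))"
    by (rule continuous_on_compose2[OF continuous_on_plane_proj])
      (auto intro!: continuous_on_wedge continuous_intros simp: wedge_eq_0_iff)
  then have c: "continuous_on ?S (\<lambda>p. proj_of (?q p))"
    by (rule continuous_on_eq) (auto simp: proj_of_span)
  show ?thesis
    unfolding continuous_map_def
  proof (intro conjI allI impI)
    fix U :: "mat4 set" assume "openin euclidean U"
    then have "openin (top_of_set ?S) (?S \<inter> (\<lambda>p. proj_of (?q p)) -` U)"
      using c by (intro continuous_openin_preimage_gen) auto
    moreover have "?S \<inter> (\<lambda>p. proj_of (?q p)) -` U = {p \<in> topspace (top_of_set ?S). ?q p \<in> {V \<in> topspace Gr2. proj_of V \<in> U}}"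
      by (auto simp: Gr2_def topspace_quotient_topology)
    ultimately show "openin Gr2 {V \<in> topspace Gr2. proj_of V \<in> U}"
      unfolding Gr2_def openin_quotient_topology
      by (auto simp: topspace_quotient_topology)
  qed auto
qed

lemma plane_proj_orthonormal:
  assumes "norm v = 1" "norm w = 1" "v \<bullet> w = 0"
  shows "plane_proj (wedge v w) *v x = (v \<bullet> x) *\<^sub>R v + (w \<bullet> x) *\<^sub>R w"
proof -
  have vw: "v \<bullet> v = 1" "w \<bullet> w = 1" using assms by (simp_all add: dot_square_norm)
  have n: "wedge v w \<bullet> wedge v w = 2" using assms vw by (simp add: inner_wedge inner_commute)
  have "(\<Sum>k\<in>UNIV. wedge v w $i$k * wedge v w $j$k) = v$i * v$j * (w \<bullet> w) + w$i * w$j * (v \<bullet> v) - (v$i * w$j + w$i * v$j) * (v \<bullet> w)" for i j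
    by (simp add: wedge_def inner_vec_def sum_4 algebra_simps)
  then have "plane_proj (wedge v w) = (\<chi> i j. v$i * v$j + w$i * w$j)"
    using vw assms n by (simp add: plane_proj_def vec_eq_iff)
  then show ?thesis
    by (simp add: matrix_vector_mult_def vec_eq_iff inner_vec_def sum_4 algebra_simps)
qed

lemma orthonormal_independent:
  fixes v w :: "'a::euclidean_space"
  assumes "norm v = 1" "norm w = 1" "v \<bullet> w = 0"
  shows "v \<noteq> w" "independent {v, w}"
proof -
  show "v \<noteq> w" using assms by (auto simp: norm_eq_1)
  have "pairwise orthogonal {v, w}" using assms by (auto simp: pairwise_def orthogonal_def inner_commute)
  then show "independent {v, w}"
    using assms by (intro pairwise_orthogonal_independent) auto
qed

lemma Gr2_orthonormal:
  assumes "V \<in> topspace Gr2"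
  obtains v w where "norm v = 1" "norm w = 1" "v \<bullet> w = 0" "V = span {v, w}"
proof -
  have V: "subspace V" "dim V = 2" using assms by (auto simp: topspace_Gr2)
  obtain B where B: "B \<subseteq> V" "pairwise orthogonal B" "\<And>x. x \<in> B \<Longrightarrow> norm x = 1" "card B = dim V" "span B = V"
    using orthonormal_basis_subspace[OF V(1)] by metis
  then obtain v w where vw: "B = {v, w}" "v \<noteq> w" using V card_2_iff by metis
  with B show ?thesis by (intro that[of v w]) (auto simp: pairwise_def orthogonal_def)
qed

lemma proj_of_fixed_iff:
  assumes "V \<in> topspace Gr2"
  shows "proj_of V *v x = x \<longleftrightarrow> x \<in> V"
proof -
  obtain v w where vw: "norm v = 1" "norm w = 1" "v \<bullet> w = 0" and V: "V = span {v, w}"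
    using Gr2_orthonormal[OF assms] .
  have vv: "v \<bullet> v = 1" "w \<bullet> w = 1" "w \<bullet> v = 0" using vw by (simp_all add: dot_square_norm inner_commute)
  have p: "proj_of V *v x = (v \<bullet> x) *\<^sub>R v + (w \<bullet> x) *\<^sub>R w"
    unfolding V by (simp add: proj_of_span orthonormal_independent[OF vw] plane_proj_orthonormal[OF vw])
  show ?thesis
  proof
    assume "proj_of V *v x = x"
    then have "x = (v \<bullet> x) *\<^sub>R v + (w \<bullet> x) *\<^sub>R w" using p by simp
    also have "\<dots> \<in> V" unfolding V by (intro span_add span_scale span_base) auto
    finally show "x \<in> V" .
  next
    assume "x \<in> V"
    then obtain a b where "x = a *\<^sub>R v + b *\<^sub>R w" unfolding V by (rule span_pairE)
    then show "proj_of V *v x = x" unfolding p using vv vw by (simp add: inner_add_right)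
  qed
qed

lemma inj_on_proj_of: "inj_on proj_of (topspace Gr2)"
proof (rule inj_onI)
  fix V W assume V: "V \<in> topspace Gr2" and W: "W \<in> topspace Gr2" and eq: "proj_of V = proj_of W"
  have "x \<in> V \<longleftrightarrow> x \<in> W" for x
    unfolding proj_of_fixed_iff[OF V, symmetric] proj_of_fixed_iff[OF W, symmetric] eq ..
  then show "V = W" by blast
qed

section \<open>Singular data of the elements of a subgroup\<close>

definition e12_plane :: "(real^4) set" where
  "e12_plane = span {axis 1 1, axis 2 1}"

lemma mem_e12_plane: "x \<in> e12_plane \<longleftrightarrow> x$3 = 0 \<and> x$4 = 0"
proof
  assume "x \<in> e12_plane"
  then obtain a b where "x = a *\<^sub>R axis 1 1 + b *\<^sub>R axis 2 1"
    unfolding e12_plane_def by (rule span_pairE)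
  then show "x$3 = 0 \<and> x$4 = 0" by (simp add: axis_def)
next
  assume "x$3 = 0 \<and> x$4 = 0"
  then have "x = x$1 *\<^sub>R axis 1 1 + x$2 *\<^sub>R axis 2 1" by (simp add: vec_eq_iff forall_4 axis_def)
  also have "\<dots> \<in> e12_plane" unfolding e12_plane_def by (intro span_add span_scale span_base) auto
  finally show "x \<in> e12_plane" .
qed

text \<open>\<open>singular_values\<close> and \<open>U2\<close> come from two unrelated choices;
  uniqueness of the singular values lets one decomposition serve both.\<close>

lemma U2_decomposition:
  assumes "invertible g"
  shows "\<exists>k k'. singular_decomposition g k (singular_values g) k' \<and> U2 g = (*v) k ` e12_plane"
proof -
  obtain k0 s0 k0' where d: "singular_decomposition g k0 s0 k0'"
    using singular_decomposition_exists[OF assms] .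
  then have "\<exists>s k k'. singular_decomposition g k s k'" by blast
  then have "\<exists>k k'. singular_decomposition g k (singular_values g) k'"
    unfolding singular_values_def by (rule someI_ex)
  then obtain k1 k1' where d1: "singular_decomposition g k1 (singular_values g) k1'" by blast
  have "\<exists>V k s k'. singular_decomposition g k s k' \<and> V = (*v) k ` span {axis 1 1, axis 2 1}"
    using d by blast
  then have "\<exists>k s k'. singular_decomposition g k s k' \<and> U2 g = (*v) k ` span {axis 1 1, axis 2 1}"
    unfolding U2_def by (rule someI_ex)
  then obtain k s k' where k: "singular_decomposition g k s k'" "U2 g = (*v) k ` e12_plane"
    unfolding e12_plane_def by blast
  moreover have "s = singular_values g" using singular_decomposition_unique[OF k(1) d1] .
  ultimately show ?thesis by blast
qed

definition left_factor :: "mat4 \<Rightarrow> mat4" where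
  "left_factor g = (SOME k. \<exists>k'. singular_decomposition g k (singular_values g) k' \<and> U2 g = (*v) k ` e12_plane)"

definition right_factor :: "mat4 \<Rightarrow> mat4" where
  "right_factor g = (SOME k'. singular_decomposition g (left_factor g) (singular_values g) k')"

lemma left_right_factor:
  assumes "invertible g"
  shows "singular_decomposition g (left_factor g) (singular_values g) (right_factor g)"
    and U2_left_factor: "U2 g = (*v) (left_factor g) ` e12_plane"
proof -
  have "\<exists>k'. singular_decomposition g (left_factor g) (singular_values g) k' \<and> U2 g = (*v) (left_factor g) ` e12_plane"
    unfolding left_factor_def by (rule someI_ex[OF U2_decomposition[OF assms]])
  then obtain k' where k': "singular_decomposition g (left_factor g) (singular_values g) k'"
     and U: "U2 g = (*v) (left_factor g) ` e12_plane" by blast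
  show "singular_decomposition g (left_factor g) (singular_values g) (right_factor g)"
    unfolding right_factor_def by (rule someI[where P="\<lambda>k'. singular_decomposition g (left_factor g) (singular_values g) k'"]) (rule k')
  show "U2 g = (*v) (left_factor g) ` e12_plane" by (rule U)
qed

lemma image_e12_plane:
  "(*v) k ` e12_plane = span {column 1 k, column 2 k}"
proof -
  have "(*v) k ` e12_plane = span ((*v) k ` {axis 1 1, axis 2 1})"
    unfolding e12_plane_def by (rule linear_span_image[symmetric]) simp
  then show ?thesis by (simp add: matrix_vector_mult_basis)
qed

lemma orthogonal_columns12:
  assumes "orthogonal_matrix (k::mat4)"
  shows "norm (column 1 k) = 1" "norm (column 2 k) = 1" "column 1 k \<bullet> column 2 k = 0"
proof -
  have "(1::4) \<noteq> 2" by simp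
  then show "norm (column 1 k) = 1" "norm (column 2 k) = 1" "column 1 k \<bullet> column 2 k = 0"
    using assms unfolding orthogonal_matrix_orthonormal_columns by (auto simp: orthogonal_def)
qed

lemma image_e12_plane_Gr2:
  assumes "orthogonal_matrix k"
  shows "(*v) k ` e12_plane \<in> topspace Gr2" "proj_of ((*v) k ` e12_plane) = plane_proj (ext k E12)"
proof -
  note c = orthonormal_independent[OF orthogonal_columns12[OF assms]]
  show "(*v) k ` e12_plane \<in> topspace Gr2"
    using c unfolding image_e12_plane Gr2_def topspace_quotient_topology by auto
  show "proj_of ((*v) k ` e12_plane) = plane_proj (ext k E12)"
    using c unfolding image_e12_plane ext_E12_eq by (rule proj_of_span)
qed

lemma compact_orthogonal: "compact {Q :: mat4. orthogonal_matrix Q}"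
proof -
  have "{Q :: mat4. orthogonal_matrix Q} = {Q. \<forall>i j. (\<Sum>k\<in>UNIV. Q$k$i * Q$k$j) = (mat 1 :: mat4)$i$j}"
    unfolding orthogonal_matrix by (auto simp: vec_eq_iff matrix_matrix_mult_def transpose_def)
  moreover have "closed {Q :: mat4. \<forall>i j. (\<Sum>k\<in>UNIV. Q$k$i * Q$k$j) = (mat 1 :: mat4)$i$j}"
    by (intro closed_Collect_all closed_Collect_eq continuous_intros)
  moreover have "norm Q = 2" if "orthogonal_matrix Q" for Q :: mat4
  proof -
    note r = orthogonal_matrix_columns4(2)[OF that]
    have "Q \<bullet> Q = 4"
      using r[of 1] r[of 2] r[of 3] r[of 4] by (simp add: inner_matrix sum_4 power2_eq_square)
    then show ?thesis by (simp add: norm_eq_sqrt_inner)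
  qed
  then have "bounded {Q :: mat4. orthogonal_matrix Q}"
    unfolding bounded_iff by (intro exI[of _ 2]) simp
  ultimately show ?thesis by (simp add: compact_eq_bounded_closed)
qed

lemma tendsto_ext:
  assumes "(k \<longlongrightarrow> k0) F"
  shows "((\<lambda>j. ext (k j) X) \<longlongrightarrow> ext k0 X) F"
proof (rule vec_tendstoI, rule vec_tendstoI)
  fix i l
  show "((\<lambda>j. ext (k j) X $ i $ l) \<longlongrightarrow> ext k0 X $ i $ l) F"
    unfolding ext_def matrix_matrix_mult_def transpose_def vec_lambda_beta
    by (intro tendsto_intros assms)
qed

text \<open>Compactness of the orthogonal group makes both factors converge along a subsequence, and
  \<open>proj_of\<close> identifies the limit of the planes. The right factors are kept because
  their limit decides which vectors are attracted to \<open>V\<close>.\<close>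

lemma limit_set2_decomposition:
  assumes V: "V \<in> limit_set2 \<Gamma>" and \<Gamma>: "\<And>g. g \<in> \<Gamma> \<Longrightarrow> invertible g"
  shows "\<exists>\<gamma> k k'. inj \<gamma> \<and> range \<gamma> \<subseteq> \<Gamma> \<and> (\<lambda>j::nat. left_factor (\<gamma> j)) \<longlonglongrightarrow> k \<and> (\<lambda>j. right_factor (\<gamma> j)) \<longlonglongrightarrow> k' \<and>
    orthogonal_matrix k \<and> orthogonal_matrix k' \<and> V = (*v) k ` e12_plane"
proof -
  obtain \<gamma> :: "nat \<Rightarrow> mat4" where g: "inj \<gamma>" "range \<gamma> \<subseteq> \<Gamma>" and lim: "limitin Gr2 (\<lambda>j. U2 (\<gamma> j)) V sequentially"
    using V unfolding limit_set2_def by blast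
  have sd: "singular_decomposition (\<gamma> j) (left_factor (\<gamma> j)) (singular_values (\<gamma> j)) (right_factor (\<gamma> j))" 
    and U: "U2 (\<gamma> j) = (*v) (left_factor (\<gamma> j)) ` e12_plane" for j
    using left_right_factor g \<Gamma> by blast+
  have o: "orthogonal_matrix (left_factor (\<gamma> j))" "orthogonal_matrix (right_factor (\<gamma> j))" for j
    using sd[of j] unfolding singular_decomposition_def by blast+
  have "compact ({Q :: mat4. orthogonal_matrix Q} \<times> {Q :: mat4. orthogonal_matrix Q})"
    by (intro compact_Times compact_orthogonal)
  then have "seq_compact ({Q :: mat4. orthogonal_matrix Q} \<times> {Q :: mat4. orthogonal_matrix Q})"
    by (rule compact_imp_seq_compact)
  moreover have "\<forall>j. (left_factor (\<gamma> j), right_factor (\<gamma> j)) \<in> {Q. orthogonal_matrix Q} \<times> {Q. orthogonal_matrix Q}"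
    using o by simp
  ultimately obtain l r where l: "l \<in> {Q :: mat4. orthogonal_matrix Q} \<times> {Q. orthogonal_matrix Q}"
    and r: "strict_mono (r :: nat \<Rightarrow> nat)" "((\<lambda>j. (left_factor (\<gamma> j), right_factor (\<gamma> j))) \<circ> r) \<longlonglongrightarrow> l"
    by (rule seq_compactE)
  obtain k k' where kk: "l = (k, k')" by fastforce
  have k: "orthogonal_matrix k" "orthogonal_matrix k'" using l kk by auto
  have lk: "(\<lambda>j. left_factor (\<gamma> (r j))) \<longlonglongrightarrow> k" "(\<lambda>j. right_factor (\<gamma> (r j))) \<longlonglongrightarrow> k'"
    using tendsto_fst[OF r(2)] tendsto_snd[OF r(2)] by (simp_all add: kk o_def)
  have "limitin euclidean (proj_of \<circ> (\<lambda>j. U2 (\<gamma> j))) (proj_of V) sequentially"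
    by (rule continuous_map_limit[OF continuous_map_proj_of lim])
  then have "(\<lambda>j. plane_proj (ext (left_factor (\<gamma> j)) E12)) \<longlonglongrightarrow> proj_of V"
    by (simp add: o_def U image_e12_plane_Gr2 o)
  then have "(\<lambda>j. plane_proj (ext (left_factor (\<gamma> (r j))) E12)) \<longlonglongrightarrow> proj_of V"
    using LIMSEQ_subseq_LIMSEQ[OF _ r(1)] by (simp add: o_def)
  moreover have "(\<lambda>j. plane_proj (ext (left_factor (\<gamma> (r j))) E12)) \<longlonglongrightarrow> plane_proj (ext k E12)"
  proof -
    have "open {X :: mat4. X \<noteq> 0}" by (simp add: open_Collect_neq)
    moreover have "ext k E12 \<noteq> 0" using norm_ext_E12[OF k(1)] by auto
    ultimately have "isCont plane_proj (ext k E12)"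
      using continuous_on_plane_proj by (simp add: continuous_on_eq_continuous_at)
    then show ?thesis by (rule isCont_tendsto_compose) (intro tendsto_ext lk)
  qed
  ultimately have "proj_of V = proj_of ((*v) k ` e12_plane)"
    using LIMSEQ_unique k by (simp add: image_e12_plane_Gr2)
  then have "V = (*v) k ` e12_plane"
    using inj_on_proj_of limitin_topspace[OF lim] image_e12_plane_Gr2(1)[OF k(1)]
    by (auto dest: inj_onD)
  moreover have "inj (\<lambda>j. \<gamma> (r j))"
    using inj_compose[OF g(1) strict_mono_imp_inj_on[OF r(1)]] by (simp add: o_def)
  ultimately show ?thesis using k lk g(2) by (intro exI[of _ "\<lambda>j. \<gamma> (r j)"] exI[of _ k] exI[of _ k']) auto
qed

section \<open>The word metric\<close>

abbreviation iv :: "mat4 \<Rightarrow> mat4" where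
  "iv \<equiv> matrix_inv"

lemma iv_inverse:
  fixes A :: mat4
  assumes "invertible A"
  shows "A ** iv A = mat 1" "iv A ** A = mat 1"
proof -
  have "A ** iv A = mat 1 \<and> iv A ** A = mat 1"
    using assms unfolding invertible_def matrix_inv_def by (rule someI_ex)
  then show "A ** iv A = mat 1" "iv A ** A = mat 1" by blast+
qed

lemma iv_unique:
  fixes A B :: mat4
  assumes "A ** B = mat 1"
  shows "iv A = B"
proof -
  have "invertible A" using assms invertible_right_inverse by blast
  then have "iv A ** A = mat 1" by (rule iv_inverse)
  then have "iv A ** (A ** B) = B" by (simp add: matrix_mul_assoc)
  then show ?thesis using assms by simp
qed

lemma iv_mult:
  fixes A B :: mat4
  assumes "invertible A" "invertible B"
  shows "iv (A ** B) = iv B ** iv A"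
proof (rule iv_unique)
  have "A ** B ** (iv B ** iv A) = A ** (B ** iv B) ** iv A" by (simp add: matrix_mul_assoc)
  then show "A ** B ** (iv B ** iv A) = mat 1" using assms by (simp add: iv_inverse)
qed

lemma iv_cancel [simp]:
  fixes A :: mat4
  assumes "invertible A"
  shows "iv A ** A = mat 1" "A ** iv A = mat 1" "X ** iv A ** A = X" "X ** A ** iv A = X"
    "iv A ** (A ** Y) = Y" "A ** (iv A ** Y) = Y"
proof -
  show 1: "iv A ** A = mat 1" "A ** iv A = mat 1"
    using assms by (simp_all add: iv_inverse)
  have "X ** iv A ** A = X ** (iv A ** A)" "X ** A ** iv A = X ** (A ** iv A)" 
    "iv A ** (A ** Y) = (iv A ** A) ** Y" "A ** (iv A ** Y) = (A ** iv A) ** Y"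
    by (simp_all only: matrix_mul_assoc)
  then show "X ** iv A ** A = X" "X ** A ** iv A = X" "iv A ** (A ** Y) = Y" "A ** (iv A ** Y) = Y"
    using 1 by simp_all
qed

lemma iv_iv: "invertible A \<Longrightarrow> iv (iv A) = A" for A :: mat4
  by (rule iv_unique) simp

lemma iv_id: "iv (mat 1) = mat 1"
  by (rule iv_unique) simp

lemma foldr_mult_append: "foldr (**) (xs @ ys) (mat 1) = foldr (**) xs (mat 1) ** foldr (**) ys (mat 1 :: mat4)"
  by (induction xs) (simp_all add: matrix_mul_assoc)

locale anosov_group =
  fixes \<Gamma> S :: "mat4 set" and c C :: real
  assumes subgroup: "subgroup \<Gamma> SL4"
    and finite_gen: "finite S" and gen_sub: "S \<subseteq> \<Gamma>" and gen: "generate SL4 S = \<Gamma>"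
    and c_pos: "c > 0" and C_pos: "C > 0"
    and gap: "\<And>\<gamma>. \<gamma> \<in> \<Gamma> \<Longrightarrow>
          ln (singular_values \<gamma> $ 2 / singular_values \<gamma> $ 3) \<ge> c * real (word_length S \<gamma>) - C"
begin

lemma det_one: "g \<in> \<Gamma> \<Longrightarrow> det g = 1"
  using subgroup.mem_carrier[OF subgroup] by (auto simp: SL4_def)

lemma inv [simp, intro]: "g \<in> \<Gamma> \<Longrightarrow> invertible g"
  by (simp add: invertible_det_nz det_one)

lemma one_mem [simp, intro]: "mat 1 \<in> \<Gamma>"
  using subgroup.one_closed[OF subgroup] by (simp add: SL4_def)

lemma mult_mem [simp, intro]: "g \<in> \<Gamma> \<Longrightarrow> h \<in> \<Gamma> \<Longrightarrow> g ** h \<in> \<Gamma>"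
  using subgroup.m_closed[OF subgroup] by (simp add: SL4_def)

lemma m_inv_eq:
  assumes "g \<in> \<Gamma>"
  shows "m_inv SL4 g = iv g"
proof -
  have "g \<in> carrier SL4" using assms subgroup.mem_carrier[OF subgroup] by blast
  then have "g \<otimes>\<^bsub>SL4\<^esub> m_inv SL4 g = \<one>\<^bsub>SL4\<^esub>" by (rule group.r_inv[OF group_SL4])
  then have "g ** m_inv SL4 g = mat 1" by (simp add: SL4_def)
  then show ?thesis using iv_unique by metis
qed

lemma iv_mem [simp, intro]: "g \<in> \<Gamma> \<Longrightarrow> iv g \<in> \<Gamma>"
  using subgroup.m_inv_closed[OF subgroup] m_inv_eq by force

abbreviation len :: "mat4 \<Rightarrow> nat" where
  "len \<equiv> word_length S"

definition letters :: "mat4 set" where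
  "letters = S \<union> m_inv SL4 ` S"

lemma letters_mem: "s \<in> letters \<Longrightarrow> s \<in> \<Gamma>"
  using gen_sub m_inv_eq by (auto simp: letters_def)

lemma letters_iv: "s \<in> letters \<Longrightarrow> iv s \<in> letters"
  using gen_sub m_inv_eq by (auto simp: letters_def iv_iv subset_iff)

lemma finite_letters: "finite letters"
  using finite_gen by (simp add: letters_def)

lemma foldr_mem: "set ws \<subseteq> letters \<Longrightarrow> foldr (**) ws (mat 1) \<in> \<Gamma>"
  by (induction ws) (auto intro: letters_mem)

lemma exists_word:
  assumes "g \<in> \<Gamma>"
  shows "\<exists>ws. set ws \<subseteq> letters \<and> g = foldr (**) ws (mat 1)"
proof -
  have "g \<in> generate SL4 S" using assms gen by simp
  then show ?thesis
  proof induction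
    case one
    show ?case by (intro exI[of _ "[]"]) (simp add: SL4_def)
  next
    case (incl h)
    then show ?case by (intro exI[of _ "[h]"]) (simp add: letters_def)
  next
    case (inv h)
    then show ?case by (intro exI[of _ "[m_inv SL4 h]"]) (simp add: letters_def)
  next
    case (eng h1 h2)
    then obtain w1 w2 where "set w1 \<subseteq> letters" "h1 = foldr (**) w1 (mat 1)" "set w2 \<subseteq> letters" "h2 = foldr (**) w2 (mat 1)"
      by blast
    then show ?case
      by (intro exI[of _ "w1 @ w2"]) (simp add: SL4_def foldr_mult_append del: foldr_append)
  qed
qed

lemma word_length_eq:
  "len g = (LEAST n. \<exists>ws. length ws = n \<and> set ws \<subseteq> letters \<and> g = foldr (**) ws (mat 1))"
  by (simp add: word_length_def letters_def)

lemma len_le: "set ws \<subseteq> letters \<Longrightarrow> len (foldr (**) ws (mat 1)) \<le> length ws"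
  unfolding word_length_eq by (rule Least_le) blast

lemma geodesic_word:
  assumes "g \<in> \<Gamma>"
  obtains ws where "set ws \<subseteq> letters" "g = foldr (**) ws (mat 1)" "length ws = len g"
proof -
  have "\<exists>n ws. length ws = n \<and> set ws \<subseteq> letters \<and> g = foldr (**) ws (mat 1)"
    using exists_word[OF assms] by blast
  then have "\<exists>ws. length ws = len g \<and> set ws \<subseteq> letters \<and> g = foldr (**) ws (mat 1)"
    unfolding word_length_eq by (rule LeastI_ex)
  then show ?thesis using that by blast
qed

lemma len_mult:
  assumes "g \<in> \<Gamma>" "h \<in> \<Gamma>"
  shows "len (g ** h) \<le> len g + len h"
proof -
  obtain v w where "set v \<subseteq> letters" "g = foldr (**) v (mat 1)" "length v = len g"
     "set w \<subseteq> letters" "h = foldr (**) w (mat 1)" "length w = len h"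
    using geodesic_word assms by metis
  then show ?thesis using len_le[of "v @ w"] by (simp add: foldr_mult_append del: foldr_append)
qed

lemma len_one: "len (mat 1) = 0"
  using len_le[of "[]"] by simp

lemma iv_foldr: "set ws \<subseteq> letters \<Longrightarrow> iv (foldr (**) ws (mat 1)) = foldr (**) (rev (map iv ws)) (mat 1)"
proof (induction ws)
  case (Cons s ws)
  then have "s \<in> \<Gamma>" "foldr (**) ws (mat 1) \<in> \<Gamma>" by (auto intro: letters_mem foldr_mem)
  then have "iv (s ** foldr (**) ws (mat 1)) = iv (foldr (**) ws (mat 1)) ** iv s" by (simp add: iv_mult)
  with Cons show ?case by (simp add: foldr_mult_append del: foldr_append)
qed (simp add: iv_id)

lemma len_iv_le:
  assumes "g \<in> \<Gamma>"
  shows "len (iv g) \<le> len g"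
proof -
  obtain w where w: "set w \<subseteq> letters" "g = foldr (**) w (mat 1)" "length w = len g"
    using geodesic_word assms by metis
  then have "set (rev (map iv w)) \<subseteq> letters" using letters_iv by auto
  then show ?thesis using len_le w iv_foldr[OF w(1)] by fastforce
qed

lemma len_iv: "g \<in> \<Gamma> \<Longrightarrow> len (iv g) = len g"
  using len_iv_le[of g] len_iv_le[of "iv g"] by (simp add: iv_iv)

lemma finite_ball: "finite {g \<in> \<Gamma>. len g \<le> n}"
proof -
  have "{g \<in> \<Gamma>. len g \<le> n} \<subseteq> (\<lambda>ws. foldr (**) ws (mat 1)) ` {ws. set ws \<subseteq> letters \<and> length ws \<le> n}"
  proof
    fix g assume g: "g \<in> {g \<in> \<Gamma>. len g \<le> n}"
    then obtain w where "set w \<subseteq> letters" "g = foldr (**) w (mat 1)" "length w = len g"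
      using geodesic_word[of g] by blast
    with g show "g \<in> (\<lambda>ws. foldr (**) ws (mat 1)) ` {ws. set ws \<subseteq> letters \<and> length ws \<le> n}" by auto
  qed
  then show ?thesis
    by (rule finite_subset) (intro finite_imageI finite_lists_length_le finite_letters)
qed

text \<open>Balls of the word metric are finite, so pairwise distinct elements leave each of
  them.\<close>

lemma len_at_top:
  assumes "inj \<gamma>" "range \<gamma> \<subseteq> \<Gamma>"
  shows "filterlim (\<lambda>j::nat. len (\<gamma> j)) at_top sequentially"
  unfolding filterlim_at_top
proof
  fix n
  have "finite (\<gamma> -` {g \<in> \<Gamma>. len g \<le> n})"
    using finite_ball assms(1) by (rule finite_vimageI)
  moreover have "\<gamma> -` {g \<in> \<Gamma>. len g \<le> n} = {j. len (\<gamma> j) \<le> n}" using assms(2) by auto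
  ultimately have "\<forall>\<^sub>F j in cofinite. \<not> len (\<gamma> j) \<le> n" by (simp add: eventually_cofinite)
  then show "\<forall>\<^sub>F j in sequentially. n \<le> len (\<gamma> j)"
    by (simp add: cofinite_eq_sequentially eventually_mono)
qed

lemma len_mult_at_top:
  assumes "filterlim (\<lambda>j::nat. len (\<gamma> j)) at_top sequentially" "\<And>j. \<gamma> j \<in> \<Gamma>" "u \<in> \<Gamma>"
  shows "filterlim (\<lambda>j. len (u ** \<gamma> j)) at_top sequentially"
  unfolding filterlim_at_top
proof
  fix n
  have "\<forall>\<^sub>F j in sequentially. n + len u \<le> len (\<gamma> j)"
    using assms(1) by (simp add: filterlim_at_top)
  then show "\<forall>\<^sub>F j in sequentially. n \<le> len (u ** \<gamma> j)"
  proof eventually_elim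
    case (elim j)
    have "len (iv u ** (u ** \<gamma> j)) \<le> len (iv u) + len (u ** \<gamma> j)"
      using assms by (intro len_mult) auto
    then show ?case using elim assms by (simp add: len_iv)
  qed
qed

lemma geodesic:
  assumes x: "x \<in> \<Gamma>" and y: "y \<in> \<Gamma>"
  shows "\<exists>q L. q 0 = x \<and> q L = y \<and> (\<forall>i. q i \<in> \<Gamma>) \<and>
    (\<forall>i j. i \<le> j \<longrightarrow> j \<le> L \<longrightarrow> len (iv (q i) ** q j) = j - i)"
proof -
  have "iv x ** y \<in> \<Gamma>" using x y by auto
  then obtain w where w: "set w \<subseteq> letters" "iv x ** y = foldr (**) w (mat 1)" "length w = len (iv x ** y)"
    by (rule geodesic_word)
  define p where "p i = foldr (**) (take i w) (mat 1)" for i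
  have tw: "set (take i w) \<subseteq> letters" "set (drop i w) \<subseteq> letters" for i
    using w(1) set_take_subset[of i w] set_drop_subset[of i w] by auto
  have p: "p i \<in> \<Gamma>" for i unfolding p_def by (rule foldr_mem[OF tw(1)])
  have le: "len (iv (p i) ** p j) \<le> j - i" if "i \<le> j" for i j
  proof -
    have "take j w = take i w @ take (j - i) (drop i w)"
      using that by (metis le_add_diff_inverse take_add)
    then have "p j = p i ** foldr (**) (take (j - i) (drop i w)) (mat 1)"
      by (simp add: p_def foldr_mult_append del: foldr_append)
    then have "iv (p i) ** p j = foldr (**) (take (j - i) (drop i w)) (mat 1)"
      using p[of i] by simp
    moreover have "set (take (j - i) (drop i w)) \<subseteq> letters"
      using tw(2)[of i] set_take_subset[of "j - i" "drop i w"] by auto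
    ultimately have "len (iv (p i) ** p j) \<le> length (take (j - i) (drop i w))" using len_le by metis
    then show ?thesis by simp
  qed
  define L where "L = length w"
  have p0: "p 0 = mat 1" by (simp add: p_def)
  have pL: "p L = iv x ** y" by (simp add: p_def L_def w)
  \<comment> \<open>A shortcut between two prefixes would shorten the whole word, which has minimal
    length.\<close>
  have eq: "len (iv (p i) ** p j) = j - i" if "i \<le> j" "j \<le> L" for i j
  proof -
    have "L = len (p L)" unfolding pL by (simp add: L_def w(3))
    also have "p L = p i ** ((iv (p i) ** p j) ** (iv (p j) ** p L))"
      using p[of i] p[of j] by (simp add: matrix_mul_assoc)
    also have "len \<dots> \<le> len (p i) + len ((iv (p i) ** p j) ** (iv (p j) ** p L))"
      by (intro len_mult mult_mem iv_mem p)
    also have "len ((iv (p i) ** p j) ** (iv (p j) ** p L)) \<le> len (iv (p i) ** p j) + len (iv (p j) ** p L)"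
      by (intro len_mult mult_mem iv_mem p)
    also have "len (iv (p j) ** p L) \<le> L - j" using that by (intro le)
    also have "len (p i) \<le> i" using le[of 0 i] by (simp add: p0 iv_id)
    finally have "L \<le> i + (len (iv (p i) ** p j) + (L - j))" by simp
    then show ?thesis using le[OF that(1)] that by linarith
  qed
  have "iv (x ** p i) ** (x ** p j) = iv (p i) ** p j" for i j
    using x p by (simp add: iv_mult flip: matrix_mul_assoc)
  then show ?thesis
    using x y p p0 pL eq
    by (intro exI[of _ "\<lambda>i. x ** p i"] exI[of _ L]) auto
qed

end

section \<open>Domination along geodesics\<close>

text \<open>The vector in the exterior power that represents a plane is determined only up to sign.\<close>

definition sign_dist :: "'a::real_normed_vector \<Rightarrow> 'a \<Rightarrow> real" where
  "sign_dist X Y = min (norm (X - Y)) (norm (X + Y))"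

lemma sign_dist_nonneg: "0 \<le> sign_dist X Y" by (simp add: sign_dist_def)

lemma sign_dist_refl [simp]: "sign_dist X X = 0" by (simp add: sign_dist_def)

lemma sign_dist_commute: "sign_dist X Y = sign_dist Y X"
  by (simp add: sign_dist_def norm_minus_commute add.commute)

lemma sign_dist_triangle: "sign_dist X Z \<le> sign_dist X Y + sign_dist Y Z"
proof -
  have "norm (X - Z) \<le> norm (X - Y) + norm (Y - Z)" "norm (X - Z) \<le> norm (X + Y) + norm (Y + Z)"
    "norm (X + Z) \<le> norm (X - Y) + norm (Y + Z)" "norm (X + Z) \<le> norm (X + Y) + norm (Y - Z)"
    using norm_triangle_ineq[of "X - Y" "Y - Z"] norm_triangle_ineq4[of "X + Y" "Y + Z"]
      norm_triangle_ineq[of "X - Y" "Y + Z"] norm_triangle_ineq4[of "X + Y" "Y - Z"]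
    by (simp_all add: algebra_simps)
  then show ?thesis unfolding sign_dist_def by linarith
qed

lemma sign_dist_eq_0_iff: "sign_dist X Y = 0 \<longleftrightarrow> X = Y \<or> X = - Y"
  by (auto simp: sign_dist_def min_def eq_neg_iff_add_eq_0 split: if_splits)

lemma tendsto_sign_dist: "(f \<longlongrightarrow> X) F \<Longrightarrow> (g \<longlongrightarrow> Y) F \<Longrightarrow> ((\<lambda>x. sign_dist (f x) (g x)) \<longlongrightarrow> sign_dist X Y) F"
  unfolding sign_dist_def by (intro tendsto_intros)

text \<open>Since x and y have the same norm r, \<bar>t\<bar> r differs from r by at most
  \<open>norm e\<close>. The sign of t decides whether x is close to y or to -y.\<close>

lemma sign_dist_le_residual:
  assumes "norm x = r" "norm y = r" "x = t *\<^sub>R y + e"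
  shows "sign_dist x y \<le> 2 * norm e"
proof (cases "t \<ge> 0")
  case True
  have "\<bar>t * r - r\<bar> \<le> norm e"
    using assms True norm_triangle_ineq[of "t *\<^sub>R y" e] norm_triangle_ineq2[of "t *\<^sub>R y" "- e"]
      norm_triangle_ineq4[of x e] by (simp add: abs_le_iff)
  moreover have e: "x - y = (t - 1) *\<^sub>R y + e" using assms by (simp add: algebra_simps)
  have "norm (x - y) \<le> \<bar>t - 1\<bar> * r + norm e"
    unfolding e using norm_triangle_ineq[of "(t - 1) *\<^sub>R y" e] assms(2) by simp
  moreover have "\<bar>t - 1\<bar> * r = \<bar>t * r - r\<bar>"
    using assms by (metis abs_mult abs_norm_cancel left_diff_distrib mult_1)
  ultimately show ?thesis by (simp add: sign_dist_def)
next
  case False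
  have "\<bar>- t * r - r\<bar> \<le> norm e"
    using assms False norm_triangle_ineq[of "t *\<^sub>R y" e] norm_triangle_ineq2[of "t *\<^sub>R y" "- e"]
      norm_triangle_ineq4[of x e] by (simp add: abs_le_iff)
  moreover have e: "x + y = (t + 1) *\<^sub>R y + e" using assms by (simp add: algebra_simps)
  have "norm (x + y) \<le> \<bar>t + 1\<bar> * r + norm e"
    unfolding e using norm_triangle_ineq[of "(t + 1) *\<^sub>R y" e] assms(2) by simp
  moreover have "\<bar>t + 1\<bar> * r = \<bar>t * r + r\<bar>"
    using assms by (metis abs_mult abs_norm_cancel distrib_right mult_1)
  moreover have "- t * r - r = - (t * r + r)" by simp
  then have "\<bar>- t * r - r\<bar> = \<bar>t * r + r\<bar>" by (simp only: abs_minus_cancel)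
  ultimately show ?thesis by (simp add: sign_dist_def)
qed

lemma sign_dist_witness: "\<exists>A. (A = Y \<or> A = - Y) \<and> sign_dist X Y = norm (X - A)"
proof (cases "norm (X - Y) \<le> norm (X + Y)")
  case True
  then show ?thesis by (intro exI[of _ Y]) (simp add: sign_dist_def)
next
  case False
  then show ?thesis by (intro exI[of _ "- Y"]) (simp add: sign_dist_def)
qed

text \<open>Bilinearity and \<open>pf_bound\<close>; the absolute values make the signs immaterial.
  The 12 is the 6 of \<open>pf_bound\<close> times the bound 2 for the norm
  \<open>sqrt 2\<close>.\<close>

lemma pf_sign_dist:
  assumes "norm X = sqrt 2" "norm X' = sqrt 2" "norm Y = sqrt 2" "norm Y' = sqrt 2"
  shows "\<bar>pf X Y\<bar> \<le> \<bar>pf X' Y'\<bar> + 12 * (sign_dist X X' + sign_dist Y Y')"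
proof -
  have s: "sqrt 2 \<le> (2::real)" by (rule real_le_lsqrt) auto
  have neg: "pf (- A) B = - pf A B" "pf A (- B) = - pf A B" for A B
    by (simp_all add: pf_def algebra_simps)
  have diff: "pf A B - pf A' B' = pf (A - A') B + pf A' (B - B')" for A B A' B'
    by (simp add: pf_def algebra_simps)
  have *: "\<bar>pf X Y\<bar> \<le> \<bar>pf A B\<bar> + 12 * (norm (X - A) + norm (Y - B))"
    if "norm A = sqrt 2" for A B
  proof -
    have "\<bar>pf (X - A) Y\<bar> \<le> 6 * (norm (X - A) * norm Y)" by (rule pf_bound)
    also have "\<dots> \<le> 6 * (norm (X - A) * 2)" unfolding assms using s by (intro mult_left_mono) auto
    finally have 1: "\<bar>pf (X - A) Y\<bar> \<le> 12 * norm (X - A)" by simp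
    have "\<bar>pf A (Y - B)\<bar> \<le> 6 * (norm A * norm (Y - B))" by (rule pf_bound)
    also have "\<dots> \<le> 6 * (2 * norm (Y - B))" unfolding that using s by (intro mult_left_mono mult_right_mono) auto
    finally have "\<bar>pf A (Y - B)\<bar> \<le> 12 * norm (Y - B)" by simp
    then show ?thesis using 1 diff[of X Y A B] by (simp add: algebra_simps)
  qed
  obtain A where A: "A = X' \<or> A = - X'" "sign_dist X X' = norm (X - A)"
    using sign_dist_witness by blast
  obtain B where B: "B = Y' \<or> B = - Y'" "sign_dist Y Y' = norm (Y - B)"
    using sign_dist_witness by blast
  have "norm A = sqrt 2" "\<bar>pf A B\<bar> = \<bar>pf X' Y'\<bar>" using A B assms by (auto simp: neg)
  then show ?thesis using *[of A B] A B by simp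
qed

section \<open>Operator norm on bivectors and singular data of inverses\<close>

lemma norm_ext_singular_decomposition_le:
  assumes sd: "singular_decomposition g k s k'" and X: "X \<in> skew"
  shows "norm (ext g X) \<le> s$1 * s$2 * norm X"
proof -
  have k: "orthogonal_matrix k" "orthogonal_matrix k'" and s: "s$1 \<ge> s$2" "s$2 \<ge> s$3" "s$3 \<ge> s$4" "s$4 \<ge> 0"
    and g: "g = k ** diagonal s ** k'"
    using sd unfolding singular_decomposition_def by blast+
  define Y where "Y = ext k' X"
  have Y: "Y \<in> skew" using X by (simp add: Y_def ext_skew)
  have pos: "0 \<le> s$i" for i using singular_decomposition_nonneg[OF sd] .
  have "norm (ext (diagonal s) Y) \<le> (s$1 * s$2) * norm Y"
  proof (rule norm_le_componentwise_matrix)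
    fix i j
    show "\<bar>ext (diagonal s) Y $ i $ j\<bar> \<le> s$1 * s$2 * \<bar>Y$i$j\<bar>"
    proof (cases "i = j")
      case True
      then show ?thesis using skewD[OF Y, of i i] by (simp add: ext_diagonal)
    next
      case False
      then have "s$i \<le> s$1 \<and> s$j \<le> s$2 \<or> s$i \<le> s$2 \<and> s$j \<le> s$1"
        using s exhaust_4[of i] exhaust_4[of j] by auto
      then have "s$i * s$j \<le> s$1 * s$2"
        using mult_mono[of "s$i" "s$1" "s$j" "s$2"] mult_mono[of "s$i" "s$2" "s$j" "s$1"] pos
        by (auto simp: mult.commute)
      then have "s$i * s$j * \<bar>Y$i$j\<bar> \<le> s$1 * s$2 * \<bar>Y$i$j\<bar>" by (intro mult_right_mono) auto
      then show ?thesis using pos by (simp add: ext_diagonal abs_mult)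
    qed
  qed (use pos in auto)
  then show ?thesis
    using k by (simp add: g ext_mult Y_def norm_ext_orthogonal)
qed

lemma skew_diff:
  assumes "X \<in> skew" "Y \<in> skew"
  shows "X - Y \<in> skew"
proof (rule skewI)
  fix i j show "(X - Y) $ j $ i = - (X - Y) $ i $ j"
    using skewD[OF assms(1), of j i] skewD[OF assms(2), of j i] by simp
qed

lemma skew_scale:
  assumes "X \<in> skew"
  shows "a *\<^sub>R X \<in> skew"
proof (rule skewI)
  fix i j show "(a *\<^sub>R X) $ j $ i = - (a *\<^sub>R X) $ i $ j" using skewD[OF assms, of j i] by simp
qed

text \<open>Inversion reverses the order of the singular values.\<close>

definition anti :: mat4 where
  "anti = (\<chi> i j. if (i,j) = (1,4) \<or> (i,j) = (2,3) \<or> (i,j) = (3,2) \<or> (i,j) = (4,1) then 1 else 0)"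

definition rev_inv :: "real^4 \<Rightarrow> real^4" where
  "rev_inv s = (\<chi> i. if i = 1 then 1 / s$4 else if i = 2 then 1 / s$3 else if i = 3 then 1 / s$2 else 1 / s$1)"

lemma anti_diagonal:
  assumes "\<And>i. s$i \<noteq> 0"
  shows "anti ** diagonal (rev_inv s) ** anti ** diagonal s = mat 1"
  by (simp add: vec_eq_iff forall_4 assms)
    (simp add: matrix_matrix_mult_def sum_4 anti_def rev_inv_def diagonal_def mat_def assms)

lemma orthogonal_anti: "orthogonal_matrix anti"
  unfolding orthogonal_matrix
  by (simp add: vec_eq_iff forall_4 matrix_matrix_mult_def transpose_def sum_4 anti_def mat_def)

lemma singular_decomposition_inverse:
  assumes sd: "singular_decomposition g k s k'" and pos: "\<And>i. s$i > 0"
  shows "singular_decomposition (iv g) (transpose k' ** anti) (rev_inv s) (anti ** transpose k)"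
proof -
  have k: "orthogonal_matrix k" "orthogonal_matrix k'" and s: "s$1 \<ge> s$2" "s$2 \<ge> s$3" "s$3 \<ge> s$4" "s$4 \<ge> 0"
    and g: "g = k ** diagonal s ** k'"
    using sd unfolding singular_decomposition_def by blast+
  let ?h = "(transpose k' ** anti) ** diagonal (rev_inv s) ** (anti ** transpose k)"
  have "?h ** g = transpose k' ** (anti ** diagonal (rev_inv s) ** anti ** ((transpose k ** k) ** diagonal s)) ** k'"
    unfolding g by (simp only: matrix_mul_assoc)
  also have "\<dots> = mat 1"
    using k anti_diagonal[of s] pos by (simp add: orthogonal_matrix_def matrix_mul_assoc less_imp_neq[THEN not_sym])
  finally have "?h ** g = mat 1" .
  then have "iv g = ?h"
    by (intro iv_unique) (simp add: matrix_left_right_inverse)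
  then show ?thesis
    unfolding singular_decomposition_def
    using k s pos orthogonal_anti
    by (simp add: orthogonal_matrix_mul rev_inv_def frac_le less_imp_le)
qed

text \<open>Hodge duality: pairing with the plane of the first two axes is wedging with the plane of
  the last two, up to the determinant of \<open>k'\<close>, which is 1 or -1. By
  \<open>singular_decomposition_inverse\<close> the matrix on the right is a left factor of the
  inverse, so how far g expands a plane is measured by the incidence of that plane with the plane
  \<open>U2\<close> of the inverse.\<close>

lemma E12_pairing:
  assumes "orthogonal_matrix k'"
  shows "\<bar>ext (transpose k') E12 \<bullet> wedge x y\<bar> = 2 * \<bar>pf (ext (transpose k' ** anti) E12) (wedge x y)\<bar>"
proof -
  have "ext anti E12 = wedge (axis 4 1) (axis 3 1)"
    unfolding ext_E12_eq
    by (rule arg_cong2[where f = wedge]) (auto simp: vec_eq_iff column_def anti_def axis_def)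
  then have "ext (transpose k' ** anti) E12 = ext (transpose k') (wedge (axis 4 1) (axis 3 1))"
    by (simp add: ext_mult)
  moreover have "wedge x y = ext (transpose k') (wedge (k' *v x) (k' *v y))"
    using assms by (simp add: orthogonal_matrix_def flip: ext_wedge ext_mult)
  ultimately have "pf (ext (transpose k' ** anti) E12) (wedge x y)
      = det (transpose k') * pf (wedge (axis 4 1) (axis 3 1)) (wedge (k' *v x) (k' *v y))"
    by (simp only: pf_ext_wedge)
  moreover have "\<bar>det (transpose k')\<bar> = 1"
    using det_orthogonal_matrix[of k'] assms by auto
  ultimately have "\<bar>pf (ext (transpose k' ** anti) E12) (wedge x y)\<bar> = \<bar>wedge (k' *v x) (k' *v y) $ 1 $ 2\<bar>"
    by (simp add: abs_mult pf_def wedge_def axis_def)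
  moreover have "ext (transpose k') E12 \<bullet> wedge x y = 2 * wedge (k' *v x) (k' *v y) $ 1 $ 2"
    by (simp add: inner_ext ext_wedge inner_E12 wedge_skew)
  ultimately show ?thesis by (simp add: abs_mult)
qed

context anosov_group
begin

text \<open>Up to a relative error \<open>dl g\<close>, the element \<open>g\<close> acts on the exterior power as the rank-one map
  of norm \<open>N g\<close> taking \<open>aa g\<close> to \<open>bb g\<close>, where \<open>bb g\<close> represents the plane \<open>U\<^sub>2(g)\<close>.\<close>

definition sv where "sv g = singular_values g"
definition N where "N g = sv g $ 1 * sv g $ 2"
definition bb where "bb g = ext (left_factor g) E12"
definition aa where "aa g = ext (transpose (right_factor g)) E12"
definition dl where "dl g = exp (C - c * real (len g))"

lemma sd: "g \<in> \<Gamma> \<Longrightarrow> singular_decomposition g (left_factor g) (sv g) (right_factor g)"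
  using left_right_factor(1)[of g] by (simp add: sv_def)

lemma ortho: "g \<in> \<Gamma> \<Longrightarrow> orthogonal_matrix (left_factor g)" "g \<in> \<Gamma> \<Longrightarrow> orthogonal_matrix (right_factor g)"
  using sd unfolding singular_decomposition_def by blast+

lemma sv_prod:
  assumes "g \<in> \<Gamma>"
  shows "\<bar>sv g $ 1 * sv g $ 2 * sv g $ 3 * sv g $ 4\<bar> = 1"
proof -
  have "g = left_factor g ** diagonal (sv g) ** right_factor g" using sd[OF assms] unfolding singular_decomposition_def by blast
  then have "det g = det (left_factor g) * det (diagonal (sv g)) * det (right_factor g)" by (metis det_mul)
  moreover have "\<bar>det (left_factor g)\<bar> = 1" "\<bar>det (right_factor g)\<bar> = 1"
    using ortho[OF assms] det_orthogonal_matrix by fastforce+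
  moreover have "det (diagonal (sv g)) = sv g $ 1 * sv g $ 2 * sv g $ 3 * sv g $ 4"
    by (simp add: det_4 diagonal_def)
  ultimately show ?thesis using det_one[OF assms] by (metis abs_mult abs_one mult.left_neutral mult.right_neutral)
qed

lemma sv_pos: "g \<in> \<Gamma> \<Longrightarrow> sv g $ i > 0"
proof -
  assume g: "g \<in> \<Gamma>"
  have "sv g $ i \<noteq> 0" using sv_prod[OF g] exhaust_4[of i] by auto
  then show ?thesis using singular_decomposition_nonneg[OF sd[OF g], of i] by simp
qed

lemma sv_mono: "g \<in> \<Gamma> \<Longrightarrow> sv g $ 2 \<le> sv g $ 1" "g \<in> \<Gamma> \<Longrightarrow> sv g $ 3 \<le> sv g $ 2" "g \<in> \<Gamma> \<Longrightarrow> sv g $ 4 \<le> sv g $ 3"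
  using sd unfolding singular_decomposition_def by blast+

text \<open>The four singular values have product 1 and the last two have the smaller product. This
  is the lower bound that the dyadic decay contradicts.\<close>

lemma N_ge_1: assumes "g \<in> \<Gamma>" shows "N g \<ge> 1"
proof -
  note p = sv_pos[OF assms] and m = sv_mono[OF assms]
  have "sv g $ 3 * sv g $ 4 \<le> sv g $ 1 * sv g $ 2"
    using p[of 3] p[of 4] p[of 1] m by (intro mult_mono) auto
  then have "sv g $ 1 * sv g $ 2 * sv g $ 3 * sv g $ 4 \<le> (N g)\<^sup>2"
    using p[of 1] p[of 2] by (simp add: N_def power2_eq_square mult.assoc mult_left_mono)
  moreover have "sv g $ 1 * sv g $ 2 * sv g $ 3 * sv g $ 4 > 0"
    using p by (intro mult_pos_pos)
  ultimately have "1 \<le> (N g)\<^sup>2" using sv_prod[OF assms] by linarith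
  moreover have "N g > 0" using p[of 1] p[of 2] by (simp add: N_def)
  ultimately show ?thesis by (metis abs_of_pos one_le_power power2_le_iff_abs_le zero_le_one abs_one power_one power2_abs abs_le_square_iff)
qed

lemma sv_ratio: assumes "g \<in> \<Gamma>" shows "sv g $ 3 \<le> dl g * sv g $ 2"
proof -
  note p = sv_pos[OF assms]
  have "ln (sv g $ 2 / sv g $ 3) \<ge> c * len g - C" using gap[OF assms] by (simp add: sv_def)
  then have "exp (c * len g - C) \<le> sv g $ 2 / sv g $ 3"
    using p[of 2] p[of 3] by (simp add: ln_ge_iff)
  moreover have "exp (c * len g - C) = inverse (dl g)" by (simp add: dl_def flip: exp_minus)
  moreover have "dl g > 0" by (simp add: dl_def)
  ultimately show ?thesis using p[of 3] by (simp add: field_simps)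
qed

lemma norm_bb: "g \<in> \<Gamma> \<Longrightarrow> norm (bb g) = sqrt 2" and norm_aa: "g \<in> \<Gamma> \<Longrightarrow> norm (aa g) = sqrt 2"
  using ortho by (simp_all add: bb_def aa_def norm_ext_E12)

lemma bb_skew: "bb g \<in> skew" and aa_skew: "aa g \<in> skew"
  by (simp_all add: bb_def aa_def ext_skew E12_skew)

lemma ext_approx:
  assumes g: "g \<in> \<Gamma>" and X: "X \<in> skew"
  shows "norm (ext g X - (N g * (aa g \<bullet> X) / 2) *\<^sub>R bb g) \<le> dl g * N g * norm X"
proof -
  have "sv g $ 1 * sv g $ 3 \<le> dl g * N g"
    using sv_ratio[OF g] sv_pos[OF g, of 1] by (simp add: N_def mult_left_mono mult_ac)
  then have "sv g $ 1 * sv g $ 3 * norm X \<le> dl g * N g * norm X" by (rule mult_right_mono) simp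
  then show ?thesis
    using ext_singular_decomposition[OF sd[OF g] X] by (simp add: N_def aa_def bb_def)
qed

lemma ext_aa: "g \<in> \<Gamma> \<Longrightarrow> ext g (aa g) = N g *\<^sub>R bb g"
  using ext_singular_decomposition_E12[OF sd] by (simp add: N_def aa_def bb_def)

lemma norm_ext_le: "g \<in> \<Gamma> \<Longrightarrow> X \<in> skew \<Longrightarrow> norm (ext g X) \<le> N g * norm X"
  using norm_ext_singular_decomposition_le[OF sd] by (simp add: N_def)

section \<open>Norms of products and motion of the attracting planes\<close>

lemma N_mult_le:
  assumes "g \<in> \<Gamma>" "h \<in> \<Gamma>"
  shows "N (g ** h) \<le> N g * N h"
proof -
  have gh: "g ** h \<in> \<Gamma>" using assms by simp
  have "N (g ** h) * sqrt 2 = norm (ext (g ** h) (aa (g ** h)))"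
    using N_ge_1[OF gh] by (simp add: ext_aa[OF gh] norm_bb[OF gh])
  also have "\<dots> \<le> N g * norm (ext h (aa (g ** h)))"
    unfolding ext_mult using assms by (intro norm_ext_le ext_skew aa_skew)
  also have "\<dots> \<le> N g * (N h * norm (aa (g ** h)))"
    using assms N_ge_1[of g] by (intro mult_left_mono norm_ext_le aa_skew) auto
  finally show ?thesis using norm_aa[OF gh] by simp
qed

text \<open>Up to the factor \<open>N g\<close>, \<open>bb g\<close> is the image of
  \<open>aa g\<close> under g, so its image under u is a value of the product u g, which maps
  everything close to the line of \<open>bb (u ** g)\<close>. Submultiplicativity pays for the
  division by \<open>N g\<close>.\<close>

lemma ext_bb:
  assumes "u \<in> \<Gamma>" "g \<in> \<Gamma>"
  shows "\<exists>t. norm (ext u (bb g) - t *\<^sub>R bb (u ** g)) \<le> 2 * N u * dl (u ** g)"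
proof -
  have ug: "u ** g \<in> \<Gamma>" using assms by simp
  have "ext (u ** g) (aa g) = N g *\<^sub>R ext u (bb g)"
    using assms by (simp add: ext_mult ext_aa ext_scaleR)
  then have "norm (N g *\<^sub>R ext u (bb g) - (N (u ** g) * (aa (u ** g) \<bullet> aa g) / 2) *\<^sub>R bb (u ** g)) \<le> dl (u ** g) * N (u ** g) * sqrt 2"
    using ext_approx[OF ug aa_skew, of g] assms by (simp add: norm_aa)
  moreover define t where "t = N (u ** g) * (aa (u ** g) \<bullet> aa g) / 2 / N g"
  have Ng: "N g > 0" using N_ge_1[of g] assms by simp
  then have "N (u ** g) * (aa (u ** g) \<bullet> aa g) / 2 = N g * t" by (simp add: t_def)
  ultimately have "norm (N g *\<^sub>R (ext u (bb g) - t *\<^sub>R bb (u ** g))) \<le> dl (u ** g) * N (u ** g) * sqrt 2"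
    by (simp add: scaleR_diff_right)
  then have "N g * norm (ext u (bb g) - t *\<^sub>R bb (u ** g)) \<le> dl (u ** g) * N (u ** g) * sqrt 2"
    using Ng by simp
  also have "\<dots> \<le> dl (u ** g) * (N u * N g) * 2"
    using assms N_ge_1[OF ug] N_ge_1[OF assms(1)] N_ge_1[OF assms(2)]
    by (intro mult_mono N_mult_le real_le_lsqrt) (auto simp: dl_def intro!: mult_nonneg_nonneg)
  finally have "N g * norm (ext u (bb g) - t *\<^sub>R bb (u ** g)) \<le> N g * (2 * N u * dl (u ** g))"
    by (simp add: mult_ac)
  then show ?thesis using Ng by (intro exI[of _ t]) (simp add: mult.assoc)
qed

text \<open>The vector \<open>bb (g ** s)\<close> is, up to scale, g applied to X, the image of the
  top direction of the product under s; so it lies near the line of \<open>bb g\<close> with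
  relative error \<open>dl g\<close>. The factor \<open>N (iv s)\<close> bounds \<open>N g\<close>
  by the norm of the product.\<close>

lemma bb_step:
  assumes g: "g \<in> \<Gamma>" and s: "s \<in> \<Gamma>"
  shows "sign_dist (bb (g ** s)) (bb g) \<le> 4 * N s * N (iv s) * dl g"
proof -
  have gs: "g ** s \<in> \<Gamma>" using assms by simp
  define X where "X = ext s (aa (g ** s))"
  have X: "X \<in> skew" "norm X \<le> N s * sqrt 2"
    using norm_ext_le[OF s aa_skew, of "g ** s"] by (simp_all add: X_def ext_skew aa_skew norm_aa[OF gs])
  define t where "t = N g * (aa g \<bullet> X) / 2"
  define e where "e = ext g X - t *\<^sub>R bb g"
  have "norm e \<le> dl g * N g * norm X" unfolding e_def t_def by (rule ext_approx[OF g X(1)])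
  also have "\<dots> \<le> dl g * N g * (N s * 2)"
  proof (rule mult_left_mono)
    have "N s * sqrt 2 \<le> N s * 2"
      using N_ge_1[OF s] by (intro mult_left_mono real_le_lsqrt) auto
    then show "norm X \<le> N s * 2" using X(2) by simp
  qed (use N_ge_1[OF g] in \<open>simp add: dl_def\<close>)
  finally have e: "norm e \<le> dl g * N g * (N s * 2)" .
  have N: "N (g ** s) > 0" using N_ge_1[OF gs] by simp
  have "N (g ** s) *\<^sub>R bb (g ** s) = t *\<^sub>R bb g + e"
    using ext_aa[OF gs] by (simp add: e_def X_def ext_mult)
  then have "inverse (N (g ** s)) *\<^sub>R N (g ** s) *\<^sub>R bb (g ** s) = inverse (N (g ** s)) *\<^sub>R (t *\<^sub>R bb g + e)" by simp
  then have "bb (g ** s) = (t / N (g ** s)) *\<^sub>R bb g + (inverse (N (g ** s)) *\<^sub>R e)"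
    using N by (simp add: scaleR_add_right divide_inverse mult.commute)
  then have "sign_dist (bb (g ** s)) (bb g) \<le> 2 * norm (inverse (N (g ** s)) *\<^sub>R e)"
    by (rule sign_dist_le_residual[OF norm_bb[OF gs] norm_bb[OF g]])
  also have "\<dots> = 2 * (norm e / N (g ** s))" using N by (simp add: divide_inverse)
  also have "norm e / N (g ** s) \<le> dl g * (N (g ** s) * N (iv s)) * (N s * 2) / N (g ** s)"
  proof (intro divide_right_mono order.trans[OF e] mult_right_mono mult_left_mono)
    show "N g \<le> N (g ** s) * N (iv s)"
      using N_mult_le[OF gs iv_mem[OF s]] s by simp
  qed (use N N_ge_1[OF s] in \<open>auto simp: dl_def\<close>)
  also have "\<dots> = 2 * N s * N (iv s) * dl g" using N by simp
  finally show ?thesis by simp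
qed

definition K where "K = Max (N ` {g \<in> \<Gamma>. len g \<le> 1})"

lemma N_le_K: "g \<in> \<Gamma> \<Longrightarrow> len g \<le> 1 \<Longrightarrow> N g \<le> K"
  unfolding K_def by (intro Max_ge finite_imageI finite_ball) auto

lemma K_ge_1: "K \<ge> 1"
  using N_le_K[OF one_mem] N_ge_1[OF one_mem] len_one by linarith

text \<open>The constant of \<open>bb_step\<close> for s of length at most 1, where both norms are
  at most \<open>K\<close>; \<open>exp C\<close> comes from \<open>dl\<close>.\<close>

definition C2 where "C2 = 4 * K\<^sup>2 * exp C"

lemma C2_pos: "C2 > 0" using K_ge_1 by (simp add: C2_def)

lemma bb_adjacent:
  assumes "g \<in> \<Gamma>" "h \<in> \<Gamma>" "len (iv g ** h) \<le> 1"
  shows "sign_dist (bb h) (bb g) \<le> C2 * exp (- (c * len g))"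
proof -
  define s where "s = iv g ** h"
  have s: "s \<in> \<Gamma>" "len s \<le> 1" "h = g ** s" using assms by (simp_all add: s_def)
  have "sign_dist (bb h) (bb g) \<le> 4 * (N s * N (iv s)) * dl g" using bb_step[OF assms(1) s(1)] s(3) by simp
  also have "N s * N (iv s) \<le> K * K"
    using s N_ge_1[OF s(1)] N_ge_1[of "iv s"] K_ge_1 by (intro mult_mono N_le_K) (auto simp: len_iv)
  also have "4 * (K * K) * dl g = C2 * exp (- (c * len g))"
    by (simp add: C2_def dl_def power2_eq_square exp_diff exp_minus divide_inverse)
  finally show ?thesis by (simp add: dl_def)
qed

text \<open>A geometric series: if the path stays at distance \<alpha> + \<beta> i from the
  identity, its planes move by steps of ratio \<open>exp (- (c * \<beta>))\<close>, and the total
  drift is a constant times the first step.\<close>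

lemma bb_path:
  assumes p: "\<And>i. i \<le> n \<Longrightarrow> p i \<in> \<Gamma>" and adj: "\<And>i. i < n \<Longrightarrow> len (iv (p i) ** p (Suc i)) \<le> 1"
    and away: "\<And>i. i < n \<Longrightarrow> \<alpha> + \<beta> * real i \<le> len (p i)" and \<beta>: "\<beta> > 0"
  shows "sign_dist (bb (p 0)) (bb (p n)) \<le> C2 * exp (- (c * \<alpha>)) / (1 - exp (- (c * \<beta>)))"
proof -
  define r where "r = exp (- (c * \<beta>))"
  have r: "0 \<le> r" "r < 1" using c_pos \<beta> by (simp_all add: r_def)
  have "sign_dist (bb (p 0)) (bb (p m)) \<le> (\<Sum>i<m. C2 * exp (- (c * \<alpha>)) * r ^ i)" if "m \<le> n" for m
    using that
  proof (induction m)
    case (Suc m)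
    have "sign_dist (bb (p 0)) (bb (p (Suc m))) \<le> sign_dist (bb (p 0)) (bb (p m)) + sign_dist (bb (p m)) (bb (p (Suc m)))"
      by (rule sign_dist_triangle)
    moreover have "sign_dist (bb (p (Suc m))) (bb (p m)) \<le> C2 * exp (- (c * len (p m)))"
      using Suc p adj by (intro bb_adjacent) auto
    moreover have "c * (\<alpha> + \<beta> * real m) \<le> c * len (p m)"
      using away[of m] Suc c_pos by (intro mult_left_mono) auto
    then have "exp (- (c * len (p m))) \<le> exp (- (c * (\<alpha> + \<beta> * real m)))" by simp
    moreover have "exp (- (c * (\<alpha> + \<beta> * real m))) = exp (- (c * \<alpha>)) * r ^ m"
      by (simp add: r_def flip: exp_of_nat_mult exp_add) (simp add: algebra_simps)
    ultimately have "sign_dist (bb (p 0)) (bb (p (Suc m))) \<le> sign_dist (bb (p 0)) (bb (p m)) + C2 * (exp (- (c * \<alpha>)) * r ^ m)"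
      using C2_pos sign_dist_commute[of "bb (p m)"] by (smt (verit) mult_left_mono)
    then show ?case using Suc by (simp add: mult.assoc)
  qed simp
  then have "sign_dist (bb (p 0)) (bb (p n)) \<le> (\<Sum>i<n. C2 * exp (- (c * \<alpha>)) * r ^ i)" by simp
  also have "\<dots> = C2 * exp (- (c * \<alpha>)) * (\<Sum>i<n. r ^ i)" by (simp add: sum_distrib_left)
  also have "\<dots> \<le> C2 * exp (- (c * \<alpha>)) * (1 / (1 - r))"
  proof (rule mult_left_mono)
    have "(\<Sum>i<n. r ^ i) \<le> (\<Sum>i. r ^ i)"
      using r by (intro sum_le_suminf summable_geometric) auto
    then show "(\<Sum>i<n. r ^ i) \<le> 1 / (1 - r)" using r by (simp add: suminf_geometric)
  qed (use C2_pos in auto)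
  finally show ?thesis by (simp add: r_def)
qed

definition C3 where "C3 = C2 / (1 - exp (- c))"

lemma C3_pos: "C3 > 0" using C2_pos c_pos by (simp add: C3_def)

text \<open>On a geodesic starting at the identity the length grows with rate 1, so
  \<open>bb_path\<close> applies with \<beta> = 1; \<open>C3\<close> is the resulting
  constant.\<close>

lemma bb_ray:
  assumes p: "\<And>i. p i \<in> \<Gamma>" and geo: "\<And>i j. i \<le> j \<Longrightarrow> j \<le> L \<Longrightarrow> len (iv (p i) ** p j) = j - i"
    and p0: "p 0 = mat 1" and m: "m \<le> L"
  shows "sign_dist (bb (p m)) (bb (p L)) \<le> C3 * exp (- (c * real m))"
proof -
  have "sign_dist (bb (p (m + 0))) (bb (p (m + (L - m)))) \<le> C2 * exp (- (c * real m)) / (1 - exp (- (c * 1)))"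
  proof (rule bb_path)
    fix i assume i: "i < L - m"
    show "real m + 1 * real i \<le> real (len (p (m + i)))"
      using geo[of 0 "m + i"] i by (simp add: p0 iv_id)
    show "len (iv (p (m + i)) ** p (m + Suc i)) \<le> 1" using geo[of "m + i" "m + Suc i"] i by simp
  qed (use p in auto)
  then show ?thesis using m by (simp add: C3_def)
qed

section \<open>Loss of norm in products with nearly incident planes\<close>

definition C5 where "C5 = 2 + 24 * C3 + 2 * exp C"

lemma C5_pos: "C5 > 1" using C3_pos by (simp add: C5_def add_pos_pos)

text \<open>\<open>bb (iv g)\<close> stems from its own choice of a decomposition of the inverse;
  the strict gap identifies it, up to sign, with the one obtained by inverting the decomposition of
  g.\<close>

lemma aa_pairing:
  assumes g: "g \<in> \<Gamma>" and h: "h \<in> \<Gamma>" and lt: "sv g $ 3 < sv g $ 2"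
  shows "\<bar>aa g \<bullet> bb h\<bar> = 2 * \<bar>pf (bb (iv g)) (bb h)\<bar>"
proof -
  note sdi = singular_decomposition_inverse[OF sd[OF g] sv_pos[OF g]]
  have "rev_inv (sv g) $ 3 < rev_inv (sv g) $ 2"
    using lt sv_pos[OF g] by (simp add: rev_inv_def frac_less2)
  then have "ext (transpose (right_factor g) ** anti) E12 = bb (iv g) \<or> ext (transpose (right_factor g) ** anti) E12 = - bb (iv g)"
    unfolding bb_def by (intro singular_decomposition_E12_unique[OF sdi sd[OF iv_mem[OF g]]])
  moreover have "pf (- A) B = - pf A B" for A B by (simp add: pf_def algebra_simps)
  ultimately have "\<bar>pf (ext (transpose (right_factor g) ** anti) E12) (bb h)\<bar> = \<bar>pf (bb (iv g)) (bb h)\<bar>" by auto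
  moreover have "\<bar>aa g \<bullet> bb h\<bar> = 2 * \<bar>pf (ext (transpose (right_factor g) ** anti) E12) (bb h)\<bar>"
    unfolding aa_def bb_def[of h] ext_E12_eq[of "left_factor h"] by (rule E12_pairing[OF ortho(2)[OF g]])
  ultimately show ?thesis by simp
qed

text \<open>B sends almost everything towards \<open>bb B\<close>. If this plane nearly meets the
  plane of \<open>iv A\<close>, then A expands it little, and the product falls short of
  \<open>N A * N B\<close>. Y and Z stand for the far ends of a geodesic, where incidence is known;
  the two distance hypotheses carry it to the ends of the short segments.\<close>

lemma N_submultiplicative_gain:
  assumes A: "A \<in> \<Gamma>" "len A = m" and B: "B \<in> \<Gamma>" "len B = m" and YZ: "Y \<in> \<Gamma>" "Z \<in> \<Gamma>"
    and pdA: "sign_dist (bb (iv A)) (bb Y) \<le> C3 * exp (- (c * real m))"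
    and pdB: "sign_dist (bb B) (bb Z) \<le> C3 * exp (- (c * real m))"
    and pf: "\<bar>pf (bb Y) (bb Z)\<bar> \<le> exp (- (c * real m))"
  shows "N (A ** B) \<le> C5 * exp (- (c * real m)) * (N A * N B)"
proof -
  have AB: "A ** B \<in> \<Gamma>" using A B by simp
  note NA = N_ge_1[OF A(1)] and NB = N_ge_1[OF B(1)]
  have dl: "dl A = exp C * exp (- (c * real m))" "dl B = exp C * exp (- (c * real m))"
    using A B by (simp_all add: dl_def exp_diff exp_minus divide_inverse)
  have dlp: "dl A > 0" "dl B > 0" by (simp_all add: dl_def)
  show ?thesis
  proof (cases "sv A $ 3 < sv A $ 2")
    \<comment> \<open>Without a strict gap \<open>dl A\<close> is at least 1, and the claim reduces
      to submultiplicativity.\<close>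
    case False
    then have "sv A $ 2 \<le> dl A * sv A $ 2" using sv_ratio[OF A(1)] by simp
    then have "1 \<le> dl A" using sv_pos[OF A(1), of 2] by simp
    also have "\<dots> \<le> C5 * exp (- (c * real m))"
      unfolding dl using C3_pos by (intro mult_right_mono) (auto simp: C5_def)
    finally have "1 * (N A * N B) \<le> C5 * exp (- (c * real m)) * (N A * N B)"
      using NA NB by (intro mult_right_mono) auto
    then show ?thesis using N_mult_le[OF A(1) B(1)] by simp
  next
    case True
    have "\<bar>pf (bb (iv A)) (bb B)\<bar> \<le> \<bar>pf (bb Y) (bb Z)\<bar> + 12 * (sign_dist (bb (iv A)) (bb Y) + sign_dist (bb B) (bb Z))"
      using A B YZ by (intro pf_sign_dist norm_bb) auto
    also have "\<dots> \<le> exp (- (c * real m)) + 12 * (C3 * exp (- (c * real m)) + C3 * exp (- (c * real m)))"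
      using pf pdA pdB by simp
    finally have q: "\<bar>aa A \<bullet> bb B\<bar> / 2 \<le> (1 + 24 * C3) * exp (- (c * real m))"
      unfolding aa_pairing[OF A(1) B(1) True] by (simp add: algebra_simps)
    have "norm (ext A (bb B)) \<le> norm ((N A * (aa A \<bullet> bb B) / 2) *\<^sub>R bb A) + dl A * N A * norm (bb B)"
      using ext_approx[OF A(1) bb_skew[of B]] norm_triangle_sub[of "ext A (bb B)" "(N A * (aa A \<bullet> bb B) / 2) *\<^sub>R bb A"] by linarith
    also have "\<dots> = (\<bar>aa A \<bullet> bb B\<bar> / 2 + dl A) * (N A * sqrt 2)"
      using NA by (simp add: norm_bb A B abs_mult algebra_simps)
    finally have 1: "norm (ext A (bb B)) \<le> (\<bar>aa A \<bullet> bb B\<bar> / 2 + dl A) * (N A * sqrt 2)" .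
    define a where "a = aa (A ** B)"
    have a: "norm a = sqrt 2" "a \<in> skew" using AB by (simp_all add: a_def norm_aa aa_skew)
    define t where "t = N B * (aa B \<bullet> a) / 2"
    have "\<bar>aa B \<bullet> a\<bar> \<le> norm (aa B) * norm a" by (rule Cauchy_Schwarz_ineq2)
    then have t: "\<bar>t\<bar> \<le> N B" using a NB by (simp add: t_def norm_aa B abs_mult)
    have "ext B a = t *\<^sub>R bb B + (ext B a - t *\<^sub>R bb B)" by simp
    then have "ext A (ext B a) = t *\<^sub>R ext A (bb B) + ext A (ext B a - t *\<^sub>R bb B)"
      by (metis ext_add ext_scaleR)
    then have "norm (ext A (ext B a)) \<le> \<bar>t\<bar> * norm (ext A (bb B)) + norm (ext A (ext B a - t *\<^sub>R bb B))"
      using norm_triangle_ineq[of "t *\<^sub>R ext A (bb B)"] by simp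
    also have "\<bar>t\<bar> * norm (ext A (bb B)) \<le> N B * ((\<bar>aa A \<bullet> bb B\<bar> / 2 + dl A) * (N A * sqrt 2))"
      using t 1 by (intro mult_mono) auto
    also have "norm (ext A (ext B a - t *\<^sub>R bb B)) \<le> N A * norm (ext B a - t *\<^sub>R bb B)"
      using A(1) a by (intro norm_ext_le skew_diff skew_scale ext_skew bb_skew)
    also have "N A * norm (ext B a - t *\<^sub>R bb B) \<le> N A * (dl B * N B * sqrt 2)"
      using ext_approx[OF B(1) a(2)] NA a by (simp add: t_def)
    also have "ext A (ext B a) = N (A ** B) *\<^sub>R bb (A ** B)"
      unfolding a_def using ext_aa[OF AB] by (simp add: ext_mult)
    also have "norm \<dots> = N (A ** B) * sqrt 2" using N_ge_1[OF AB] by (simp add: norm_bb AB)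
    finally have "N (A ** B) * sqrt 2 \<le> ((\<bar>aa A \<bullet> bb B\<bar> / 2 + dl A + dl B) * (N A * N B)) * sqrt 2"
      by (simp add: algebra_simps)
    then have "N (A ** B) \<le> (\<bar>aa A \<bullet> bb B\<bar> / 2 + dl A + dl B) * (N A * N B)" by simp
    also have "\<dots> \<le> (C5 * exp (- (c * real m))) * (N A * N B)"
    proof (rule mult_right_mono)
      \<comment> \<open>Origin of \<open>C5\<close>: \<open>24 * C3\<close> is the 12 of
        \<open>pf_sign_dist\<close> for each of the two displaced planes, and
        \<open>2 * exp C\<close> collects the rank-one errors of both factors.\<close>
      have "\<bar>aa A \<bullet> bb B\<bar> / 2 + dl A + dl B \<le> (1 + 24 * C3 + 2 * exp C) * exp (- (c * real m))"
        using q unfolding dl by (simp add: algebra_simps)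
      also have "\<dots> \<le> C5 * exp (- (c * real m))" by (intro mult_right_mono) (auto simp: C5_def)
      finally show "\<bar>aa A \<bullet> bb B\<bar> / 2 + dl A + dl B \<le> C5 * exp (- (c * real m))" .
    qed (use NA NB in simp)
    finally show ?thesis .
  qed
qed

end

section \<open>Limits of attracting planes under translation\<close>

lemma tendsto_pf: "(f \<longlongrightarrow> X) F \<Longrightarrow> (g \<longlongrightarrow> Y) F \<Longrightarrow> ((\<lambda>x. pf (f x) (g x)) \<longlongrightarrow> pf X Y) F"
  unfolding pf_def by (intro tendsto_intros)

context anosov_group
begin

lemma dl_tendsto_0:
  assumes "filterlim (\<lambda>j::nat. len (\<gamma> j)) at_top sequentially"
  shows "(\<lambda>j. dl (\<gamma> j)) \<longlonglongrightarrow> 0"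
proof -
  have "filterlim (\<lambda>n::nat. C - c * real n) at_bot sequentially" using c_pos by real_asymp
  then have "filterlim (\<lambda>n::nat. exp (C - c * real n)) (nhds 0) sequentially"
    by (rule filterlim_compose[OF exp_at_bot])
  then show ?thesis unfolding dl_def by (rule filterlim_compose[OF _ assms])
qed

text \<open>The error tends to 0 with \<open>dl\<close>. The scalars stay away from 0 because u is
  invertible: the image of \<open>bb (\<gamma> j)\<close> has norm at least
  \<open>sqrt 2 / N (iv u)\<close>.\<close>

lemma ext_bb_sequence:
  assumes \<gamma>: "\<And>j::nat. \<gamma> j \<in> \<Gamma>" and lim: "filterlim (\<lambda>j. len (\<gamma> j)) at_top sequentially" and u: "u \<in> \<Gamma>"
  obtains t where "(\<lambda>j. ext u (bb (\<gamma> j)) - t j *\<^sub>R bb (u ** \<gamma> j)) \<longlonglongrightarrow> 0"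
    "\<forall>\<^sub>F j in sequentially. 1 / (2 * N (iv u)) \<le> \<bar>t j\<bar>"
proof -
  have "\<forall>j. \<exists>t. norm (ext u (bb (\<gamma> j)) - t *\<^sub>R bb (u ** \<gamma> j)) \<le> 2 * N u * dl (u ** \<gamma> j)"
    using ext_bb[OF u \<gamma>] by blast
  then obtain t where t: "\<And>j. norm (ext u (bb (\<gamma> j)) - t j *\<^sub>R bb (u ** \<gamma> j)) \<le> 2 * N u * dl (u ** \<gamma> j)"
    by metis
  have "(\<lambda>j. 2 * N u * dl (u ** \<gamma> j)) \<longlonglongrightarrow> 2 * N u * 0"
    by (intro tendsto_mult_left dl_tendsto_0 len_mult_at_top lim \<gamma> u)
  then have e: "(\<lambda>j. ext u (bb (\<gamma> j)) - t j *\<^sub>R bb (u ** \<gamma> j)) \<longlonglongrightarrow> 0"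
    using Lim_null_comparison[OF always_eventually[OF allI[OF t]]] by (simp only: mult_zero_right)
  have Nu: "N (iv u) \<ge> 1" using u by (simp add: N_ge_1)
  \<comment> \<open>Half of the lower bound on the norm of the image, so that half survives the
    error.\<close>
  define \<delta> where "\<delta> = sqrt 2 / (2 * N (iv u))"
  have "\<delta> > 0" using Nu by (simp add: \<delta>_def)
  then have "\<forall>\<^sub>F j in sequentially. norm (ext u (bb (\<gamma> j)) - t j *\<^sub>R bb (u ** \<gamma> j)) < \<delta>"
    using e by (simp add: tendsto_iff)
  then have "\<forall>\<^sub>F j in sequentially. 1 / (2 * N (iv u)) \<le> \<bar>t j\<bar>"
  proof eventually_elim
    case (elim j)
    have "bb (\<gamma> j) = ext (iv u) (ext u (bb (\<gamma> j)))" using u by (simp flip: ext_mult)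
    then have "sqrt 2 \<le> N (iv u) * norm (ext u (bb (\<gamma> j)))"
      using norm_ext_le[OF iv_mem[OF u] ext_skew[OF bb_skew], of u "\<gamma> j"] norm_bb[OF \<gamma>[of j]] by simp
    then have "2 * \<delta> \<le> norm (ext u (bb (\<gamma> j)))" using Nu by (simp add: \<delta>_def field_simps)
    moreover have "norm (ext u (bb (\<gamma> j))) \<le> norm (t j *\<^sub>R bb (u ** \<gamma> j)) + norm (ext u (bb (\<gamma> j)) - t j *\<^sub>R bb (u ** \<gamma> j))"
      by (rule norm_triangle_sub)
    moreover have "norm (t j *\<^sub>R bb (u ** \<gamma> j)) = \<bar>t j\<bar> * sqrt 2"
      using norm_bb u \<gamma> by simp
    ultimately have "\<delta> \<le> \<bar>t j\<bar> * sqrt 2" using elim by linarith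
    moreover have "\<delta> = 1 / (2 * N (iv u)) * sqrt 2" by (simp add: \<delta>_def)
    ultimately have "1 / (2 * N (iv u)) * sqrt 2 \<le> \<bar>t j\<bar> * sqrt 2" by (simp only:)
    then show ?case by (rule mult_right_le_imp_le) simp
  qed
  with e show ?thesis by (rule that)
qed

text \<open>Acting by u multiplies \<open>pf\<close> by the determinant, so incidence passes to the
  translated limits. The vectors \<open>bb (u ** \<gamma> j)\<close> need not converge, if only
  because of their signs; hence the conclusion is about the pairing, and the scalars are divided out
  by means of their lower bounds.\<close>

lemma pf_equivariant_limit:
  assumes \<gamma>: "\<And>j::nat. \<gamma> j \<in> \<Gamma>" "filterlim (\<lambda>j. len (\<gamma> j)) at_top sequentially" "(\<lambda>j. bb (\<gamma> j)) \<longlonglongrightarrow> X"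
    and \<eta>: "\<And>j::nat. \<eta> j \<in> \<Gamma>" "filterlim (\<lambda>j. len (\<eta> j)) at_top sequentially" "(\<lambda>j. bb (\<eta> j)) \<longlonglongrightarrow> Y"
    and pf0: "pf X Y = 0" and u: "u \<in> \<Gamma>"
  shows "(\<lambda>j. pf (bb (u ** \<gamma> j)) (bb (u ** \<eta> j))) \<longlonglongrightarrow> 0"
proof -
  obtain t where t: "(\<lambda>j. ext u (bb (\<gamma> j)) - t j *\<^sub>R bb (u ** \<gamma> j)) \<longlonglongrightarrow> 0"
    "\<forall>\<^sub>F j in sequentially. 1 / (2 * N (iv u)) \<le> \<bar>t j\<bar>"
    using ext_bb_sequence[OF \<gamma>(1,2) u] .
  obtain t' where t': "(\<lambda>j. ext u (bb (\<eta> j)) - t' j *\<^sub>R bb (u ** \<eta> j)) \<longlonglongrightarrow> 0"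
    "\<forall>\<^sub>F j in sequentially. 1 / (2 * N (iv u)) \<le> \<bar>t' j\<bar>"
    using ext_bb_sequence[OF \<eta>(1,2) u] .
  have lim: "(\<lambda>j. ext u (bb (\<gamma> j))) \<longlonglongrightarrow> ext u X" "(\<lambda>j. ext u (bb (\<eta> j))) \<longlonglongrightarrow> ext u Y"
    using \<gamma>(3) \<eta>(3) bounded_linear.tendsto[OF linear_conv_bounded_linear[THEN iffD1, OF linear_ext]] by blast+
  have "pf (ext u (bb (\<gamma> j))) (ext u (bb (\<eta> j))) = det u * pf (bb (\<gamma> j)) (bb (\<eta> j))" for j
    unfolding bb_def ext_E12_eq by (rule pf_ext_wedge)
  then have "(\<lambda>j. pf (ext u (bb (\<gamma> j))) (ext u (bb (\<eta> j)))) \<longlonglongrightarrow> det u * pf X Y"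
    by (simp only:) (intro tendsto_mult_left tendsto_pf \<gamma> \<eta>)
  then have pfu: "pf (ext u X) (ext u Y) = 0"
    using LIMSEQ_unique[OF tendsto_pf[OF lim]] pf0 by simp
  have lim': "(\<lambda>j. t j *\<^sub>R bb (u ** \<gamma> j)) \<longlonglongrightarrow> ext u X" "(\<lambda>j. t' j *\<^sub>R bb (u ** \<eta> j)) \<longlonglongrightarrow> ext u Y"
    using tendsto_diff[OF lim(1) t(1)] tendsto_diff[OF lim(2) t'(1)] by simp_all
  have "(\<lambda>j. pf (t j *\<^sub>R bb (u ** \<gamma> j)) (t' j *\<^sub>R bb (u ** \<eta> j))) \<longlonglongrightarrow> 0"
    using tendsto_pf[OF lim'] unfolding pfu .
  moreover have "pf (a *\<^sub>R A) (b *\<^sub>R B) = a * b * pf A B" for a b A B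
    by (simp add: pf_def algebra_simps)
  ultimately have z: "(\<lambda>j. t j * t' j * pf (bb (u ** \<gamma> j)) (bb (u ** \<eta> j))) \<longlonglongrightarrow> 0" by simp
  define \<delta> where "\<delta> = 1 / (2 * N (iv u))"
  have \<delta>: "\<delta> > 0" using N_ge_1[OF iv_mem[OF u]] by (simp add: \<delta>_def)
  have "\<forall>\<^sub>F j in sequentially. norm (pf (bb (u ** \<gamma> j)) (bb (u ** \<eta> j)))
      \<le> norm (t j * t' j * pf (bb (u ** \<gamma> j)) (bb (u ** \<eta> j))) / (\<delta> * \<delta>)"
    using t(2) t'(2)
  proof eventually_elim
    case (elim j)
    have "\<delta> * \<delta> \<le> \<bar>t j\<bar> * \<bar>t' j\<bar>" using elim \<delta> by (intro mult_mono) (simp_all add: \<delta>_def)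
    then have "(\<delta> * \<delta>) * \<bar>pf (bb (u ** \<gamma> j)) (bb (u ** \<eta> j))\<bar> \<le> (\<bar>t j\<bar> * \<bar>t' j\<bar>) * \<bar>pf (bb (u ** \<gamma> j)) (bb (u ** \<eta> j))\<bar>"
      by (rule mult_right_mono) simp
    then show ?case using \<delta> by (simp add: abs_mult field_simps)
  qed
  moreover have "(\<lambda>j. norm (t j * t' j * pf (bb (u ** \<gamma> j)) (bb (u ** \<eta> j))) / (\<delta> * \<delta>)) \<longlonglongrightarrow> 0"
    using tendsto_divide[OF tendsto_norm[OF z] tendsto_const[of "\<delta> * \<delta>"]] \<delta> by simp
  ultimately show ?thesis by (rule Lim_null_comparison)
qed

section \<open>Geodesics between limit planes and the dyadic contradiction\<close>

definition C4 where "C4 = 2 * (C2 / (1 - exp (- (c * (1/4)))))"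

text \<open>Cut the geodesic at its point nearest to the identity. Both halves then move away
  linearly, with rate 1/4, and \<open>bb_path\<close> bounds the drift on each; \<open>C4\<close>
  adds the two constants. So a geodesic joining elements with clearly different planes must pass
  near the identity.\<close>

lemma far_geodesic:
  assumes q: "\<And>i. q i \<in> \<Gamma>" and geo: "\<And>i j. i \<le> j \<Longrightarrow> j \<le> L \<Longrightarrow> len (iv (q i) ** q j) = j - i"
    and far: "\<And>i. i \<le> L \<Longrightarrow> R \<le> len (q i)"
  shows "sign_dist (bb (q 0)) (bb (q L)) \<le> C4 * exp (- (c * (real R / 2)))"
proof -
  have "\<exists>i\<in>{0..L}. \<forall>j\<in>{0..L}. len (q i) \<le> len (q j)"
    using ex_min_if_finite[of "(\<lambda>i. len (q i)) ` {0..L}"] by (auto simp: not_less)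
  then obtain m where m: "m \<le> L" "\<And>j. j \<le> L \<Longrightarrow> len (q m) \<le> len (q j)" by auto
  have geo': "len (iv (q j) ** q i) = j - i" if "i \<le> j" "j \<le> L" for i j
  proof -
    have "iv (q j) ** q i = iv (iv (q i) ** q j)" using q by (simp add: iv_mult iv_iv)
    then show ?thesis using geo[OF that] q by (simp add: len_iv)
  qed
  \<comment> \<open>The distance from i to m is at most twice \<open>len (q i)\<close>, because m is
    nearest. Averaging this bound with \<open>R \<le> len (q i)\<close> gives R/2 + \<bar>i -
    m\<bar>/4.\<close>
  have away: "real R / 2 + 1/4 * \<bar>real i - real m\<bar> \<le> real (len (q i))" if "i \<le> L" for i
  proof -
    have "len (iv (q i) ** q m) \<le> len (iv (q i)) + len (q m)" by (intro len_mult iv_mem q)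
    then have "len (iv (q i) ** q m) \<le> 2 * len (q i)" using m(2)[OF that] q by (simp add: len_iv)
    then have "real (len (iv (q i) ** q m)) \<le> 2 * real (len (q i))"
      by (metis of_nat_le_iff of_nat_mult of_nat_numeral)
    moreover have "real (len (iv (q i) ** q m)) = \<bar>real i - real m\<bar>"
      using geo[of i m] geo'[of m i] m(1) that by (cases "i \<le> m") (auto simp: of_nat_diff)
    moreover have "real R \<le> real (len (q i))" using far[OF that] by simp
    moreover have "r / 2 + 1/4 * D \<le> l" if "x \<le> 2 * l" "x = D" "r \<le> l" for x l D r :: real
      using that by linarith
    ultimately show ?thesis by blast
  qed
  have "sign_dist (bb (q (m + 0))) (bb (q (m + (L - m)))) \<le> C2 * exp (- (c * (real R / 2))) / (1 - exp (- (c * (1/4))))"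
  proof (rule bb_path)
    fix i assume i: "i < L - m"
    have "m + i \<le> L" "\<bar>real (m + i) - real m\<bar> = real i" using i by simp_all
    then show "real R / 2 + 1/4 * real i \<le> real (len (q (m + i)))" using away[of "m + i"] by (simp only:)
    show "len (iv (q (m + i)) ** q (m + Suc i)) \<le> 1" using geo[of "m + i" "m + Suc i"] i by simp
  qed (use q in auto)
  moreover have "sign_dist (bb (q (m - 0))) (bb (q (m - m))) \<le> C2 * exp (- (c * (real R / 2))) / (1 - exp (- (c * (1/4))))"
  proof (rule bb_path)
    fix i assume i: "i < m"
    have "m - i \<le> L" "\<bar>real (m - i) - real m\<bar> = real i" using i m(1) by (simp_all add: of_nat_diff)
    then show "real R / 2 + 1/4 * real i \<le> real (len (q (m - i)))" using away[of "m - i"] by (simp only:)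
    show "len (iv (q (m - i)) ** q (m - Suc i)) \<le> 1" using geo'[of "m - Suc i" "m - i"] i m(1) by simp
  qed (use q in auto)
  ultimately show ?thesis
    using sign_dist_triangle[of "bb (q 0)" "bb (q L)" "bb (q m)"] m(1) by (simp add: C4_def sign_dist_commute)
qed

text \<open>Fixed by the base case below: at scale 1 the bound is then exactly
  \<open>K\<close>.\<close>

definition \<kappa> where "\<kappa> = ln K + ln C5"

text \<open>If the two ends of a geodesic are nearly incident, then so are their translates along the
  geodesic. The gain in the submultiplicativity of the norm, applied at all dyadic scales, then
  forces the norm to decay.\<close>

lemma dyadic_decay:
  assumes q: "\<And>i. q i \<in> \<Gamma>" and geo: "\<And>i j. i \<le> j \<Longrightarrow> j \<le> L \<Longrightarrow> len (iv (q i) ** q j) = j - i"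
    and L: "i0 + 2 ^ k0 \<le> L"
    and pf: "\<And>i. i0 \<le> i \<Longrightarrow> i \<le> i0 + 2 ^ k0 \<Longrightarrow>
       \<bar>pf (bb (iv (q i) ** q 0)) (bb (iv (q i) ** q L))\<bar> \<le> exp (- (c * 2 ^ k0))"
    and k: "k \<le> k0" and i: "i0 \<le> i" "i + 2 ^ k \<le> i0 + 2 ^ k0"
  shows "N (iv (q i) ** q (i + 2 ^ k)) \<le> exp (2 ^ k * (\<kappa> - real k * c / 2) - ln C5)"
  using k i
proof (induction k arbitrary: i)
  case 0
  have "N (iv (q i) ** q (i + 1)) \<le> K"
    using geo[of i "i + 1"] q L 0 by (intro N_le_K) auto
  also have "K = exp (\<kappa> - ln C5)" using K_ge_1 by (simp add: \<kappa>_def)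
  finally show ?case by simp
next
  case (Suc k)
  define m :: nat where "m = 2 ^ k"
  define j where "j = i + m"
  have jm: "i + 2 ^ Suc k = j + m" by (simp add: j_def m_def)
  have m: "m \<le> 2 ^ k0" using Suc by (simp add: m_def)
  have le: "i \<le> j" "j + m \<le> L" "j \<le> i0 + 2 ^ k0" "i0 \<le> j" using Suc L jm by (auto simp: j_def)
  define A where "A = iv (q i) ** q j"
  define B where "B = iv (q j) ** q (j + m)"
  have A: "A \<in> \<Gamma>" "len A = m" and B: "B \<in> \<Gamma>" "len B = m"
    using q geo le by (auto simp: A_def B_def j_def)
  have AB: "A ** B = iv (q i) ** q (i + 2 ^ Suc k)"
    unfolding jm using q by (simp add: A_def B_def matrix_mul_assoc)
  have rel: "iv (iv a ** b) ** (iv a ** d) = iv b ** d" if "a \<in> \<Gamma>" "b \<in> \<Gamma>" "d \<in> \<Gamma>" for a b d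
    using that by (simp add: iv_mult iv_iv flip: matrix_mul_assoc)
  have geo': "len (iv (q b) ** q a) = b - a" if "a \<le> b" "b \<le> L" for a b
  proof -
    have "iv (q b) ** q a = iv (iv (q a) ** q b)" using q by (simp add: iv_mult iv_iv)
    then show ?thesis using geo[OF that] q by (simp add: len_iv)
  qed
  \<comment> \<open>Translating the midpoint \<open>q j\<close> to the identity turns the two halves
    of the geodesic into rays from the identity; this is the backward one.\<close>
  have "sign_dist (bb (iv (q j) ** q (j - m))) (bb (iv (q j) ** q (j - j))) \<le> C3 * exp (- (c * real m))"
  proof (rule bb_ray[where p = "\<lambda>d. iv (q j) ** q (j - d)" and L = j])
    fix a b :: nat assume "a \<le> b" "b \<le> j"
    then show "len (iv (iv (q j) ** q (j - a)) ** (iv (q j) ** q (j - b))) = b - a"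
      using rel geo'[of "j - b" "j - a"] q le by simp
  qed (use q j_def in auto)
  moreover have "iv A = iv (q j) ** q (j - m)" using q by (simp add: A_def iv_mult iv_iv j_def)
  ultimately have pdA: "sign_dist (bb (iv A)) (bb (iv (q j) ** q 0)) \<le> C3 * exp (- (c * real m))" by simp
  have "sign_dist (bb (iv (q j) ** q (j + m))) (bb (iv (q j) ** q (j + (L - j)))) \<le> C3 * exp (- (c * real m))"
  proof (rule bb_ray[where p = "\<lambda>d. iv (q j) ** q (j + d)" and L = "L - j"])
    fix a b :: nat assume "a \<le> b" "b \<le> L - j"
    then show "len (iv (iv (q j) ** q (j + a)) ** (iv (q j) ** q (j + b))) = b - a"
      using rel geo[of "j + a" "j + b"] q le by simp
  qed (use q le in auto)
  then have pdB: "sign_dist (bb B) (bb (iv (q j) ** q L)) \<le> C3 * exp (- (c * real m))"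
    using le by (simp add: B_def)
  have "\<bar>pf (bb (iv (q j) ** q 0)) (bb (iv (q j) ** q L))\<bar> \<le> exp (- (c * 2 ^ k0))"
    using le by (intro pf) auto
  also have "\<dots> \<le> exp (- (c * real m))"
  proof -
    have "real m \<le> real (2 ^ k0)" using m by (rule of_nat_mono)
    then show ?thesis using c_pos by simp
  qed
  finally have pfm: "\<bar>pf (bb (iv (q j) ** q 0)) (bb (iv (q j) ** q L))\<bar> \<le> exp (- (c * real m))" .
  \<comment> \<open>Squaring doubles the subtracted \<open>ln C5\<close>; one copy cancels the
    factor \<open>C5\<close> of the gain, the other restores the form of the bound. The factor
    \<open>exp (- (c * real m))\<close> produces the further c / 2.\<close>
  let ?x = "2 ^ k * (\<kappa> - real k * c / 2) - ln C5"
  have NA: "N A \<le> exp ?x" "N B \<le> exp ?x"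
    using Suc.IH[of i] Suc.IH[of j] Suc.prems by (auto simp: A_def B_def j_def m_def)
  have "N (A ** B) \<le> C5 * exp (- (c * real m)) * (N A * N B)"
    using A B q pdA pdB pfm by (intro N_submultiplicative_gain) auto
  also have "\<dots> \<le> C5 * exp (- (c * real m)) * (exp ?x * exp ?x)"
    using NA N_ge_1[OF A(1)] N_ge_1[OF B(1)] C5_pos by (intro mult_left_mono mult_mono) auto
  also have "\<dots> = exp (ln C5 - c * real m + ?x + ?x)"
  proof -
    have "C5 * exp (- y) * (exp x * exp x) = exp (ln C5 - y + x + x)" for x y
      by (simp only: exp_add exp_diff exp_minus divide_inverse) (use C5_pos in simp)
    then show ?thesis .
  qed
  also have "ln C5 - c * real m + ?x + ?x = 2 ^ Suc k * (\<kappa> - real (Suc k) * c / 2) - ln C5"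
  proof -
    have "l - c * p + (p * (r - n * c / 2) - l) + (p * (r - n * c / 2) - l) = 2 * p * (r - (n + 1) * c / 2) - l" for l p r n :: real
      by (simp add: field_simps)
    then show ?thesis by (simp add: m_def add.commute[of 1])
  qed
  finally show ?case unfolding AB .
qed

lemma limit_sequence:
  assumes "V \<in> limit_set2 \<Gamma>"
  obtains \<gamma> k k' where "inj \<gamma>" "\<And>j::nat. \<gamma> j \<in> \<Gamma>" "filterlim (\<lambda>j. len (\<gamma> j)) at_top sequentially"
    "(\<lambda>j. left_factor (\<gamma> j)) \<longlonglongrightarrow> k" "(\<lambda>j. right_factor (\<gamma> j)) \<longlonglongrightarrow> k'" "(\<lambda>j. bb (\<gamma> j)) \<longlonglongrightarrow> ext k E12"
    "orthogonal_matrix k" "orthogonal_matrix k'" "V = (*v) k ` e12_plane"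
proof -
  obtain \<gamma> :: "nat \<Rightarrow> mat4" and k k' where g: "inj \<gamma>" "range \<gamma> \<subseteq> \<Gamma>" "(\<lambda>j. left_factor (\<gamma> j)) \<longlonglongrightarrow> k"
    "(\<lambda>j. right_factor (\<gamma> j)) \<longlonglongrightarrow> k'" "orthogonal_matrix k" "orthogonal_matrix k'" "V = (*v) k ` e12_plane"
    using limit_set2_decomposition[OF assms inv] by blast
  show ?thesis
    using g len_at_top[OF g(1,2)] tendsto_ext[OF g(3)]
    by (intro that[of \<gamma> k k']) (auto simp: bb_def)
qed

theorem limit_set_transverse:
  assumes V: "V \<in> limit_set2 \<Gamma>" and W: "W \<in> limit_set2 \<Gamma>" and ne: "V \<noteq> W"
    and x: "x \<in> V" "x \<in> W"
  shows "x = 0"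
proof (rule ccontr)
  assume x0: "x \<noteq> 0"
  obtain \<gamma> k k' where g: "\<And>j::nat. \<gamma> j \<in> \<Gamma>" "filterlim (\<lambda>j. len (\<gamma> j)) at_top sequentially"
    "(\<lambda>j. bb (\<gamma> j)) \<longlonglongrightarrow> ext k E12" "orthogonal_matrix k" "V = (*v) k ` e12_plane"
    using limit_sequence[OF V] by metis
  obtain \<eta> l l' where h: "\<And>j::nat. \<eta> j \<in> \<Gamma>" "filterlim (\<lambda>j. len (\<eta> j)) at_top sequentially"
    "(\<lambda>j. bb (\<eta> j)) \<longlonglongrightarrow> ext l E12" "orthogonal_matrix l" "W = (*v) l ` e12_plane"
    using limit_sequence[OF W] by metis
  have pf0: "pf (ext k E12) (ext l E12) = 0"
  proof -
    obtain a b where ab: "x = a *\<^sub>R column 1 k + b *\<^sub>R column 2 k"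
      using x(1) unfolding g(5) image_e12_plane by (rule span_pairE)
    obtain a' b' where ab': "x = a' *\<^sub>R column 1 l + b' *\<^sub>R column 2 l"
      using x(2) unfolding h(5) image_e12_plane by (rule span_pairE)
    let ?M = "columns4 (column 1 k) (column 2 k) (column 1 l) (column 2 l)"
    \<comment> \<open>The coefficients of x in the two bases, the second pair negated: a kernel
      vector of the matrix made of both bases.\<close>
    define z :: "real^4" where "z = vector [a, b, - a', - b']"
    have "?M *v z = (a *\<^sub>R column 1 k + b *\<^sub>R column 2 k) - (a' *\<^sub>R column 1 l + b' *\<^sub>R column 2 l)"
      by (simp add: vec_eq_iff columns4_def z_def matrix_vector_mult_def sum_4 vector_4 algebra_simps)
    then have "?M *v z = 0" using ab ab' by simp
    moreover have "z \<noteq> 0" using ab x0 by (auto simp: z_def vec_eq_iff forall_4 vector_4)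
    ultimately have "\<not> invertible ?M"
      by (metis invertible_def matrix_left_invertible_ker)
    then have "det ?M = 0" by (simp add: invertible_det_nz)
    then show ?thesis by (simp add: ext_E12_eq pf_wedge)
  qed
  define \<delta> where "\<delta> = sign_dist (ext k E12) (ext l E12)"
  have "\<delta> \<noteq> 0"
  proof
    assume "\<delta> = 0"
    then have "ext k E12 = 1 *\<^sub>R ext l E12 \<or> ext k E12 = (-1) *\<^sub>R ext l E12" by (simp add: \<delta>_def sign_dist_eq_0_iff)
    then have "plane_proj (ext k E12) = plane_proj (ext l E12)"
      using plane_proj_scale[of 1 "ext l E12"] plane_proj_scale[of "-1" "ext l E12"] by auto
    then have "proj_of V = proj_of W" using g h by (simp add: image_e12_plane_Gr2)
    moreover have "V \<in> topspace Gr2" "W \<in> topspace Gr2" using g h by (simp_all add: image_e12_plane_Gr2)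
    ultimately show False using ne inj_on_proj_of by (auto dest: inj_onD)
  qed
  then have \<delta>: "\<delta> > 0" using sign_dist_nonneg[of "ext k E12" "ext l E12"] by (simp add: \<delta>_def)
  have "(\<lambda>R::nat. C4 * exp (- (c * (real R / 2)))) \<longlonglongrightarrow> 0" using c_pos by real_asymp
  then have "\<forall>\<^sub>F R in sequentially. C4 * exp (- (c * (real R / 2))) < \<delta>"
    using \<delta> by (rule order_tendstoD)
  \<comment> \<open>With this R, a geodesic avoiding the ball of radius R would bring the two planes
    closer than \<delta>.\<close>
  then obtain R :: nat where R: "C4 * exp (- (c * (real R / 2))) < \<delta>"
    by (auto simp: eventually_sequentially)
  \<comment> \<open>Enough doublings to make the exponent \<open>\<kappa> - real k0 * c / 2\<close>
    nonpositive.\<close>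
  obtain k0 :: nat where k0: "2 * \<kappa> / c \<le> real k0" using real_arch_simple by blast
  have "(\<lambda>j. sign_dist (bb (\<gamma> j)) (bb (\<eta> j))) \<longlonglongrightarrow> \<delta>" unfolding \<delta>_def by (intro tendsto_sign_dist g h)
  then have 1: "\<forall>\<^sub>F j in sequentially. C4 * exp (- (c * (real R / 2))) < sign_dist (bb (\<gamma> j)) (bb (\<eta> j))"
    using R by (rule order_tendstoD)
  \<comment> \<open>From a point of length less than R, at least \<open>2 ^ k0\<close> further steps
    are needed to reach such an element; this leaves room for the segment.\<close>
  have 2: "\<forall>\<^sub>F j in sequentially. R + 2 ^ k0 \<le> len (\<eta> j)" using h(2) by (simp add: filterlim_at_top)
  \<comment> \<open>The inverses of all points of the segment lie in this finite ball, so one index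
    j serves all translates.\<close>
  have 3: "\<forall>\<^sub>F j in sequentially. \<forall>u\<in>{u \<in> \<Gamma>. len u \<le> R + 2 ^ k0}.
      \<bar>pf (bb (u ** \<gamma> j)) (bb (u ** \<eta> j))\<bar> < exp (- (c * 2 ^ k0))"
  proof (intro eventually_ball_finite finite_ball ballI)
    fix u assume "u \<in> {u \<in> \<Gamma>. len u \<le> R + 2 ^ k0}"
    then have "(\<lambda>j. \<bar>pf (bb (u ** \<gamma> j)) (bb (u ** \<eta> j))\<bar>) \<longlonglongrightarrow> 0"
      using pf_equivariant_limit[OF g(1,2,3) h(1,2,3) pf0] by (intro tendsto_rabs_zero) simp
    then show "\<forall>\<^sub>F j in sequentially. \<bar>pf (bb (u ** \<gamma> j)) (bb (u ** \<eta> j))\<bar> < exp (- (c * 2 ^ k0))"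
      by (rule order_tendstoD) simp
  qed
  obtain j where j: "C4 * exp (- (c * (real R / 2))) < sign_dist (bb (\<gamma> j)) (bb (\<eta> j))" "R + 2 ^ k0 \<le> len (\<eta> j)"
    "\<And>u. u \<in> \<Gamma> \<Longrightarrow> len u \<le> R + 2 ^ k0 \<Longrightarrow> \<bar>pf (bb (u ** \<gamma> j)) (bb (u ** \<eta> j))\<bar> < exp (- (c * 2 ^ k0))"
    using eventually_conj[OF 1 eventually_conj[OF 2 3]] by (auto dest: eventually_happens)
  obtain q L where q: "q 0 = \<gamma> j" "q L = \<eta> j" "\<And>i. q i \<in> \<Gamma>"
    and geo: "\<And>a b. a \<le> b \<Longrightarrow> b \<le> L \<Longrightarrow> len (iv (q a) ** q b) = b - a"
    using geodesic[OF g(1) h(1), of j j] by blast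
  have "\<exists>i\<le>L. len (q i) < R"
  proof (rule ccontr)
    assume "\<not> (\<exists>i\<le>L. len (q i) < R)"
    then have "sign_dist (bb (q 0)) (bb (q L)) \<le> C4 * exp (- (c * (real R / 2)))"
      using q geo by (intro far_geodesic) (auto simp: not_less)
    then show False using j(1) q by simp
  qed
  then obtain i0 where i0: "i0 \<le> L" "len (q i0) < R" by blast
  have step: "len (q b) \<le> len (q a) + (b - a)" if "a \<le> b" "b \<le> L" for a b
  proof -
    have "len (q a ** (iv (q a) ** q b)) \<le> len (q a) + len (iv (q a) ** q b)" by (intro len_mult mult_mem iv_mem q)
    then show ?thesis using geo[OF that] q by simp
  qed
  have L: "i0 + 2 ^ k0 \<le> L" using step[OF i0(1)] i0 j(2) q(2) by simp
  have "N (iv (q i0) ** q (i0 + 2 ^ k0)) \<le> exp (2 ^ k0 * (\<kappa> - real k0 * c / 2) - ln C5)"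
  proof (rule dyadic_decay[OF q(3) geo L])
    fix i assume i: "i0 \<le> i" "i \<le> i0 + 2 ^ k0"
    have "len (q i) \<le> R + 2 ^ k0" using step[of i0 i] i i0 L by simp
    then show "\<bar>pf (bb (iv (q i) ** q 0)) (bb (iv (q i) ** q L))\<bar> \<le> exp (- (c * 2 ^ k0))"
      unfolding q using j(3)[of "iv (q i)"] q(3) by (simp add: len_iv less_imp_le)
  qed auto
  also have "\<dots> < exp 0"
  proof -
    have "\<kappa> - real k0 * c / 2 \<le> 0" using k0 c_pos by (simp add: field_simps)
    then have "2 ^ k0 * (\<kappa> - real k0 * c / 2) \<le> 0" by (simp add: mult_nonneg_nonpos)
    moreover have "ln C5 > 0" using C5_pos by simp
    ultimately show ?thesis by simp
  qed
  finally show False using N_ge_1[of "iv (q i0) ** q (i0 + 2 ^ k0)"] q(3) by simp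
qed

end

section \<open>A transverse sphere of planes covers the space\<close>

lemma continuous_on_matrix_vector_mult:
  fixes A :: "'a::topological_space \<Rightarrow> real^'n^'m"
  assumes "continuous_on S A" "continuous_on S f"
  shows "continuous_on S (\<lambda>x. A x *v f x)"
  unfolding matrix_vector_mult_def
  by (rule continuous_on_vec_lambda)
    (intro continuous_on_sum continuous_on_mult continuous_on_component assms)

lemma proj_of_mem:
  assumes "V \<in> topspace Gr2"
  shows "proj_of V *v x \<in> V"
proof -
  obtain v w where vw: "norm v = 1" "norm w = 1" "v \<bullet> w = 0" and V: "V = span {v, w}"
    using Gr2_orthonormal[OF assms] .
  have "proj_of V *v x = (v \<bullet> x) *\<^sub>R v + (w \<bullet> x) *\<^sub>R w"
    unfolding V by (simp add: proj_of_span orthonormal_independent[OF vw] plane_proj_orthonormal[OF vw])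
  also have "\<dots> \<in> V" unfolding V by (intro span_add span_scale span_base) auto
  finally show ?thesis .
qed

lemma independent_pair_cancel:
  fixes v w :: "'a::real_vector"
  assumes "v \<noteq> w" "independent {v, w}" "a *\<^sub>R v + b *\<^sub>R w = a' *\<^sub>R v + b' *\<^sub>R w"
  shows "a = a' \<and> b = b'"
proof -
  have eq: "(a - a') *\<^sub>R v + (b - b') *\<^sub>R w = 0" using assms(3) by (simp add: algebra_simps)
  have v: "v \<notin> span {w}" and w: "w \<noteq> 0"
    using assms(1,2) by (auto simp: independent_insert dest: dependent_zero)
  have "a - a' = 0"
  proof (rule ccontr)
    assume n: "a - a' \<noteq> 0"
    have "(a - a') *\<^sub>R v = - ((b - b') *\<^sub>R w)"
      by (rule eq_neg_iff_add_eq_0[THEN iffD2, OF eq])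
    moreover have "v = inverse (a - a') *\<^sub>R ((a - a') *\<^sub>R v)" using n by simp
    ultimately have "v = inverse (a - a') *\<^sub>R - ((b - b') *\<^sub>R w)" by simp
    also have "\<dots> \<in> span {w}" by (intro span_scale span_neg span_base) simp
    finally show False using v by simp
  qed
  then show ?thesis using eq w by simp
qed

text \<open>The nonzero vectors on the planes form a nonempty set that is open and closed in the
  connected punctured space. Openness is a matter of dimension: two parameters on the sphere and two
  in the plane, injectively by transversality.\<close>

lemma sphere_of_planes_covers:
  assumes sub: "\<Lambda> \<subseteq> topspace Gr2"
    and hom: "subtopology Gr2 \<Lambda> homeomorphic_space top_of_set (sphere (0 :: real^3) 1)"
    and trans: "\<And>V W x. V \<in> \<Lambda> \<Longrightarrow> W \<in> \<Lambda> \<Longrightarrow> V \<noteq> W \<Longrightarrow> x \<in> V \<Longrightarrow> x \<in> W \<Longrightarrow> x = 0"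
    and x: "x \<noteq> 0"
  shows "\<exists>V\<in>\<Lambda>. x \<in> V"
proof -
  define S where "S = sphere (0 :: real^3) 1"
  obtain f h where fh: "homeomorphic_maps (subtopology Gr2 \<Lambda>) (top_of_set S) f h"
    using hom unfolding homeomorphic_space_def S_def by blast
  then have hc: "continuous_map (top_of_set S) (subtopology Gr2 \<Lambda>) h" and fh': "\<And>u. u \<in> S \<Longrightarrow> f (h u) = u"
    unfolding homeomorphic_maps_def by auto
  have hL: "h u \<in> \<Lambda>" if "u \<in> S" for u
    using continuous_map_image_subset_topspace[OF hc] that sub by auto
  have hG: "h u \<in> topspace Gr2" if "u \<in> S" for u using hL[OF that] sub by auto
  define p where "p u = proj_of (h u)" for u
  have "continuous_map (top_of_set S) Gr2 h"
    using hc by (simp add: continuous_map_in_subtopology)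
  then have "continuous_map (top_of_set S) euclidean (proj_of \<circ> h)"
    using continuous_map_proj_of by (rule continuous_map_compose)
  then have pc: "continuous_on S p" by (simp add: p_def o_def)
  have fixp: "p u *v y = y \<longleftrightarrow> y \<in> h u" if "u \<in> S" for u y
    unfolding p_def by (rule proj_of_fixed_iff[OF hG[OF that]])
  have pmem: "p u *v y \<in> h u" if "u \<in> S" for u y
    unfolding p_def by (rule proj_of_mem[OF hG[OF that]])
  define M where "M = {y. y \<noteq> 0 \<and> (\<exists>u\<in>S. y \<in> h u)}"
  have closed: "closed {y. \<exists>u\<in>S. y \<in> h u}"
  proof -
    \<comment> \<open>Lying in a plane means being fixed by its projection, a closed condition on
      the pair; compactness of S keeps the set of vectors closed.\<close>
    have "closed {z \<in> S \<times> UNIV. p (fst z) *v snd z - snd z = 0}"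
    proof (rule continuous_closed_preimage_constant)
      show "continuous_on (S \<times> UNIV) (\<lambda>z. p (fst z) *v snd z - snd z)"
        by (intro continuous_on_diff continuous_on_matrix_vector_mult continuous_on_snd continuous_on_id
            continuous_on_compose2[OF pc continuous_on_fst[OF continuous_on_id]]) auto
      show "closed (S \<times> (UNIV :: (real^4) set))" by (intro closed_Times) (auto simp: S_def)
    qed
    moreover have "compact S" by (simp add: S_def)
    ultimately have "closed {y. \<exists>u. u \<in> S \<and> (u, y) \<in> {z \<in> S \<times> UNIV. p (fst z) *v snd z - snd z = 0}}"
      by (intro closed_compact_projection)
    moreover have "{y. \<exists>u. u \<in> S \<and> (u, y) \<in> {z \<in> S \<times> UNIV. p (fst z) *v snd z - snd z = 0}} = {y. \<exists>u\<in>S. y \<in> h u}"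
      using fixp by auto
    ultimately show ?thesis by simp
  qed
  have nbhd: "\<exists>U. open U \<and> y \<in> U \<and> U \<subseteq> M" if yM: "y \<in> M" for y
  proof -
    obtain u0 where u0: "u0 \<in> S" "y \<in> h u0" and y0: "y \<noteq> 0" using yM by (auto simp: M_def)
    have nu0: "- u0 \<in> S" "- u0 \<noteq> u0"
    proof -
      show "- u0 \<in> S" using u0 by (simp add: S_def)
      show "- u0 \<noteq> u0"
      proof
        assume "- u0 = u0"
        then have "2 *\<^sub>R u0 = 0" unfolding scaleR_2 by (metis add.right_inverse)
        then show False using u0 by (auto simp: S_def)
      qed
    qed
    \<comment> \<open>Removing the antipode leaves a planar chart around u0.\<close>
    have "S - {- u0} homeomorphic (UNIV :: (real^2) set)"
      unfolding S_def using nu0 by (intro homeomorphic_punctured_sphere_affine) (auto simp: S_def)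
    then obtain g g' where g: "homeomorphism (UNIV :: (real^2) set) (S - {- u0}) g g'"
      by (metis homeomorphic_sym homeomorphic_def)
    have gc: "continuous_on UNIV g" and gS: "\<And>z. g z \<in> S" and ginj: "\<And>z z'. g z = g z' \<Longrightarrow> z = z'"
      using g unfolding homeomorphism_def by (auto, metis)
    obtain z0 where z0: "g z0 = u0"
      using g u0 nu0 unfolding homeomorphism_def by (metis Diff_iff imageE singletonD)
    obtain v w where vw: "norm v = 1" "norm w = 1" "v \<bullet> w = 0" and V: "h u0 = span {v, w}"
      using Gr2_orthonormal[OF hG[OF u0(1)]] .
    note ind = orthonormal_independent[OF vw]
    \<comment> \<open>A local frame: a basis of the plane at u0, projected to the other planes. It
      stays independent near u0, and \<open>Q\<close> records where it does.\<close>
    define a where "a z = p (g z) *v v" for z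
    define b where "b z = p (g z) *v w" for z
    have pg: "continuous_on UNIV (\<lambda>z. p (g z))"
      by (rule continuous_on_compose2[OF pc gc]) (use gS in auto)
    have ac: "continuous_on UNIV a" "continuous_on UNIV b"
      unfolding a_def b_def by (intro continuous_on_matrix_vector_mult pg continuous_on_const)+
    have ah: "a z \<in> h (g z)" "b z \<in> h (g z)" for z using pmem gS by (auto simp: a_def b_def)
    define F :: "(real^2) \<times> (real^2) \<Rightarrow> real^4"
      where "F zc = (snd zc $ 1) *\<^sub>R a (fst zc) + (snd zc $ 2) *\<^sub>R b (fst zc)" for zc
    define Q where "Q = {zc :: (real^2) \<times> (real^2). snd zc \<noteq> 0} \<inter> {zc. wedge (a (fst zc)) (b (fst zc)) \<noteq> 0}"
    have afst: "continuous_on UNIV (\<lambda>zc :: (real^2) \<times> (real^2). a (fst zc))" "continuous_on UNIV (\<lambda>zc :: (real^2) \<times> (real^2). b (fst zc))"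
      by (auto intro!: continuous_on_compose2[OF ac(1)] continuous_on_compose2[OF ac(2)] continuous_intros)
    have "open Q" unfolding Q_def
      by (intro open_Int open_Collect_neq continuous_on_wedge afst continuous_intros)
    moreover have "continuous_on UNIV F"
      unfolding F_def
      by (intro continuous_on_add continuous_on_scaleR afst continuous_on_component continuous_on_snd continuous_on_id)
    then have "continuous_on Q F" by (rule continuous_on_subset) simp
    moreover have Fh: "F zc \<in> h (g (fst zc))" for zc
      using ah[of "fst zc"] hG[OF gS, of "fst zc"] unfolding F_def
      by (auto simp: topspace_Gr2 intro!: subspace_add subspace_scale)
    have indz: "a z \<noteq> b z" "independent {a z, b z}" if "wedge (a z) (b z) \<noteq> 0" for z
      using that by (simp_all add: wedge_eq_0_iff)
    have F0: "F zc \<noteq> 0" if "zc \<in> Q" for zc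
    proof
      assume "F zc = 0"
      then have "(snd zc $ 1) *\<^sub>R a (fst zc) + (snd zc $ 2) *\<^sub>R b (fst zc) = 0 *\<^sub>R a (fst zc) + 0 *\<^sub>R b (fst zc)"
        by (simp add: F_def)
      moreover have "wedge (a (fst zc)) (b (fst zc)) \<noteq> 0" using that by (simp add: Q_def)
      ultimately have "snd zc $ 1 = 0 \<and> snd zc $ 2 = 0"
        by (intro independent_pair_cancel[OF indz])
      then show False using that by (auto simp: Q_def vec_eq_iff forall_2)
    qed
    \<comment> \<open>Equal nonzero values lie on both planes, so transversality makes the planes
      equal, and then independence of the frame makes the coefficients equal.\<close>
    moreover have "inj_on F Q"
    proof (rule inj_onI)
      fix zc zc' assume Q: "zc \<in> Q" "zc' \<in> Q" and eq: "F zc = F zc'"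
      have "h (g (fst zc)) = h (g (fst zc'))"
      proof (rule ccontr)
        assume "h (g (fst zc)) \<noteq> h (g (fst zc'))"
        then have "F zc = 0" using trans[OF hL[OF gS] hL[OF gS]] Fh[of zc] Fh[of zc'] eq by metis
        then show False using F0[OF Q(1)] by simp
      qed
      then have z: "fst zc = fst zc'" using fh'[OF gS] ginj by metis
      have "snd zc $ 1 = snd zc' $ 1 \<and> snd zc $ 2 = snd zc' $ 2"
      proof (rule independent_pair_cancel[OF indz])
        show "wedge (a (fst zc)) (b (fst zc)) \<noteq> 0" "wedge (a (fst zc)) (b (fst zc)) \<noteq> 0" using Q by (auto simp: Q_def)
        show "(snd zc $ 1) *\<^sub>R a (fst zc) + (snd zc $ 2) *\<^sub>R b (fst zc) = (snd zc' $ 1) *\<^sub>R a (fst zc) + (snd zc' $ 2) *\<^sub>R b (fst zc)"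
          using eq z by (simp add: F_def)
      qed
      then show "zc = zc'" using z by (simp add: prod_eq_iff vec_eq_iff forall_2)
    qed
    ultimately have "open (F ` Q)" by (intro invariance_of_domain_gen) auto
    moreover have "F zc \<in> M" if "zc \<in> Q" for zc
      unfolding M_def using F0[OF that] Fh[of zc] gS[of "fst zc"] by blast
    then have "F ` Q \<subseteq> M" by blast
    moreover have "y \<in> F ` Q"
    proof -
      obtain \<alpha> \<beta> where y: "y = \<alpha> *\<^sub>R v + \<beta> *\<^sub>R w" using u0(2) unfolding V by (rule span_pairE)
      have "v \<in> h u0" "w \<in> h u0" unfolding V by (auto simp: span_base)
      then have ab: "a z0 = v" "b z0 = w" using fixp[OF u0(1)] by (auto simp: a_def b_def z0)
      have "wedge v w \<noteq> 0" using ind by (simp add: wedge_eq_0_iff)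
      moreover have "vector [\<alpha>, \<beta>] \<noteq> (0 :: real^2)" using y y0 by (auto simp: vec_eq_iff forall_2 vector_2)
      ultimately have "(z0, vector [\<alpha>, \<beta>]) \<in> Q" by (simp add: Q_def ab)
      moreover have "F (z0, vector [\<alpha>, \<beta>]) = y" by (simp add: F_def ab y vector_2)
      ultimately show ?thesis by force
    qed
    ultimately show ?thesis by blast
  qed
  then have "open M" by (subst open_subopen) blast
  then have "openin (top_of_set (- {0})) M" by (auto simp: openin_open M_def)
  moreover have "closedin (top_of_set (- {0})) M"
    using closed unfolding closedin_closed by (intro exI[of _ "{y. \<exists>u\<in>S. y \<in> h u}"]) (auto simp: M_def)
  moreover have "connected (- {0 :: real^4})" by (intro connected_punctured_universe) simp
  moreover have "M \<noteq> {}"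
  proof -
    have "axis 1 1 \<in> S" by (simp add: S_def)
    then obtain v where "norm v = 1" "v \<in> h (axis 1 1)"
      using Gr2_orthonormal[OF hG] by (metis insertI1 span_base)
    then have "v \<in> M" using \<open>axis 1 1 \<in> S\<close> by (auto simp: M_def)
    then show ?thesis by blast
  qed
  ultimately have "M = - {0}" unfolding connected_clopen by blast
  then have "x \<in> M" using x by simp
  then show ?thesis using hL by (auto simp: M_def)
qed

section \<open>Zariski-dense subgroups of SL(2,C)\<close>

lemma vec2_eqI: "z $ 1 = w $ 1 \<Longrightarrow> z $ 2 = w $ 2 \<Longrightarrow> z = w" for z w :: "'a^2"
  by (simp add: vec_eq_iff forall_2)

lemma matrix_vector_2:
  fixes A :: "'a::semiring_1^2^2"
  shows "(A *v z) $ 1 = A$1$1 * z$1 + A$1$2 * z$2" "(A *v z) $ 2 = A$2$1 * z$1 + A$2$2 * z$2"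
  by (simp_all add: matrix_vector_mult_def sum_2)

definition cmat :: "complex \<Rightarrow> complex \<Rightarrow> complex \<Rightarrow> complex \<Rightarrow> complex^2^2" where
  "cmat a b c d = vector [vector [a, b], vector [c, d]]"

lemma cmat_nth [simp]: "cmat a b c d $ 1 $ 1 = a" "cmat a b c d $ 1 $ 2 = b" "cmat a b c d $ 2 $ 1 = c" "cmat a b c d $ 2 $ 2 = d"
  by (simp_all add: cmat_def vector_2)

lemma cmat_SL2C: "cmat a b c d \<in> SL2C \<longleftrightarrow> a * d - b * c = 1"
  by (simp add: SL2C_def det_2)

text \<open>Along a convergent subsequence with exponents s, the quotients of the terms of index j +
  j and j tend to 1; strict growth of s makes the difference of exponents at least j.\<close>

lemma unit_power_recurrence:
  fixes w :: complex
  assumes "norm w = 1"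
  obtains n where "\<And>j::nat. j \<le> n j" "(\<lambda>j. w ^ n j) \<longlonglongrightarrow> 1"
proof -
  have "seq_compact (sphere (0::complex) 1)" by (intro compact_imp_seq_compact) simp
  moreover have "\<forall>n. w ^ n \<in> sphere 0 1" using assms by (simp add: norm_power)
  ultimately obtain l s where l: "l \<in> sphere 0 1" and s: "strict_mono (s :: nat \<Rightarrow> nat)" "((\<lambda>n. w ^ n) \<circ> s) \<longlonglongrightarrow> l"
    by (rule seq_compactE)
  have sl: "(\<lambda>j. w ^ s j) \<longlonglongrightarrow> l" using s by (simp add: o_def)
  have "strict_mono (\<lambda>j::nat. j + j)" by (simp add: strict_mono_def)
  then have s2l: "(\<lambda>j. w ^ s (j + j)) \<longlonglongrightarrow> l"
    using LIMSEQ_subseq_LIMSEQ[OF sl] by (simp add: o_def)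
  have le: "s j + d \<le> s (j + d)" for j d
  proof (induction d)
    case (Suc d)
    have "s (j + d) < s (j + Suc d)" using s(1) by (simp add: strict_mono_less)
    then show ?case using Suc by simp
  qed simp
  have w0: "w \<noteq> 0" using assms by auto
  have "(\<lambda>j. w ^ s (j + j) / w ^ s j) \<longlonglongrightarrow> l / l"
    using l by (intro tendsto_divide s2l sl) auto
  moreover have "w ^ s (j + j) / w ^ s j = w ^ (s (j + j) - s j)" for j
    using le[of j j] w0 by (simp add: power_diff)
  ultimately have "(\<lambda>j. w ^ (s (j + j) - s j)) \<longlonglongrightarrow> l / l" by simp
  moreover have "l / l = 1" using l by auto
  ultimately have "(\<lambda>j. w ^ (s (j + j) - s j)) \<longlonglongrightarrow> 1" by simp
  moreover have "j \<le> s (j + j) - s j" for j using le[of j j] by simp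
  ultimately show ?thesis by (intro that) auto
qed

text \<open>Recurrence supplies inverses, so the part on the circle is a closed group. Being
  infinite and compact it has distinct points arbitrarily close together; their quotients are
  arbitrarily small rotations, whose powers are dense.\<close>

lemma closed_semigroup_circle:
  fixes S :: "complex set"
  assumes cl: "closed S" and mult: "\<And>z w. z \<in> S \<Longrightarrow> w \<in> S \<Longrightarrow> z * w \<in> S" and one: "1 \<in> S"
    and inf: "infinite (S \<inter> sphere 0 1)"
  shows "sphere 0 1 \<subseteq> S"
proof -
  define T where "T = S \<inter> sphere (0::complex) 1"
  have T1: "norm z = 1" "z \<noteq> 0" if "z \<in> T" for z using that by (auto simp: T_def)
  have Tmult: "z * w \<in> T" if "z \<in> T" "w \<in> T" for z w
    using that mult by (auto simp: T_def norm_mult)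
  have Tone: "1 \<in> T" using one by (simp add: T_def)
  have Tpow: "z ^ n \<in> T" if "z \<in> T" for z n
    by (induction n) (auto intro: Tone Tmult that)
  have Tcl: "closed T" unfolding T_def using cl by (intro closed_Int) auto
  have Tinv: "inverse z \<in> T" if z: "z \<in> T" for z
  proof -
    obtain n where n: "\<And>j::nat. j \<le> n j" "(\<lambda>j. z ^ n j) \<longlonglongrightarrow> 1"
      using unit_power_recurrence[OF T1(1)[OF z]] by blast
    \<comment> \<open>The shift to \<open>Suc j\<close> makes the exponent at least 1, so that it
      can be lowered by one.\<close>
    have "(\<lambda>j. z ^ n (Suc j) * inverse z) \<longlonglongrightarrow> 1 * inverse z"
      by (rule tendsto_mult_right[OF LIMSEQ_Suc[OF n(2)]])
    moreover have "z ^ n (Suc j) * inverse z = z ^ (n (Suc j) - 1)" for j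
      using n(1)[of "Suc j"] T1(2)[OF z] by (simp add: power_diff divide_inverse)
    ultimately have "(\<lambda>j. z ^ (n (Suc j) - 1)) \<longlonglongrightarrow> inverse z" by simp
    then show ?thesis using Tcl Tpow[OF z] by (metis closed_sequentially)
  qed
  define \<Theta> where "\<Theta> = {t. cis t \<in> T}"
  have Tadd: "s + t \<in> \<Theta>" if "s \<in> \<Theta>" "t \<in> \<Theta>" for s t
    using that Tmult by (simp add: \<Theta>_def flip: cis_mult)
  have Tneg: "- t \<in> \<Theta>" if "t \<in> \<Theta>" for t
    using that Tinv[of "cis t"] by (simp add: \<Theta>_def)
  have Tnat: "of_nat n * t \<in> \<Theta>" if "t \<in> \<Theta>" for n t
    using that Tpow[of "cis t" n] Complex.DeMoivre[of t n] by (simp add: \<Theta>_def)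
  have Tint: "of_int n * t \<in> \<Theta>" if "t \<in> \<Theta>" for n t
    using Tnat[OF that, of "nat n"] Tneg[OF Tnat[OF that, of "nat (- n)"]] by (cases "n \<ge> 0") auto
  have small: "\<exists>t\<in>\<Theta>. 0 < t \<and> t < d" if d: "d > 0" for d
  proof -
    have "isCont Arg 1" by (rule continuous_at_Arg) simp
    then have "\<exists>e>0. \<forall>w. dist w 1 < e \<longrightarrow> dist (Arg w) (Arg 1) < d"
      using d unfolding continuous_at_eps_delta by blast
    then obtain e where e: "e > 0" "\<And>w. dist w 1 < e \<Longrightarrow> \<bar>Arg w\<bar> < d" by (auto simp: dist_real_def)
    have "compact T" using Tcl by (simp add: compact_eq_bounded_closed T_def bounded_Int)
    moreover have "infinite T" using inf by (simp add: T_def)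
    ultimately obtain x where x: "x \<in> T" "x islimpt T"
      using Heine_Borel_imp_Bolzano_Weierstrass[of T T] by blast
    then obtain a where a: "a \<in> T" "a \<noteq> x" "dist a x < e" using e(1) by (auto simp: islimpt_approachable)
    define w where "w = a * inverse x"
    have w: "w \<in> T" using a x Tmult Tinv by (simp add: w_def)
    have "w - 1 = (a - x) / x" using T1(2)[OF x(1)] by (simp add: w_def field_simps)
    then have "dist w 1 < e" using a(3) T1(1)[OF x(1)] by (simp add: dist_norm norm_divide)
    then have Ad: "\<bar>Arg w\<bar> < d" by (rule e)
    have cw: "cis (Arg w) = w" using cis_Arg[OF T1(2)[OF w]] T1(1)[OF w] by (simp add: sgn_div_norm)
    have "w \<noteq> 1" using a(2) T1(2)[OF x(1)] by (simp add: w_def field_simps)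
    then have "Arg w \<noteq> 0" using cw by (metis cis_zero)
    moreover have "Arg w \<in> \<Theta>" using w by (simp add: \<Theta>_def cw)
    then have "\<bar>Arg w\<bar> \<in> \<Theta>" using Tneg by (simp add: abs_if)
    ultimately show ?thesis using Ad by (intro bexI[of _ "\<bar>Arg w\<bar>"]) auto
  qed
  show ?thesis
  proof
    fix z :: complex assume z: "z \<in> sphere 0 1"
    then have z1: "norm z = 1" "z \<noteq> 0" by auto
    have cz: "cis (Arg z) = z" using cis_Arg[OF z1(2)] z1 by (simp add: sgn_div_norm)
    have "\<forall>j::nat. \<exists>t\<in>\<Theta>. \<bar>Arg z - t\<bar> < 1 / real (Suc j)"
    proof
      fix j
      obtain t where t: "t \<in> \<Theta>" "0 < t" "t < 1 / real (Suc j)" using small[of "1 / real (Suc j)"] by auto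
      define n where "n = \<lfloor>Arg z / t\<rfloor>"
      have "of_int n \<le> Arg z / t" "Arg z / t < of_int n + 1" by (simp_all add: n_def)
      then have "of_int n * t \<le> Arg z" "Arg z < of_int n * t + t" using t(2) by (simp_all add: field_simps)
      then have "\<bar>Arg z - of_int n * t\<bar> < 1 / real (Suc j)" using t by linarith
      then show "\<exists>t\<in>\<Theta>. \<bar>Arg z - t\<bar> < 1 / real (Suc j)" using Tint[OF t(1)] by blast
    qed
    then obtain t where t: "\<And>j::nat. t j \<in> \<Theta>" "\<And>j. \<bar>Arg z - t j\<bar> < 1 / real (Suc j)" by metis
    have "(\<lambda>j. Arg z - t j) \<longlonglongrightarrow> 0"
      by (rule Lim_null_comparison[OF _ LIMSEQ_inverse_real_of_nat])
        (use t(2) in \<open>auto intro!: always_eventually less_imp_le simp: divide_inverse\<close>)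
    then have "(\<lambda>j. Arg z - (Arg z - t j)) \<longlonglongrightarrow> Arg z - 0" by (intro tendsto_diff tendsto_const)
    then have "t \<longlonglongrightarrow> Arg z" by simp
    then have "(\<lambda>j. cis (t j)) \<longlonglongrightarrow> cis (Arg z)" unfolding cis_conv_exp by (intro tendsto_intros)
    moreover have "cis (t j) \<in> T" for j using t(1)[of j] by (simp add: \<Theta>_def)
    ultimately have "z \<in> T" using Tcl cz by (metis closed_sequentially)
    then show "z \<in> S" by (simp add: T_def)
  qed
qed

text \<open>Polarising the hypothesis shows that the kernel of \<open>(L\<^sub>1, L\<^sub>2)\<close> is stable under
  multiplication by \<open>\<i>\<close>; so the two functionals would make the quotient, a real plane with
  complex structure, degenerate.\<close>

lemma real_plane_misses_complex_line:
  fixes L1 L2 :: "complex^2 \<Rightarrow> real"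
  assumes lin: "linear L1" "linear L2"
    and q: "L1 q1 = 1" "L2 q1 = 0" "L1 q2 = 0" "L2 q2 = 1"
  shows "\<exists>z. L1 z * L2 (\<i> *s z) \<noteq> L2 z * L1 (\<i> *s z)"
proof (rule ccontr)
  assume "\<not> ?thesis"
  then have D: "L1 z * L2 (\<i> *s z) = L2 z * L1 (\<i> *s z)" for z by blast
  have sadd: "\<i> *s (z + w) = \<i> *s z + \<i> *s w" and ssc: "\<i> *s (r *\<^sub>R z) = r *\<^sub>R (\<i> *s z)"
    and sii: "\<i> *s (\<i> *s z) = (-1) *\<^sub>R z" for z w :: "complex^2" and r
    by (simp_all add: vec_eq_iff algebra_simps)
  note l = linear_add[OF lin(1)] linear_add[OF lin(2)] linear_scale[OF lin(1)] linear_scale[OF lin(2)]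
  have polar: "L1 z * L2 (\<i> *s w) + L1 w * L2 (\<i> *s z) = L2 z * L1 (\<i> *s w) + L2 w * L1 (\<i> *s z)" for z w
    using D[of "z + w"] D[of z] D[of w] by (simp add: sadd l algebra_simps)
  have stable: "L1 (\<i> *s z) = 0 \<and> L2 (\<i> *s z) = 0" if "L1 z = 0" "L2 z = 0" for z
    using polar[of q1 z] polar[of q2 z] that q by simp
  define t where "t = L1 (\<i> *s q1)"
  have t2: "L2 (\<i> *s q1) = 0" using D[of q1] q by simp
  \<comment> \<open>A vector of the common kernel; stability of the kernel under \<i> will give - 1
    - t * t = 0.\<close>
  define z where "z = \<i> *s q1 + (- t) *\<^sub>R q1"
  have "L1 z = 0" "L2 z = 0" unfolding z_def l using q t2 by (simp_all add: t_def)
  then have "L1 (\<i> *s z) = 0" using stable by blast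
  moreover have "\<i> *s z = (-1) *\<^sub>R q1 + (- t) *\<^sub>R (\<i> *s q1)" by (simp only: z_def sadd ssc sii)
  then have "L1 (\<i> *s z) = (-1) *\<^sub>R L1 q1 + (- t) *\<^sub>R L1 (\<i> *s q1)" by (simp only: l)
  then have "L1 (\<i> *s z) = - 1 - t * t" using q by (simp add: t_def)
  moreover have "0 \<le> t * t" by simp
  ultimately show False by linarith
qed

section \<open>Polynomial consequences of Zariski density\<close>

lemma real_polynomial_function_Re_Im_power:
  assumes "real_polynomial_function (\<lambda>x. Re (f x))" "real_polynomial_function (\<lambda>x. Im (f x))"
  shows "real_polynomial_function (\<lambda>x. Re (f x ^ n)) \<and> real_polynomial_function (\<lambda>x. Im (f x ^ n))"
proof (induction n)
  case (Suc n)
  then show ?case using assms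
    by (auto simp only: power_Suc times_complex.sel
        intro!: real_polynomial_function_diff real_polynomial_function.intros(3,4))
qed (simp add: real_polynomial_function.intros(2))

text \<open>Complex coordinates in which \<open>H\<close> acts as \<open>SL2C\<close>. They are kept
  abstract so that the standard basis can be exchanged for an eigenbasis of a loxodromic
  element.\<close>

locale dense_coords =
  fixes \<Gamma> H :: "mat4 set" and \<phi> :: "real^4 \<Rightarrow> complex^2" and \<psi> :: "complex^2 \<Rightarrow> real^4"
  assumes lin: "linear \<phi>" "linear \<psi>" and \<phi>\<psi>: "\<And>z. \<phi> (\<psi> z) = z" and \<psi>\<phi>: "\<And>x. \<psi> (\<phi> x) = x"
    and toH: "\<And>A. A \<in> SL2C \<Longrightarrow> \<exists>B\<in>H. \<forall>x. \<phi> (B *v x) = A *v \<phi> x"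
    and ofH: "\<And>B. B \<in> H \<Longrightarrow> \<exists>A\<in>SL2C. \<forall>x. \<phi> (B *v x) = A *v \<phi> x"
    and zariski: "\<And>p B. real_polynomial_function p \<Longrightarrow> (\<forall>B\<in>\<Gamma> \<inter> H. p B = 0) \<Longrightarrow> B \<in> H \<Longrightarrow> p B = 0"
begin

lemma linear_poly: "linear f \<Longrightarrow> real_polynomial_function f" for f :: "mat4 \<Rightarrow> real"
  by (simp add: linear_conv_bounded_linear real_polynomial_function.intros(1))

lemma coord_poly:
  fixes y :: "real^4"
  shows "real_polynomial_function (\<lambda>B. Re (\<phi> (B *v y) $ i))" "real_polynomial_function (\<lambda>B. Im (\<phi> (B *v y) $ i))"
proof -
  have add: "\<phi> ((A + B) *v y) = \<phi> (A *v y) + \<phi> (B *v y)" for A B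
    by (simp add: matrix_vector_mult_add_rdistrib linear_add[OF lin(1)])
  have sc: "\<phi> ((r *\<^sub>R A) *v y) = r *\<^sub>R \<phi> (A *v y)" for r A
    by (simp add: linear_scale[OF lin(1)] flip: scaleR_matrix_vector_assoc)
  show "real_polynomial_function (\<lambda>B. Re (\<phi> (B *v y) $ i))" "real_polynomial_function (\<lambda>B. Im (\<phi> (B *v y) $ i))"
    by (rule linear_poly, rule linearI, simp_all add: add sc)+
qed

text \<open>The imaginary part of the trace is a real polynomial; it is nonzero at the diagonal
  matrix with entries 2\<i> and -\<i>/2. Elliptic and parabolic elements have real trace, so the
  element found is loxodromic.\<close>

lemma exists_nonreal_trace:
  "\<exists>B\<in>\<Gamma> \<inter> H. \<exists>A\<in>SL2C. (\<forall>x. \<phi> (B *v x) = A *v \<phi> x) \<and> Im (A$1$1 + A$2$2) \<noteq> 0"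
proof (rule ccontr)
  assume neg: "\<not> ?thesis"
  define p where "p B = Im (\<phi> (B *v \<psi> (axis 1 1)) $ 1) + Im (\<phi> (B *v \<psi> (axis 2 1)) $ 2)" for B
  have pA: "p B = Im (A$1$1 + A$2$2)" if "\<forall>x. \<phi> (B *v x) = A *v \<phi> x" for A B
    using that by (simp add: p_def \<phi>\<psi> matrix_vector_2 axis_def)
  have "real_polynomial_function p"
    unfolding p_def by (intro real_polynomial_function.intros(3) coord_poly)
  moreover have "\<forall>B\<in>\<Gamma> \<inter> H. p B = 0"
    using neg ofH pA by (metis IntD2)
  moreover obtain B where "B \<in> H" "\<forall>x. \<phi> (B *v x) = cmat (2 * \<i>) 0 0 (- \<i> / 2) *v \<phi> x"
    using toH[of "cmat (2 * \<i>) 0 0 (- \<i> / 2)"] by (auto simp: cmat_SL2C)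
  ultimately show False using zariski[of p B] pA[of B "cmat (2 * \<i>) 0 0 (- \<i> / 2)"] by simp
qed

text \<open>The identity and a quarter turn read off both coordinates of \<open>\<phi> v\<close>.
  The lemma provides a point of the cone whose projection to the attracting line is not 0.\<close>

lemma exists_first_coordinate_nonzero:
  assumes "v \<noteq> 0"
  shows "\<exists>B\<in>\<Gamma> \<inter> H. \<phi> (B *v v) $ 1 \<noteq> 0"
proof (rule ccontr)
  assume neg: "\<not> ?thesis"
  have z: "\<phi> (B *v v) $ 1 = 0" if "B \<in> H" for B
    using zariski[OF coord_poly(1)[of v 1] _ that] zariski[OF coord_poly(2)[of v 1] _ that] neg
    by (simp add: complex_eq_iff)
  have "A \<in> SL2C \<Longrightarrow> (A *v \<phi> v) $ 1 = 0" for A using toH[of A] z by metis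
  from this[of "cmat 1 0 0 1"] this[of "cmat 0 1 (-1) 0"]
  have "\<phi> v = 0" by (intro vec2_eqI) (simp_all add: cmat_SL2C matrix_vector_2)
  then have "v = 0" using \<psi>\<phi>[of v] linear_0[OF lin(2)] by simp
  then show False using assms by simp
qed

text \<open>The two sides differ by a 2 by 2 minor: it is nonzero when the translated complex line
  projects isomorphically to the first two coordinates of the frame k. If it vanished on
  \<open>\<Gamma> \<inter> H\<close> it would vanish on \<open>H\<close>; transitivity of
  \<open>SL2C\<close> on nonzero vectors would then make every complex line degenerate.\<close>

lemma exists_transverse_translate:
  assumes k: "orthogonal_matrix (k :: mat4)"
  shows "\<exists>B\<in>\<Gamma> \<inter> H.
    (k *v (B *v \<psi> (axis 1 1))) $ 1 * (k *v (B *v \<psi> (axis 1 \<i>))) $ 2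
    \<noteq> (k *v (B *v \<psi> (axis 1 1))) $ 2 * (k *v (B *v \<psi> (axis 1 \<i>))) $ 1"
proof (rule ccontr)
  assume neg: "\<not> ?thesis"
  define p where "p B = (k *v (B *v \<psi> (axis 1 1))) $ 1 * (k *v (B *v \<psi> (axis 1 \<i>))) $ 2
    - (k *v (B *v \<psi> (axis 1 1))) $ 2 * (k *v (B *v \<psi> (axis 1 \<i>))) $ 1" for B
  have "linear (\<lambda>B. (k *v (B *v y)) $ i)" for y :: "real^4" and i
    by (rule linearI) (simp_all add: matrix_vector_mult_add_rdistrib matrix_vector_right_distrib matrix_vector_mult_scaleR flip: scaleR_matrix_vector_assoc)
  then have "real_polynomial_function (\<lambda>B. (k *v (B *v y)) $ i)" for y :: "real^4" and i by (rule linear_poly)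
  then have "real_polynomial_function p"
    unfolding p_def by (intro real_polynomial_function_diff real_polynomial_function.intros(4))
  moreover have "\<forall>B\<in>\<Gamma> \<inter> H. p B = 0" using neg by (simp add: p_def)
  ultimately have pH: "p B = 0" if "B \<in> H" for B using that by (rule zariski)
  define L where "L i z = (k *v \<psi> z) $ i" for i z
  have L: "linear (L i)" for i
    unfolding L_def
    by (rule linearI) (simp_all add: linear_add[OF lin(2)] linear_scale[OF lin(2)] matrix_vector_right_distrib matrix_vector_mult_scaleR)
  have "L 1 z * L 2 (\<i> *s z) = L 2 z * L 1 (\<i> *s z)" for z
  proof (cases "z = 0")
    case False
    then have "z$1 \<noteq> 0 \<or> z$2 \<noteq> 0" by (auto simp: vec_eq_iff forall_2)
    then obtain A where A: "A \<in> SL2C" "A *v axis 1 1 = z"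
    proof
      assume "z$1 \<noteq> 0"
      then show ?thesis
        by (intro that[of "cmat (z$1) 0 (z$2) (1 / z$1)"] vec2_eqI) (simp_all add: cmat_SL2C matrix_vector_2 axis_def)
    next
      assume "z$2 \<noteq> 0"
      then show ?thesis
        by (intro that[of "cmat (z$1) (- 1 / z$2) (z$2) 0"] vec2_eqI) (simp_all add: cmat_SL2C matrix_vector_2 axis_def)
    qed
    have Ai: "A *v axis 1 \<i> = \<i> *s z" unfolding A(2)[symmetric]
      by (rule vec2_eqI) (simp_all add: matrix_vector_2 axis_def)
    obtain B where B: "B \<in> H" "\<And>x. \<phi> (B *v x) = A *v \<phi> x" using toH[OF A(1)] by blast
    have "B *v \<psi> y = \<psi> (A *v y)" for y using B(2)[of "\<psi> y"] \<psi>\<phi>[of "B *v \<psi> y"] by (simp add: \<phi>\<psi>)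
    then show ?thesis using pH[OF B(1)] A(2) Ai by (simp add: p_def L_def)
  qed (simp add: linear_0[OF L])
  moreover have "L i (\<phi> (transpose k *v y)) = y $ i" for i y
    unfolding L_def \<psi>\<phi> matrix_vector_mul_assoc
    using k by (simp only: orthogonal_matrix_def matrix_vector_mul_lid)
  ultimately show False
    using real_plane_misses_complex_line[OF L[of 1] L[of 2], of "\<phi> (transpose k *v axis 1 1)" "\<phi> (transpose k *v axis 2 1)"]
    by (simp add: axis_def)
qed

end

section \<open>An invariant cone contains the attracting complex line\<close>

locale invariant_cone = dense_coords +
  fixes K :: "(real^4) set" and \<mu> :: complex and v :: "real^4"
  assumes closed: "closed K" and cone: "\<And>c x. x \<in> K \<Longrightarrow> c *\<^sub>R x \<in> K"
    and invariant: "\<And>B x. B \<in> \<Gamma> \<Longrightarrow> x \<in> K \<Longrightarrow> B *v x \<in> K"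
    and v: "v \<in> K" "v \<noteq> 0"
    and mu: "norm \<mu> > 1" "\<exists>B\<in>\<Gamma>. \<forall>x. \<phi> (B *v x) = vector [\<mu> * \<phi> x $ 1, inverse \<mu> * \<phi> x $ 2]"
begin

text \<open>Iterate the loxodromic element along times at which its rotation part is nearly trivial.\<close>

lemma project:
  assumes x: "x \<in> K"
  shows "\<psi> (axis 1 (\<phi> x $ 1)) \<in> K"
proof -
  have l0: "\<mu> \<noteq> 0" using mu(1) by auto
  have "norm (sgn \<mu>) = 1" using l0 by (simp add: norm_sgn)
  then obtain n where n: "\<And>j::nat. j \<le> n j" "(\<lambda>j. sgn \<mu> ^ n j) \<longlonglongrightarrow> 1"
    using unit_power_recurrence by blast
  obtain B where B: "B \<in> \<Gamma>" "\<And>x. \<phi> (B *v x) = vector [\<mu> * \<phi> x $ 1, inverse \<mu> * \<phi> x $ 2]"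
    using mu(2) by blast
  define y where "y m = ((\<lambda>x. B *v x) ^^ m) x" for m
  have yK: "y m \<in> K" for m
    by (induction m) (auto simp: y_def x invariant B(1))
  have \<phi>y: "\<phi> (y m) $ 1 = \<mu> ^ m * \<phi> x $ 1 \<and> \<phi> (y m) $ 2 = inverse \<mu> ^ m * \<phi> x $ 2" for m
    by (induction m) (auto simp: y_def B(2) vector_2)
  define r where "r = inverse (norm \<mu>)"
  have r: "0 < r" "r < 1" using mu(1) by (auto simp: r_def inverse_less_1_iff)
  \<comment> \<open>Dividing by the modulus of \<mu> to the power n leaves only the rotation on the
    first coordinate, while the second is multiplied by a number of modulus \<open>r ^ n j\<close>
    squared.\<close>
  define z where "z j = (r ^ n j) *\<^sub>R \<phi> (y (n j))" for j
  have rn: "(\<lambda>j. r ^ n j) \<longlonglongrightarrow> 0"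
  proof (rule Lim_null_comparison)
    show "\<forall>\<^sub>F j in sequentially. norm (r ^ n j) \<le> r ^ j"
      using r n(1) by (auto intro!: always_eventually power_decreasing)
    show "(\<lambda>j. r ^ j) \<longlonglongrightarrow> 0" using r by (intro LIMSEQ_power_zero) auto
  qed
  have z1: "z j $ 1 = sgn \<mu> ^ n j * \<phi> x $ 1" for j
  proof -
    have "z j $ 1 = (r ^ n j) *\<^sub>R (\<mu> ^ n j * \<phi> x $ 1)" by (simp add: z_def \<phi>y)
    also have "\<dots> = (of_real r * \<mu>) ^ n j * \<phi> x $ 1"
      by (simp add: scaleR_conv_of_real power_mult_distrib)
    also have "of_real r * \<mu> = sgn \<mu>" by (simp add: r_def sgn_eq divide_inverse mult.commute)
    finally show ?thesis .
  qed
  have "(\<lambda>j. z j $ 1) \<longlonglongrightarrow> 1 * \<phi> x $ 1"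
    unfolding z1 by (intro tendsto_mult_right n)
  moreover have "(\<lambda>j. z j $ 2) \<longlonglongrightarrow> 0"
  proof (rule Lim_null_comparison)
    show "\<forall>\<^sub>F j in sequentially. norm (z j $ 2) \<le> r ^ n j * norm (\<phi> x $ 2)"
    proof (rule always_eventually, rule allI)
      fix j
      have "norm (z j $ 2) = r ^ n j * (r ^ n j * norm (\<phi> x $ 2))"
        using r by (simp add: z_def \<phi>y norm_mult norm_power norm_inverse r_def)
      also have "\<dots> \<le> r ^ n j * (1 * norm (\<phi> x $ 2))"
        using r by (intro mult_left_mono mult_right_mono power_le_one) auto
      finally show "norm (z j $ 2) \<le> r ^ n j * norm (\<phi> x $ 2)" by simp
    qed
    show "(\<lambda>j. r ^ n j * norm (\<phi> x $ 2)) \<longlonglongrightarrow> 0" using tendsto_mult_right[OF rn] by simp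
  qed
  ultimately have "(\<lambda>j. z j $ i) \<longlonglongrightarrow> axis 1 (\<phi> x $ 1) $ i" for i
    using exhaust_2[of i] by (auto simp: axis_def)
  then have "z \<longlonglongrightarrow> axis 1 (\<phi> x $ 1)" by (rule vec_tendstoI)
  then have "(\<lambda>j. \<psi> (z j)) \<longlonglongrightarrow> \<psi> (axis 1 (\<phi> x $ 1))"
    using lin(2) by (simp add: linear_conv_bounded_linear bounded_linear.tendsto)
  moreover have "\<psi> (z j) \<in> K" for j
    using cone[OF yK] by (simp add: z_def linear_scale[OF lin(2)] \<psi>\<phi>)
  ultimately show ?thesis using closed by (metis closed_sequentially)
qed

text \<open>The trace of the cone on the attracting line, and the complex multipliers preserving it. If
  only finitely many of them had modulus one, some power of a matrix entry would be real throughout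
  the group, contrary to Zariski density.\<close>

definition K1 where "K1 = {y. \<psi> (axis 1 y) \<in> K}"
definition S1 where "S1 = {z. \<forall>y\<in>K1. z * y \<in> K1}"

lemma linear_line: "linear (\<lambda>y. \<psi> (axis 1 y))"
proof (rule linearI)
  have "axis 1 (a + b) = axis 1 a + (axis 1 b :: complex^2)" "axis 1 (r *\<^sub>R a) = r *\<^sub>R (axis 1 a :: complex^2)" for a b r
    by (auto simp: vec_eq_iff axis_def)
  then show "\<psi> (axis 1 (a + b)) = \<psi> (axis 1 a) + \<psi> (axis 1 b)" "\<psi> (axis 1 (r *\<^sub>R a)) = r *\<^sub>R \<psi> (axis 1 a)" for a b r
    by (simp_all add: linear_add[OF lin(2)] linear_scale[OF lin(2)])
qed

lemma closed_K1: "closed K1"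
proof -
  have "continuous_on UNIV (\<lambda>y. \<psi> (axis 1 y))"
    using linear_line by (intro linear_continuous_on) (simp add: linear_conv_bounded_linear)
  then show ?thesis
    unfolding K1_def using closed by (simp add: closed_vimage continuous_on_closed_vimage vimage_def)
qed

lemma closed_S1: "closed S1"
proof -
  have "closed ((\<lambda>z. z * y) -` K1)" for y
    by (intro closed_vimage closed_K1 continuous_intros)
  then have "closed (\<Inter>y\<in>K1. (\<lambda>z. z * y) -` K1)" by blast
  moreover have "S1 = (\<Inter>y\<in>K1. (\<lambda>z. z * y) -` K1)" by (auto simp: S1_def)
  ultimately show ?thesis by simp
qed

lemma S1_real: "of_real r \<in> S1"
  using cone linear_scale[OF linear_line] by (simp add: S1_def K1_def flip: scaleR_conv_of_real)

lemma S1_mult: "z \<in> S1 \<Longrightarrow> w \<in> S1 \<Longrightarrow> z * w \<in> S1"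
  by (auto simp: S1_def mult.assoc)

text \<open>Moving a point of the line by B and projecting back multiplies it by the upper left
  entry of B.\<close>

lemma S1_entry:
  assumes "B \<in> \<Gamma> \<inter> H" 
  shows "\<phi> (B *v \<psi> (axis 1 1)) $ 1 \<in> S1"
proof -
  obtain A where A: "\<And>x. \<phi> (B *v x) = A *v \<phi> x" using ofH assms by blast
  have "\<phi> (B *v \<psi> (axis 1 1)) $ 1 * y \<in> K1" if "y \<in> K1" for y
  proof -
    have "B *v \<psi> (axis 1 y) \<in> K" using that assms by (simp add: K1_def invariant)
    then have "\<psi> (axis 1 (\<phi> (B *v \<psi> (axis 1 y)) $ 1)) \<in> K" by (rule project)
    then show ?thesis by (simp add: A \<phi>\<psi> matrix_vector_2 axis_def K1_def)
  qed
  then show ?thesis by (simp add: S1_def)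
qed

lemma infinite_S1: "infinite (S1 \<inter> sphere 0 1)"
proof
  assume fin: "finite (S1 \<inter> sphere 0 1)"
  define T where "T = S1 \<inter> sphere 0 1"
  have finT: "finite T" using fin by (simp add: T_def)
  have "\<exists>e>0. z ^ e = 1" if z: "z \<in> T" for z
  proof -
    have "z ^ n \<in> T" for n
      using z S1_real[of 1] by (induction n) (auto simp: T_def norm_mult intro: S1_mult)
    then have "range (\<lambda>n. z ^ n) \<subseteq> T" by blast
    then have "finite (range (\<lambda>n::nat. z ^ n))" using finT by (rule finite_subset)
    then have "\<not> inj (\<lambda>n::nat. z ^ n)" using finite_imageD infinite_UNIV_nat by blast
    then obtain m n where mn: "m < n" "z ^ m = z ^ n" unfolding inj_def by (metis linorder_neqE_nat)
    moreover have "z \<noteq> 0" using z by (auto simp: T_def)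
    ultimately have "z ^ (n - m) = 1" by (simp add: power_diff)
    then show ?thesis using mn by (intro exI[of _ "n - m"]) simp
  qed
  then obtain e where e: "\<And>z. z \<in> T \<Longrightarrow> e z > 0 \<and> z ^ e z = (1::complex)" by metis
  \<comment> \<open>A common exponent for the finitely many roots of unity.\<close>
  define M where "M = (\<Prod>z\<in>T. e z)"
  have M0: "M > 0" unfolding M_def by (rule prod_pos) (use e in auto)
  have zM: "z ^ M = 1" if "z \<in> T" for z
  proof -
    have "e z dvd M" unfolding M_def using finT that by (rule dvd_prodI)
    then obtain d where "M = e z * d" by blast
    then show ?thesis using e[OF that] by (simp add: power_mult)
  qed
  define f where "f B = \<phi> (B *v \<psi> (axis 1 1)) $ 1" for B
  have "real_polynomial_function (\<lambda>B. Im (f B ^ M))"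
    using real_polynomial_function_Re_Im_power[of f M] coord_poly by (simp add: f_def)
  moreover have "\<forall>B\<in>\<Gamma> \<inter> H. Im (f B ^ M) = 0"
  proof
    fix B assume "B \<in> \<Gamma> \<inter> H"
    then have S: "f B \<in> S1" unfolding f_def by (rule S1_entry)
    show "Im (f B ^ M) = 0"
    proof (cases "f B = 0")
      case True then show ?thesis using M0 by simp
    next
      case False
      have "sgn (f B) = of_real (inverse (norm (f B))) * f B"
        by (simp add: sgn_eq divide_inverse mult.commute)
      then have "sgn (f B) \<in> S1" using S1_mult[OF S1_real S] by metis
      then have "sgn (f B) \<in> T" using False by (simp add: T_def norm_sgn)
      then have "sgn (f B) ^ M = 1" by (rule zM)
      moreover have "f B = of_real (norm (f B)) * sgn (f B)" using False
        by (simp add: sgn_eq)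
      ultimately have "f B ^ M = of_real (norm (f B)) ^ M" by (metis mult.right_neutral power_mult_distrib)
      then show ?thesis by (simp flip: of_real_power)
    qed
  qed
  \<comment> \<open>The diagonal matrix with entries \<zeta> and its inverse lies in
    \<open>SL2C\<close>, and the M-th power of its first entry is \<i>, which is not real.\<close>
  moreover define \<zeta> where "\<zeta> = cis (pi / (2 * real M))"
  have z0: "\<zeta> \<noteq> 0" by (simp add: \<zeta>_def)
  have zi: "\<zeta> ^ M = \<i>" using M0 by (simp add: \<zeta>_def Complex.DeMoivre)
  obtain B where B: "B \<in> H" "\<And>x. \<phi> (B *v x) = cmat \<zeta> 0 0 (inverse \<zeta>) *v \<phi> x"
    using toH[of "cmat \<zeta> 0 0 (inverse \<zeta>)"] z0 by (auto simp: cmat_SL2C)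
  ultimately have "Im (f B ^ M) = 0" using zariski B(1) by blast
  then show False by (simp add: f_def B(2) \<phi>\<psi> matrix_vector_2 axis_def zi)
qed

text \<open>Real scalings and the circle generate all complex multipliers, so one nonzero point of
  the cone on the line spreads over the whole line.\<close>

lemma line_subset: "\<psi> (axis 1 y) \<in> K"
proof -
  obtain B where B: "B \<in> \<Gamma> \<inter> H" "\<phi> (B *v v) $ 1 \<noteq> 0"
    using exists_first_coordinate_nonzero[OF v(2)] by blast
  define y0 where "y0 = \<phi> (B *v v) $ 1"
  have y0: "y0 \<in> K1" "y0 \<noteq> 0"
    using project[of "B *v v"] invariant v(1) B by (auto simp: K1_def y0_def)
  have sph: "sphere 0 1 \<subseteq> S1"
    using closed_S1 S1_mult S1_real[of 1] infinite_S1 by (intro closed_semigroup_circle) auto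
  have "z \<in> S1" for z
  proof (cases "z = 0")
    case True then show ?thesis using S1_real[of 0] by simp
  next
    case False
    then have "sgn z \<in> S1" using sph by (auto simp: norm_sgn)
    then have "of_real (norm z) * sgn z \<in> S1" using S1_mult S1_real by blast
    moreover have "of_real (norm z) * sgn z = z" using False by (simp add: sgn_eq)
    ultimately show ?thesis by simp
  qed
  then have "y / y0 \<in> S1" .
  then have "(y / y0) * y0 \<in> K1" using y0(1) unfolding S1_def by blast
  then show ?thesis using y0(2) by (simp add: K1_def)
qed

end

section \<open>Coordinates for a conjugate of the image of SL(2,C)\<close>

text \<open>Places \<open>H\<close> inside \<open>SL4\<close>, so that \<open>H\<close> is contained
  in its Zariski closure, which is taken there.\<close>

lemma det_tau: "det (tau A) = (norm (det A))\<^sup>2"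
proof -
  have t: "tau A $ i $ j = real_coords (A *v complex_coords (axis j 1)) $ i" for i j
    by (simp add: tau_def matrix_def)
  have d: "(norm (det A))\<^sup>2 = (Re (A$1$1 * A$2$2 - A$1$2 * A$2$1))\<^sup>2 + (Im (A$1$1 * A$2$2 - A$1$2 * A$2$1))\<^sup>2"
    by (simp add: cmod_power2 det_2)
  show ?thesis
    unfolding d det_4 t
    by (simp add: real_coords_def complex_coords_def vector_4 vector_2 matrix_vector_2 axis_def)
      (simp add: power2_eq_square algebra_simps)
qed

lemma zariski_dense_vanishing:
  assumes zd: "zariski_dense_in T H" and H: "H \<subseteq> carrier SL4"
    and p: "real_polynomial_function p" "\<forall>B\<in>T. p B = 0" and B: "B \<in> H"
  shows "p B = 0"
proof -
  have "B \<in> zariski_closure_SL4 H" using H B by (auto simp: zariski_closure_SL4_def)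
  then have "B \<in> zariski_closure_SL4 T" using zd by (simp add: zariski_dense_in_def)
  then show ?thesis using p by (auto simp: zariski_closure_SL4_def)
qed

lemma complex_coords_linear:
  "complex_coords (x + y) = complex_coords x + complex_coords y"
  "complex_coords (r *\<^sub>R x) = r *\<^sub>R complex_coords x"
  "real_coords (z + w) = real_coords z + real_coords w"
  "real_coords (r *\<^sub>R z) = r *\<^sub>R real_coords z"
  by (simp_all add: complex_coords_def real_coords_def vec_eq_iff forall_2 forall_4 vector_2 vector_4 complex_eq_iff)

lemma matrix_vector_scaleR: "P *v (r *\<^sub>R z) = r *\<^sub>R (P *v z)" for P :: "complex^2^2"
  by (rule vec2_eqI) (simp_all add: matrix_vector_2 algebra_simps)

text \<open>Conjugation by an invertible P preserves \<open>SL2C\<close> whatever the determinant of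
  P, so any complex basis gives admissible coordinates.\<close>

lemma dense_coords_conjugate:
  assumes h: "h \<in> carrier SL4" and H: "H = (\<lambda>A. h ** tau A ** matrix_inv h) ` SL2C"
    and zd: "zariski_dense_in (\<Gamma> \<inter> H) H"
    and P: "P' ** P = mat 1" "P ** P' = mat 1"
  shows "dense_coords \<Gamma> H (\<lambda>x. P' *v complex_coords (iv h *v x)) (\<lambda>z. h *v real_coords (P *v z))"
proof -
  have dh: "det h = 1" using h by (simp add: SL4_def)
  then have ih: "invertible h" by (simp add: invertible_det_nz)
  note hi = iv_cancel(1,2)[OF ih]
  have "det (iv h) = 1" using arg_cong[OF hi(2), of det] dh by (simp add: det_mul)
  then have HS: "H \<subseteq> carrier SL4"
    using dh by (auto simp: H SL4_def det_mul det_tau SL2C_def)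
  have act: "P' *v complex_coords (iv h *v ((h ** tau A ** iv h) *v x))
      = (P' ** A) *v complex_coords (iv h *v x)" for A x
  proof -
    have "iv h *v ((h ** tau A ** iv h) *v x) = ((iv h ** h) ** tau A) *v (iv h *v x)"
      by (simp only: matrix_vector_mul_assoc matrix_mul_assoc)
    also have "\<dots> = real_coords (A *v complex_coords (iv h *v x))" by (simp add: hi tau_mult_vec)
    finally show ?thesis by (simp add: matrix_vector_mul_assoc)
  qed
  have dP: "det P' * det P = 1" using arg_cong[OF P(1), of det] by (simp add: det_mul)
  show ?thesis
  proof (rule dense_coords.intro)
    show "linear (\<lambda>x. P' *v complex_coords (iv h *v x))"
      by (rule linearI)
        (simp_all add: complex_coords_linear matrix_vector_right_distrib matrix_vector_mult_scaleR matrix_vector_scaleR)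
    show "linear (\<lambda>z. h *v real_coords (P *v z))"
      by (rule linearI)
        (simp_all add: complex_coords_linear matrix_vector_right_distrib matrix_vector_mult_scaleR matrix_vector_scaleR)
    show "P' *v complex_coords (iv h *v (h *v real_coords (P *v z))) = z" for z
      by (simp add: matrix_vector_mul_assoc hi P)
    show "h *v real_coords (P *v (P' *v complex_coords (iv h *v x))) = x" for x
      by (simp add: matrix_vector_mul_assoc P) (simp add: matrix_vector_mul_assoc hi)
    show "\<exists>B\<in>H. \<forall>x. P' *v complex_coords (iv h *v (B *v x)) = A *v (P' *v complex_coords (iv h *v x))"
      if A: "A \<in> SL2C" for A
    proof -
      have "P ** A ** P' \<in> SL2C" using A dP by (simp add: SL2C_def det_mul mult.commute)
      then have "h ** tau (P ** A ** P') ** iv h \<in> H" by (simp add: H)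
      moreover have "P' ** (P ** A ** P') = A ** P'" using P by (simp add: matrix_mul_assoc)
      ultimately show ?thesis
        by (intro bexI[of _ "h ** tau (P ** A ** P') ** iv h"] allI, unfold act)
          (simp_all only: matrix_vector_mul_assoc)
    qed
    show "\<exists>A\<in>SL2C. \<forall>x. P' *v complex_coords (iv h *v (B *v x)) = A *v (P' *v complex_coords (iv h *v x))"
      if "B \<in> H" for B
    proof -
      obtain A where A: "A \<in> SL2C" "B = h ** tau A ** iv h" using \<open>B \<in> H\<close> by (auto simp: H)
      have "P' ** A ** P \<in> SL2C" using A dP by (simp add: SL2C_def det_mul)
      moreover have "P' ** A ** P ** P' = P' ** A" using P by (simp flip: matrix_mul_assoc)
      ultimately show ?thesis
        unfolding A(2) by (intro bexI[of _ "P' ** A ** P"] allI, unfold act)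
          (simp_all only: matrix_vector_mul_assoc)
    qed
    show "p B = 0" if "real_polynomial_function p" "\<forall>B\<in>\<Gamma> \<inter> H. p B = 0" "B \<in> H" for p B
      using zariski_dense_vanishing[OF zd HS that] .
  qed
qed

text \<open>The roots of x^2 - t x + 1 are inverse to each other. On the unit circle they would be
  complex conjugates, and their sum t would be real.\<close>

lemma eigenvalue_outside_circle:
  assumes "Im t \<noteq> 0"
  obtains \<mu> :: complex where "norm \<mu> > 1" "\<mu> + inverse \<mu> = t"
proof -
  define d where "d = csqrt (t\<^sup>2 - 4)"
  define a where "a = (t + d) / 2"
  define b where "b = (t - d) / 2"
  have "d\<^sup>2 = t\<^sup>2 - 4" by (simp add: d_def)
  then have ab: "a * b = 1" "a + b = t" by (simp_all add: a_def b_def field_simps power2_eq_square)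
  then have a0: "a \<noteq> 0" "b \<noteq> 0" by auto
  have ia: "inverse a = b" "inverse b = a"
    using ab(1) by (metis inverse_unique mult.commute)+
  have "norm a \<noteq> 1"
  proof
    assume "norm a = 1"
    then have "inverse a = cnj a" using complex_norm_square[of a] a0
      by (metis inverse_unique of_real_1 one_power2)
    then have "t = a + cnj a" using ab ia by simp
    then show False using assms by simp
  qed
  moreover have "norm a * norm b = 1" using ab(1) by (metis norm_mult norm_one)
  ultimately have "norm a > 1 \<or> norm b > 1"
    by (smt (verit) mult_le_one mult_less_cancel_left2 norm_ge_zero a0 zero_less_norm_iff mult_left_le)
  then show ?thesis using that[of a] that[of b] ab ia by (auto simp: add.commute)
qed

text \<open>The columns of P are eigenvectors, read off from a nonzero off-diagonal entry; for
  diagonal A only the order of the two eigenvalues is left to decide.\<close>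

lemma diagonalize_2:
  fixes A :: "complex^2^2"
  assumes tr: "A$1$1 + A$2$2 = \<mu> + \<nu>" and det: "A$1$1 * A$2$2 - A$1$2 * A$2$1 = 1"
    and \<mu>\<nu>: "\<mu> * \<nu> = 1" "\<mu> \<noteq> \<nu>"
  obtains P where "det P \<noteq> 0" "A ** P = P ** cmat \<mu> 0 0 \<nu>"
proof -
  define a b c d where abcd: "a = A$1$1" "b = A$1$2" "c = A$2$1" "d = A$2$2"
  have d: "d = \<mu> + \<nu> - a" using tr by (simp add: abcd algebra_simps)
  have bc: "b * c = a * d - \<mu> * \<nu>" using det \<mu>\<nu>(1) by (simp add: abcd algebra_simps)
  have AP: "A ** P = P ** cmat \<mu> 0 0 \<nu>"
    if "a * P$1$1 + b * P$2$1 = P$1$1 * \<mu>" "a * P$1$2 + b * P$2$2 = P$1$2 * \<nu>"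
      "c * P$1$1 + d * P$2$1 = P$2$1 * \<mu>" "c * P$1$2 + d * P$2$2 = P$2$2 * \<nu>" for P
    using that by (simp add: vec_eq_iff forall_2 matrix_matrix_mult_def sum_2 abcd)
  show ?thesis
  proof (cases "b = 0")
    case False
    let ?P = "cmat b b (\<mu> - a) (\<nu> - a)"
    have "det ?P \<noteq> 0" using False \<mu>\<nu>(2) by (simp add: det_2 algebra_simps)
    moreover have "A ** ?P = ?P ** cmat \<mu> 0 0 \<nu>"
      using bc by (intro AP) (simp_all add: d algebra_simps)
    ultimately show ?thesis by (rule that)
  next
    case b: True
    show ?thesis
    proof (cases "c = 0")
      case False
      let ?P = "cmat (\<mu> - d) (\<nu> - d) c c"
      have "det ?P \<noteq> 0" using False \<mu>\<nu>(2) by (simp add: det_2 algebra_simps)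
      moreover have "A ** ?P = ?P ** cmat \<mu> 0 0 \<nu>"
        using bc by (intro AP) (simp_all add: b d algebra_simps)
      ultimately show ?thesis by (rule that)
    next
      case c: True
      have "(a - \<mu>) * (a - \<nu>) = 0" using bc b by (simp add: d algebra_simps)
      then consider "a = \<mu>" | "a = \<nu>" by auto
      then show ?thesis
      proof cases
        case 1
        then have "A ** cmat 1 0 0 1 = cmat 1 0 0 1 ** cmat \<mu> 0 0 \<nu>" using b c d by (intro AP) simp_all
        then show ?thesis by (intro that[of "cmat 1 0 0 1"]) (simp_all add: det_2)
      next
        case 2
        then have "A ** cmat 0 1 1 0 = cmat 0 1 1 0 ** cmat \<mu> 0 0 \<nu>" using b c d by (intro AP) simp_all
        then show ?thesis by (intro that[of "cmat 0 1 1 0"]) (simp_all add: det_2)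
      qed
    qed
  qed
qed

lemma loxodromic_coordinates:
  assumes h: "h \<in> carrier SL4" and H: "H = (\<lambda>A. h ** tau A ** matrix_inv h) ` SL2C"
    and zd: "zariski_dense_in (\<Gamma> \<inter> H) H"
  obtains \<phi> \<psi> \<mu> where "dense_coords \<Gamma> H \<phi> \<psi>" "norm \<mu> > 1"
    "\<exists>B\<in>\<Gamma>. \<forall>x. \<phi> (B *v x) = vector [\<mu> * \<phi> x $ 1, inverse \<mu> * \<phi> x $ 2]"
proof -
  define \<phi>0 where "\<phi>0 x = complex_coords (iv h *v x)" for x
  \<comment> \<open>The standard basis serves to find an element with nonreal trace, whose
    eigenbasis then gives the final coordinates.\<close>
  have "dense_coords \<Gamma> H (\<lambda>x. mat 1 *v complex_coords (iv h *v x)) (\<lambda>z. h *v real_coords (mat 1 *v z))"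
    by (rule dense_coords_conjugate[OF h H zd]) simp_all
  then obtain B A where BA: "B \<in> \<Gamma> \<inter> H" "A \<in> SL2C" "\<And>x. \<phi>0 (B *v x) = A *v \<phi>0 x" "Im (A$1$1 + A$2$2) \<noteq> 0"
    using dense_coords.exists_nonreal_trace by (fastforce simp: \<phi>0_def)
  obtain \<mu> where \<mu>: "norm \<mu> > 1" "\<mu> + inverse \<mu> = A$1$1 + A$2$2"
    using eigenvalue_outside_circle[OF BA(4)] .
  have \<mu>0: "\<mu> \<noteq> 0" using \<mu>(1) by auto
  have "norm (inverse \<mu>) < 1" using \<mu>(1) by (simp add: norm_inverse inverse_less_1_iff)
  then have "\<mu> \<noteq> inverse \<mu>" using \<mu>(1) by force
  then obtain P where P: "det P \<noteq> 0" "A ** P = P ** cmat \<mu> 0 0 (inverse \<mu>)"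
    using diagonalize_2[of A \<mu> "inverse \<mu>"] \<mu> \<mu>0 BA(2) by (auto simp: SL2C_def det_2)
  then obtain P' where P': "P' ** P = mat 1" "P ** P' = mat 1"
    by (auto simp: invertible_def simp flip: invertible_det_nz)
  have "P' *v \<phi>0 (B *v x) = vector [\<mu> * (P' *v \<phi>0 x) $ 1, inverse \<mu> * (P' *v \<phi>0 x) $ 2]" for x
  proof -
    have "P' ** A = P' ** A ** (P ** P')" by (simp add: P')
    also have "\<dots> = P' ** (A ** P) ** P'" by (simp only: matrix_mul_assoc)
    also have "\<dots> = (P' ** P) ** cmat \<mu> 0 0 (inverse \<mu>) ** P'" unfolding P(2) by (simp only: matrix_mul_assoc)
    finally have PA: "P' ** A = cmat \<mu> 0 0 (inverse \<mu>) ** P'" by (simp add: P')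
    have "P' *v \<phi>0 (B *v x) = (P' ** A) *v \<phi>0 x" by (simp add: BA(3) matrix_vector_mul_assoc)
    also have "\<dots> = cmat \<mu> 0 0 (inverse \<mu>) *v (P' *v \<phi>0 x)" by (simp add: PA matrix_vector_mul_assoc)
    finally show ?thesis by (intro vec2_eqI) (simp_all add: matrix_vector_2 vector_2)
  qed
  then show ?thesis
    using BA(1) \<mu>(1)
    by (intro that[OF dense_coords_conjugate[OF h H zd P']]) (auto simp: \<phi>0_def)
qed

section \<open>Attraction to the planes of the limit set\<close>

lemma tendsto_matrix_vector_mult:
  fixes A :: "'b \<Rightarrow> real^'n^'m"
  assumes "(A \<longlongrightarrow> A0) F" "(f \<longlongrightarrow> f0) F"
  shows "((\<lambda>x. A x *v f x) \<longlongrightarrow> A0 *v f0) F"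
proof (rule vec_tendstoI)
  show "((\<lambda>x. (A x *v f x) $ i) \<longlongrightarrow> (A0 *v f0) $ i) F" for i
    unfolding matrix_vector_mult_def vec_lambda_beta by (intro tendsto_intros assms)
qed

lemma diagonal_mult_vec: "(diagonal s *v u) $ i = s$i * u$i"
  using exhaust_4[of i] by (auto simp: diagonal_def matrix_vector_mult_def sum_4)

text \<open>A plane that projects isomorphically to the two leading right singular directions is
  carried by \<open>\<gamma> j\<close> towards the limit plane. The limit of the right factors is
  not known beforehand, so transversality is asked for every orthogonal frame; B moves the given
  plane into good position.\<close>

lemma (in anosov_group) limit_plane_subset:
  assumes W: "W \<in> limit_set2 \<Gamma>" and X: "closed X" "\<And>g x. g \<in> \<Gamma> \<Longrightarrow> x \<in> X \<Longrightarrow> g *v x \<in> X"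
    and plane: "\<And>a b. a *\<^sub>R f1 + b *\<^sub>R f2 \<in> X"
    and transverse: "\<And>k. orthogonal_matrix k \<Longrightarrow> \<exists>B\<in>\<Gamma>.
      (k *v (B *v f1)) $ 1 * (k *v (B *v f2)) $ 2 \<noteq> (k *v (B *v f1)) $ 2 * (k *v (B *v f2)) $ 1"
  shows "W \<subseteq> X"
proof
  fix x assume "x \<in> W"
  obtain \<gamma> k k' where g: "\<And>j::nat. \<gamma> j \<in> \<Gamma>" "filterlim (\<lambda>j. len (\<gamma> j)) at_top sequentially"
    "(\<lambda>j. left_factor (\<gamma> j)) \<longlonglongrightarrow> k" "(\<lambda>j. right_factor (\<gamma> j)) \<longlonglongrightarrow> k'" "orthogonal_matrix k'" "W = (*v) k ` e12_plane"
    using limit_sequence[OF W] by metis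
  obtain u where u: "x = k *v u" "u$3 = 0" "u$4 = 0" using \<open>x \<in> W\<close> by (auto simp: g(6) mem_e12_plane)
  obtain B where B: "B \<in> \<Gamma>"
    "(k' *v (B *v f1)) $ 1 * (k' *v (B *v f2)) $ 2 \<noteq> (k' *v (B *v f1)) $ 2 * (k' *v (B *v f2)) $ 1"
    using transverse[OF g(5)] by blast
  define m where "m = k' *v (B *v f1)"
  define m' where "m' = k' *v (B *v f2)"
  define n where "n j = right_factor (\<gamma> j) *v (B *v f1)" for j
  define n' where "n' j = right_factor (\<gamma> j) *v (B *v f2)" for j
  have nm: "n \<longlonglongrightarrow> m" "n' \<longlonglongrightarrow> m'"
    unfolding n_def n'_def m_def m'_def by (intro tendsto_matrix_vector_mult g(4) tendsto_const)+
  have ni: "(\<lambda>j. n j $ i) \<longlonglongrightarrow> m $ i" "(\<lambda>j. n' j $ i) \<longlonglongrightarrow> m' $ i" for i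
    using nm by (auto intro: tendsto_vec_nth)
  define \<Delta> where "\<Delta> j = n j $ 1 * n' j $ 2 - n j $ 2 * n' j $ 1" for j
  define D where "D = m $ 1 * m' $ 2 - m $ 2 * m' $ 1"
  have \<Delta>: "\<Delta> \<longlonglongrightarrow> D" unfolding \<Delta>_def D_def by (intro tendsto_intros ni)
  have D0: "D \<noteq> 0" using B(2) by (simp add: D_def m_def m'_def)
  define s where "s j = sv (\<gamma> j)" for j
  have sp: "s j $ i > 0" for j i using sv_pos[OF g(1)] by (simp add: s_def)
  have sm: "s j $ 2 \<le> s j $ 1" "s j $ 3 \<le> s j $ 2" "s j $ 4 \<le> s j $ 3" for j
    using sv_mono[OF g(1)] by (simp_all add: s_def)
  have dl0: "(\<lambda>j. dl (\<gamma> j)) \<longlonglongrightarrow> 0" by (rule dl_tendsto_0[OF g(2)])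
  \<comment> \<open>Every such quotient is at most the quotient of the third by the second singular
    value, which \<open>dl\<close> bounds.\<close>
  have ratio: "(\<lambda>j. s j $ i / s j $ l) \<longlonglongrightarrow> 0" if "i = 3 \<or> i = 4" "l = 1 \<or> l = 2" for i l
  proof (rule Lim_null_comparison[OF always_eventually[OF allI] dl0])
    fix j
    have "s j $ i \<le> s j $ 3" "s j $ 2 \<le> s j $ l" using that sm[of j] by auto
    moreover have "s j $ 3 \<le> dl (\<gamma> j) * s j $ 2" unfolding s_def by (rule sv_ratio[OF g(1)])
    moreover have "dl (\<gamma> j) * s j $ 2 \<le> dl (\<gamma> j) * s j $ l" using calculation(2) by (simp add: dl_def)
    ultimately have "s j $ i \<le> dl (\<gamma> j) * s j $ l" by linarith
    then show "norm (s j $ i / s j $ l) \<le> dl (\<gamma> j)"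
      using sp[of j l] sp[of j i] by (simp add: divide_le_eq)
  qed
  \<comment> \<open>Cramer's rule: the coefficients for which the two leading coordinates of
    \<open>a j *\<^sub>R n j + b j *\<^sub>R n' j\<close> are \<open>u$1 / s j $ 1\<close> and
    \<open>u$2 / s j $ 2\<close>, so that \<open>diagonal (s j)\<close> restores u there
    exactly.\<close>
  define a where "a j = (u$1 / s j $ 1 * n' j $ 2 - u$2 / s j $ 2 * n' j $ 1) / \<Delta> j" for j
  define b where "b j = (u$2 / s j $ 2 * n j $ 1 - u$1 / s j $ 1 * n j $ 2) / \<Delta> j" for j
  define y where "y j = diagonal (s j) *v (a j *\<^sub>R n j + b j *\<^sub>R n' j)" for j
  have yi: "y j $ i = s j $ i * (a j * n j $ i + b j * n' j $ i)" for j i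
    by (simp add: y_def diagonal_mult_vec)
  \<comment> \<open>For the remaining j, division by zero makes both coefficients 0; the vectors
    still lie on the plane, so membership in X holds for every j.\<close>
  have ev: "\<forall>\<^sub>F j in sequentially. \<Delta> j \<noteq> 0" using \<Delta> D0 by (rule tendsto_imp_eventually_ne)
  have y1: "(\<lambda>j. y j $ 1) \<longlonglongrightarrow> u $ 1"
  proof (rule tendsto_eventually, rule eventually_mono[OF ev])
    fix j assume "\<Delta> j \<noteq> 0"
    have "a j * n j $ 1 + b j * n' j $ 1 = (u$1 / s j $ 1 * \<Delta> j) / \<Delta> j"
      by (simp add: a_def b_def \<Delta>_def algebra_simps flip: add_divide_distrib)
    then show "y j $ 1 = u $ 1" using \<open>\<Delta> j \<noteq> 0\<close> sp[of j 1] by (simp add: yi)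
  qed
  have y2: "(\<lambda>j. y j $ 2) \<longlonglongrightarrow> u $ 2"
  proof (rule tendsto_eventually, rule eventually_mono[OF ev])
    fix j assume "\<Delta> j \<noteq> 0"
    have "a j * n j $ 2 + b j * n' j $ 2 = (u$2 / s j $ 2 * \<Delta> j) / \<Delta> j"
      by (simp add: a_def b_def \<Delta>_def algebra_simps flip: add_divide_distrib)
    then show "y j $ 2 = u $ 2" using \<open>\<Delta> j \<noteq> 0\<close> sp[of j 2] by (simp add: yi)
  qed
  have y34: "(\<lambda>j. y j $ i) \<longlonglongrightarrow> 0" if i: "i = 3 \<or> i = 4" for i
  proof -
    note r = ratio[OF i, of 1, simplified] ratio[OF i, of 2, simplified]
    have "(\<lambda>j. (u$1 * (s j $ i / s j $ 1) * n' j $ 2 - u$2 * (s j $ i / s j $ 2) * n' j $ 1) / \<Delta> j * n j $ i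
       + (u$2 * (s j $ i / s j $ 2) * n j $ 1 - u$1 * (s j $ i / s j $ 1) * n j $ 2) / \<Delta> j * n' j $ i)
       \<longlonglongrightarrow> (u$1 * 0 * m' $ 2 - u$2 * 0 * m' $ 1) / D * m $ i + (u$2 * 0 * m $ 1 - u$1 * 0 * m $ 2) / D * m' $ i"
      by (intro tendsto_intros ni r \<Delta> D0)
    moreover have "(u$1 * (s j $ i / s j $ 1) * n' j $ 2 - u$2 * (s j $ i / s j $ 2) * n' j $ 1) / \<Delta> j * n j $ i
       + (u$2 * (s j $ i / s j $ 2) * n j $ 1 - u$1 * (s j $ i / s j $ 1) * n j $ 2) / \<Delta> j * n' j $ i = y j $ i" for j
      unfolding yi a_def b_def by (simp add: divide_inverse algebra_simps)
    ultimately show ?thesis by simp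
  qed
  have "(\<lambda>j. y j $ i) \<longlonglongrightarrow> u $ i" for i
    using exhaust_4[of i] y1 y2 y34[of 3] y34[of 4] u by (elim disjE) simp_all
  then have "y \<longlonglongrightarrow> u" by (rule vec_tendstoI)
  then have lim: "(\<lambda>j. left_factor (\<gamma> j) *v y j) \<longlonglongrightarrow> x" unfolding u(1) by (intro tendsto_matrix_vector_mult g(3))
  have mem: "left_factor (\<gamma> j) *v y j \<in> X" for j
  proof -
    have "\<gamma> j = left_factor (\<gamma> j) ** diagonal (s j) ** right_factor (\<gamma> j)"
      using sd[OF g(1)] unfolding singular_decomposition_def s_def by blast
    then have "\<gamma> j *v (B *v (a j *\<^sub>R f1 + b j *\<^sub>R f2)) = left_factor (\<gamma> j) *v (diagonal (s j) *v (right_factor (\<gamma> j) *v (B *v (a j *\<^sub>R f1 + b j *\<^sub>R f2))))"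
      by (metis matrix_vector_mul_assoc)
    also have "\<dots> = left_factor (\<gamma> j) *v y j"
      by (simp add: y_def n_def n'_def matrix_vector_right_distrib matrix_vector_mult_scaleR)
    finally show ?thesis using X(2)[OF g(1) X(2)[OF B(1) plane]] by metis
  qed
  show "x \<in> X" by (rule closed_sequentially[OF X(1) mem lim])
qed

section \<open>Minimality\<close>

lemma span_singleton_scaleR:
  assumes "c \<noteq> 0"
  shows "span {c *\<^sub>R w} = span {w}"
proof (rule antisym; rule span_minimal)
  show "{c *\<^sub>R w} \<subseteq> span {w}" by (simp add: span_base span_scale)
  have "w = inverse c *\<^sub>R (c *\<^sub>R w)" using assms by simp
  also have "\<dots> \<in> span {c *\<^sub>R w}" by (intro span_scale span_base) simp
  finally show "{w} \<subseteq> span {c *\<^sub>R w}" by simp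
qed simp_all

text \<open>An open set of lines pulls back to an open set of nonzero vectors, which meets the dense
  set. The scalar found there is nonzero, so its line belongs to the orbit.\<close>

lemma RP3_dense_orbit:
  assumes v: "v \<noteq> 0" and dense: "\<And>x. x \<in> closure {c *\<^sub>R (g *v v) | c g. g \<in> \<Gamma>}"
  shows "RP3 closure_of ((\<lambda>g. (*v) g ` span {v}) ` \<Gamma>) = topspace RP3"
proof (rule antisym[OF closure_of_subset_topspace], rule subsetI)
  fix L assume L: "L \<in> topspace RP3"
  then obtain x where x: "x \<noteq> 0" "L = span {x}"
    by (auto simp: RP3_def topspace_quotient_topology)
  have "\<exists>y\<in>(\<lambda>g. (*v) g ` span {v}) ` \<Gamma>. y \<in> T" if T: "L \<in> T" "openin RP3 T" for T
  proof -
    have "openin (top_of_set {v. v \<noteq> 0}) {y \<in> topspace (top_of_set {v. v \<noteq> 0}). span {y} \<in> T}"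
      using T(2) unfolding RP3_def openin_quotient_topology by blast
    moreover have "open {v :: real^4. v \<noteq> 0}" by (simp add: open_Collect_neq)
    ultimately have "open {y. y \<noteq> 0 \<and> span {y} \<in> T}" by (simp add: openin_open_eq)
    moreover have "x \<in> {y. y \<noteq> 0 \<and> span {y} \<in> T}" using x T(1) by simp
    ultimately obtain y where "y \<in> {c *\<^sub>R (g *v v) | c g. g \<in> \<Gamma>}" and yT: "y \<noteq> 0" "span {y} \<in> T"
      using dense[of x] unfolding closure_iff_nhds_not_empty by blast
    then obtain c g where y: "y = c *\<^sub>R (g *v v)" "g \<in> \<Gamma>" by blast
    have "c \<noteq> 0" using yT(1) y(1) by auto
    then have "span {y} = span {g *v v}" by (simp add: y(1) span_singleton_scaleR)
    also have "\<dots> = (*v) g ` span {v}" using linear_span_image[of "(*v) g" "{v}"] by simp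
    finally show ?thesis using yT(2) y(2) by auto
  qed
  then show "L \<in> RP3 closure_of ((\<lambda>g. (*v) g ` span {v}) ` \<Gamma>)"
    using L by (auto simp: in_closure_of)
qed

theorem corollary5:
  fixes \<Gamma> H :: "(real^4^4) set"
  assumes "P2_Anosov \<Gamma>"
    and "subtopology Gr2 (limit_set2 \<Gamma>) homeomorphic_space top_of_set (sphere (0 :: real^3) 1)"
    and "conjugate_tau_image H"
    and "zariski_dense_in (\<Gamma> \<inter> H) H"
  shows "minimal_on_RP3 \<Gamma>"
proof -
  obtain S c C where "subgroup \<Gamma> SL4" "finite S" "S \<subseteq> \<Gamma>" "generate SL4 S = \<Gamma>" "c > 0" "C > 0"
    "\<And>\<gamma>. \<gamma> \<in> \<Gamma> \<Longrightarrow> ln (singular_values \<gamma> $ 2 / singular_values \<gamma> $ 3) \<ge> c * real (word_length S \<gamma>) - C"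
    using assms(1) unfolding P2_Anosov_def by blast
  then interpret anosov_group \<Gamma> S c C by (rule anosov_group.intro)
  obtain h where h: "h \<in> carrier SL4" "H = (\<lambda>A. h ** tau A ** matrix_inv h) ` SL2C"
    using assms(3) unfolding conjugate_tau_image_def by blast
  obtain \<phi> \<psi> \<mu> where coords: "dense_coords \<Gamma> H \<phi> \<psi>" and \<mu>: "norm \<mu> > 1"
    "\<exists>B\<in>\<Gamma>. \<forall>x. \<phi> (B *v x) = vector [\<mu> * \<phi> x $ 1, inverse \<mu> * \<phi> x $ 2]"
    using loxodromic_coordinates[OF h assms(4)] .
  have sub: "limit_set2 \<Gamma> \<subseteq> topspace Gr2"
    by (auto simp: limit_set2_def dest!: limitin_topspace)
  have "RP3 closure_of ((\<lambda>g. (*v) g ` L) ` \<Gamma>) = topspace RP3" if L: "L \<in> topspace RP3" for L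
  proof -
    obtain v where v: "v \<noteq> 0" "L = span {v}"
      using L by (auto simp: RP3_def topspace_quotient_topology)
    \<comment> \<open>The union of the lines of the orbit. Its closure is the closed invariant cone
      to which all the previous results are applied.\<close>
    define Y where "Y = {c *\<^sub>R (g *v v) | c g. g \<in> \<Gamma>}"
    have cl: "f x \<in> closure Y" if "linear f" "\<And>x. x \<in> Y \<Longrightarrow> f x \<in> Y" "x \<in> closure Y" for f :: "real^4 \<Rightarrow> real^4" and x
    proof -
      have "f ` closure Y \<subseteq> closure (f ` Y)" by (rule closure_linear_image_subset[OF that(1)])
      also have "\<dots> \<subseteq> closure Y" using that(2) by (intro closure_mono) blast
      finally show ?thesis using that(3) by blast
    qed
    have scale: "a *\<^sub>R x \<in> closure Y" if "x \<in> closure Y" for a x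
    proof (rule cl[OF _ _ that])
      show "linear (\<lambda>x. a *\<^sub>R x)" by (rule linear_scale_self)
      show "a *\<^sub>R x \<in> Y" if x: "x \<in> Y" for x
      proof -
        obtain c g where "x = c *\<^sub>R (g *v v)" "g \<in> \<Gamma>" using x unfolding Y_def by blast
        then have "a *\<^sub>R x = (a * c) *\<^sub>R (g *v v)" by simp
        then show ?thesis using \<open>g \<in> \<Gamma>\<close> unfolding Y_def by blast
      qed
    qed
    have act: "B *v x \<in> closure Y" if "B \<in> \<Gamma>" "x \<in> closure Y" for B x
    proof (rule cl[OF _ _ that(2)])
      show "linear ((*v) B)" by simp
      show "B *v x \<in> Y" if x: "x \<in> Y" for x
      proof -
        obtain c g where "x = c *\<^sub>R (g *v v)" "g \<in> \<Gamma>" using x unfolding Y_def by blast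
        then have "B *v x = c *\<^sub>R ((B ** g) *v v)" "B ** g \<in> \<Gamma>"
          using \<open>B \<in> \<Gamma>\<close> by (simp_all add: matrix_vector_mult_scaleR matrix_vector_mul_assoc)
        then show ?thesis unfolding Y_def by blast
      qed
    qed
    have "v = 1 *\<^sub>R (mat 1 *v v)" by simp
    then have "v \<in> Y" unfolding Y_def by blast
    then have "v \<in> closure Y" using closure_subset by blast
    then have cone: "invariant_cone \<Gamma> H \<phi> \<psi> (closure Y) \<mu> v"
      using coords \<mu> v(1) scale act
      unfolding invariant_cone_def invariant_cone_axioms_def by blast
    have W: "W \<subseteq> closure Y" if "W \<in> limit_set2 \<Gamma>" for W
    proof (rule limit_plane_subset[OF that closed_closure act])
      show "a *\<^sub>R \<psi> (axis 1 1) + b *\<^sub>R \<psi> (axis 1 \<i>) \<in> closure Y" for a b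
      proof -
        \<comment> \<open>1 and \<i> span the attracting complex line over the reals, so its real
          plane is the one fed into \<open>limit_plane_subset\<close>.\<close>
        have l: "linear (\<lambda>y. \<psi> (axis 1 y))" by (rule invariant_cone.linear_line[OF cone])
        have "a *\<^sub>R \<psi> (axis 1 1) + b *\<^sub>R \<psi> (axis 1 \<i>) = \<psi> (axis 1 (a *\<^sub>R 1 + b *\<^sub>R \<i>))"
          by (simp only: linear_add[OF l] linear_scale[OF l])
        then show ?thesis using invariant_cone.line_subset[OF cone] by simp
      qed
      show "\<exists>B\<in>\<Gamma>. (k *v (B *v \<psi> (axis 1 1))) $ 1 * (k *v (B *v \<psi> (axis 1 \<i>))) $ 2
          \<noteq> (k *v (B *v \<psi> (axis 1 1))) $ 2 * (k *v (B *v \<psi> (axis 1 \<i>))) $ 1"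
        if "orthogonal_matrix k" for k
        using dense_coords.exists_transverse_translate[OF coords that] by blast
    qed
    have "x \<in> closure Y" for x
    proof (cases "x = 0")
      case True
      then show ?thesis using scale[OF \<open>v \<in> closure Y\<close>, of 0] by simp
    next
      case False
      have "\<exists>W\<in>limit_set2 \<Gamma>. x \<in> W"
        by (rule sphere_of_planes_covers[OF sub assms(2) _ False]) (rule limit_set_transverse)
      then obtain W where "W \<in> limit_set2 \<Gamma>" "x \<in> W" by blast
      then show ?thesis using W by blast
    qed
    then show ?thesis using RP3_dense_orbit[OF v(1)] unfolding v(2) Y_def by blast
  qed
  then show ?thesis by (simp add: minimal_on_RP3_def)
qed

end
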